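(* Let $(X,\mathcal A,\nu)$ be a $\sigma$-finite measure space and let $H$ be a reproducing kernel Hilbert space on $X$ with bounded measurable kernel $k$ such that $H$ is compactly embedded into $L^2(\nu)$. Let $0<\theta<1$ and $1\le r\le\infty$ be such that the embedding $[H]_\sim^{(\theta,r)}\hookrightarrow L^\infty(\nu)$ exists and is continuous. Then there is a Banach space of functions $\overline H_\nu^{(\theta,r)}$ on $X$ such that the operator $$\overline H_\nu^{(\theta,r)}\to[H]_\sim^{(\theta,r)},\qquad f\mapsto[f]_\sim$$ is a well-defined isometric isomorphism, with $$\left\|\overline H_\nu^{(\theta,r)}\hookrightarrow\mathcal L^\infty(X)\right\|=\left\|[H]_\sim^{(\theta,r)}\hookrightarrow L^\infty(\nu)\right\|.$$ Additionally, there is a $\nu$-null set $N\subset X$ such that for all $f\in\overline H_\nu^{(\theta,r)}$ there is a $(b_i)_{i\in I}\in\ell^{(\mu,\theta,r)}$ such that $f(x)=\sum_{i\in I}b_ie_i(x)$ for all $x\in X\setminus N$.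
   Context: All vector spaces are real. $[f]_\sim$ denotes the $\nu$-a.e. equivalence class of a measurable $f:X\to\mathbb R$. $\mathcal L^\infty(X)$ is the space of bounded measurable functions $X\to\mathbb R$ with the supremum norm; $L^\infty(\nu)$ is the usual space of classes of essentially bounded functions. A Banach space of functions (BSF) on $X$ is a Banach space whose elements are functions $X\to\mathbb R$ and for which every evaluation functional $f\mapsto f(x)$, $x\in X$, is bounded. For normed spaces, $E\hookrightarrow F$ means $E\subset F$ with continuous inclusion, and $\|E\hookrightarrow F\|$ is the operator norm of the inclusion. $H$ being compactly embedded into $L^2(\nu)$ means that $I_k:H\to L^2(\nu)$, $f\mapsto[f]_\sim$, is a well-defined compact operator. Put $T_k:=I_kI_k^*:L^2(\nu)\to L^2(\nu)$. Its non-zero eigenvalues (with multiplicity) in non-increasing order are $(\mu_i)_{i\in I}$, with $I=\{1,\dots,n\}$ or $I=\mathbb N$; so $\mu_i>0$. There are functions $e_i\in H$ such that $([e_i]_\sim)_{i\in I}$ is an orthonormal system in $L^2(\nu)$ with $T_k[e_i]_\sim=\mu_i[e_i]_\sim$ and $(\sqrt{\mu_i}\,e_i)_{i\in I}$ is an orthonormal system in $H$; such functions are fixed. For $j\in\mathbb Z$ let $M_j:=\{i\in I:2^j<\mu_i\le2^{j+1}\}$. For a real sequence $b=(b_i)_{i\in I}$ put $c_j(b):=\left(\sum_{i\in M_j}b_i^2\mu_i^{-\theta}\right)^{1/2}$, $\|b\|_{(\mu,\theta,r)}:=\|(c_j(b))_{j\in\mathbb Z}\|_{\ell^r(\mathbb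 Z)}$ and $\ell^{(\mu,\theta,r)}:=\{b:\|b\|_{(\mu,\theta,r)}<\infty\}$. The power space is $[H]_\sim^{(\theta,r)}:=\{f\in L^2(\nu):\exists b\in\ell^{(\mu,\theta,r)}\text{ with }f=\sum_{i\in I}b_i[e_i]_\sim\}$ (series convergent in $L^2(\nu)$), with norm $\left\|\sum_{i\in I}b_i[e_i]_\sim\right\|_{[H]_\sim^{(\theta,r)}}:=\|b\|_{(\mu,\theta,r)}$. *)

theory Defs
  imports "HOL-Analysis.Analysis" "HOL-Probability.Essential_Supremum"
begin

section \<open>Normed and inner product spaces with explicit carriers\<close>

record 'v nspace =
  vcarrier :: "'v set"
  vzero :: "'v"
  vadd :: "'v \<Rightarrow> 'v \<Rightarrow> 'v"
  vscale :: "real \<Rightarrow> 'v \<Rightarrow> 'v"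
  vnorm :: "'v \<Rightarrow> real"

record 'v ipspace = "'v nspace" +
  vinner :: "'v \<Rightarrow> 'v \<Rightarrow> real"

locale real_vspace =
  fixes V :: "('v, 'z) nspace_scheme"
  assumes zero_closed: "vzero V \<in> vcarrier V"
    and add_closed: "\<lbrakk>u \<in> vcarrier V; v \<in> vcarrier V\<rbrakk> \<Longrightarrow> vadd V u v \<in> vcarrier V"
    and scale_closed: "v \<in> vcarrier V \<Longrightarrow> vscale V a v \<in> vcarrier V"
    and add_assoc: "\<lbrakk>u \<in> vcarrier V; v \<in> vcarrier V; w \<in> vcarrier V\<rbrakk>
          \<Longrightarrow> vadd V (vadd V u v) w = vadd V u (vadd V v w)"
    and add_commute: "\<lbrakk>u \<in> vcarrier V; v \<in> vcarrier V\<rbrakk> \<Longrightarrow> vadd V u v = vadd V v u"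
    and add_zero: "v \<in> vcarrier V \<Longrightarrow> vadd V (vzero V) v = v"
    and add_inverse: "v \<in> vcarrier V \<Longrightarrow> vadd V v (vscale V (-1) v) = vzero V"
    and scale_add_right: "\<lbrakk>u \<in> vcarrier V; v \<in> vcarrier V\<rbrakk>
          \<Longrightarrow> vscale V a (vadd V u v) = vadd V (vscale V a u) (vscale V a v)"
    and scale_add_left: "v \<in> vcarrier V
          \<Longrightarrow> vscale V (a + b) v = vadd V (vscale V a v) (vscale V b v)"
    and scale_scale: "v \<in> vcarrier V \<Longrightarrow> vscale V a (vscale V b v) = vscale V (a * b) v"
    and scale_one: "v \<in> vcarrier V \<Longrightarrow> vscale V 1 v = v"

locale normed_vspace = real_vspace +
  assumes norm_nonneg: "v \<in> vcarrier V \<Longrightarrow> 0 \<le> vnorm V v"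
    and norm_eq_0: "v \<in> vcarrier V \<Longrightarrow> vnorm V v = 0 \<longleftrightarrow> v = vzero V"
    and norm_scale: "v \<in> vcarrier V \<Longrightarrow> vnorm V (vscale V a v) = \<bar>a\<bar> * vnorm V v"
    and norm_triangle: "\<lbrakk>u \<in> vcarrier V; v \<in> vcarrier V\<rbrakk>
          \<Longrightarrow> vnorm V (vadd V u v) \<le> vnorm V u + vnorm V v"

text \<open>Outside the carrier the distance is set to 0, because \<^locale>\<open>Metric_space\<close> demands
  symmetry and nonnegativity on the whole type.\<close>

definition vdist :: "('v, 'z) nspace_scheme \<Rightarrow> 'v \<Rightarrow> 'v \<Rightarrow> real" where
  "vdist V u v = (if u \<in> vcarrier V \<and> v \<in> vcarrier V
                  then vnorm V (vadd V u (vscale V (-1) v)) else 0)"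

definition vtopology :: "('v, 'z) nspace_scheme \<Rightarrow> 'v topology" where
  "vtopology V = Metric_space.mtopology (vcarrier V) (vdist V)"

definition banach_vspace :: "('v, 'z) nspace_scheme \<Rightarrow> bool" where
  "banach_vspace V \<longleftrightarrow> normed_vspace V \<and> Metric_space.mcomplete (vcarrier V) (vdist V)"

definition hilbert_vspace :: "('v, 'z) ipspace_scheme \<Rightarrow> bool" where
  "hilbert_vspace V \<longleftrightarrow> banach_vspace V \<and>
     (\<forall>u\<in>vcarrier V. \<forall>v\<in>vcarrier V. vinner V u v = vinner V v u) \<and>
     (\<forall>u\<in>vcarrier V. \<forall>v\<in>vcarrier V. \<forall>w\<in>vcarrier V.
        vinner V (vadd V u v) w = vinner V u w + vinner V v w) \<and>
     (\<forall>a. \<forall>u\<in>vcarrier V. \<forall>v\<in>vcarrier V. vinner V (vscale V a u) v = a * vinner V u v) \<and>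
     (\<forall>u\<in>vcarrier V. 0 \<le> vinner V u u \<and> vnorm V u = sqrt (vinner V u u))"

definition vunit_ball :: "('v, 'z) nspace_scheme \<Rightarrow> 'v set" where
  "vunit_ball V = {v \<in> vcarrier V. vnorm V v \<le> 1}"

definition vlinear ::
  "('v, 'z) nspace_scheme \<Rightarrow> ('w, 'y) nspace_scheme \<Rightarrow> ('v \<Rightarrow> 'w) \<Rightarrow> bool" where
  "vlinear E F T \<longleftrightarrow>
     T ` vcarrier E \<subseteq> vcarrier F \<and>
     (\<forall>u\<in>vcarrier E. \<forall>v\<in>vcarrier E. T (vadd E u v) = vadd F (T u) (T v)) \<and>
     (\<forall>a. \<forall>u\<in>vcarrier E. T (vscale E a u) = vscale F a (T u))"

definition compact_operator ::
  "('v, 'z) nspace_scheme \<Rightarrow> ('w, 'y) nspace_scheme \<Rightarrow> ('v \<Rightarrow> 'w) \<Rightarrow> bool" where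
  "compact_operator E F T \<longleftrightarrow> vlinear E F T \<and>
     compactin (vtopology F) (vtopology F closure_of (T ` vunit_ball E))"

definition isometric_iso ::
  "('v, 'z) nspace_scheme \<Rightarrow> ('w, 'y) nspace_scheme \<Rightarrow> ('v \<Rightarrow> 'w) \<Rightarrow> bool" where
  "isometric_iso E F T \<longleftrightarrow> vlinear E F T \<and> bij_betw T (vcarrier E) (vcarrier F) \<and>
     (\<forall>v\<in>vcarrier E. vnorm F (T v) = vnorm E v)"

definition operator_norm ::
  "('v, 'z) nspace_scheme \<Rightarrow> ('w, 'y) nspace_scheme \<Rightarrow> ('v \<Rightarrow> 'w) \<Rightarrow> real" where
  "operator_norm E F T = (SUP v\<in>vunit_ball E. vnorm F (T v))"

definition embeds :: "('v, 'z) nspace_scheme \<Rightarrow> ('v, 'y) nspace_scheme \<Rightarrow> bool" where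
  "embeds E F \<longleftrightarrow> vcarrier E \<subseteq> vcarrier F \<and>
     continuous_map (vtopology E) (vtopology F) (\<lambda>v. v)"

definition embedding_norm :: "('v, 'z) nspace_scheme \<Rightarrow> ('v, 'y) nspace_scheme \<Rightarrow> real" where
  "embedding_norm E F = operator_norm E F (\<lambda>v. v)"

definition adjoint_op ::
  "('v, 'z) ipspace_scheme \<Rightarrow> ('w, 'y) ipspace_scheme \<Rightarrow> ('v \<Rightarrow> 'w) \<Rightarrow> 'w \<Rightarrow> 'v" where
  "adjoint_op E F T w = (THE v. v \<in> vcarrier E \<and>
     (\<forall>u\<in>vcarrier E. vinner F (T u) w = vinner E u v))"

primrec vpartial_sum :: "('v, 'z) nspace_scheme \<Rightarrow> (nat \<Rightarrow> 'v) \<Rightarrow> nat \<Rightarrow> 'v" where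
  "vpartial_sum V a 0 = vzero V"
| "vpartial_sum V a (Suc n) = vadd V (vpartial_sum V a n) (a n)"

definition vsums :: "('v, 'z) nspace_scheme \<Rightarrow> (nat \<Rightarrow> 'v) \<Rightarrow> 'v \<Rightarrow> bool" where
  "vsums V a s \<longleftrightarrow> limitin (vtopology V) (vpartial_sum V a) s sequentially"

definition vorthonormal :: "('v, 'z) ipspace_scheme \<Rightarrow> nat set \<Rightarrow> (nat \<Rightarrow> 'v) \<Rightarrow> bool" where
  "vorthonormal V I a \<longleftrightarrow> (\<forall>i\<in>I. a i \<in> vcarrier V) \<and>
     (\<forall>i\<in>I. \<forall>j\<in>I. vinner V (a i) (a j) = (if i = j then 1 else 0))"

definition eigenspace :: "('v, 'z) nspace_scheme \<Rightarrow> ('v \<Rightarrow> 'v) \<Rightarrow> real \<Rightarrow> 'v set" where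
  "eigenspace V T l = {v \<in> vcarrier V. T v = vscale V l v}"

definition has_dim :: "('v, 'z) nspace_scheme \<Rightarrow> 'v set \<Rightarrow> nat \<Rightarrow> bool" where
  "has_dim V S n \<longleftrightarrow> (\<exists>v. (\<forall>i<n. v i \<in> S) \<and>
     (\<forall>w\<in>S. \<exists>!c. c \<in> extensional {..<n} \<and> w = vpartial_sum V (\<lambda>i. vscale V (c i) (v i)) n))"

section \<open>Spaces of functions on \<open>X\<close>\<close>

text \<open>A function \<open>X \<rightarrow> \<real>\<close> is encoded as an element of \<^term>\<open>extensional X\<close>.\<close>

definition function_space :: "'a set \<Rightarrow> ('a \<Rightarrow> real, 'z) nspace_scheme \<Rightarrow> bool" where
  "function_space X V \<longleftrightarrow>
     vcarrier V \<subseteq> extensional X \<and>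
     vzero V = (\<lambda>x\<in>X. 0) \<and>
     (\<forall>f\<in>vcarrier V. \<forall>g\<in>vcarrier V. vadd V f g = (\<lambda>x\<in>X. f x + g x)) \<and>
     (\<forall>a. \<forall>f\<in>vcarrier V. vscale V a f = (\<lambda>x\<in>X. a * f x))"

definition BSF :: "'a set \<Rightarrow> ('a \<Rightarrow> real, 'z) nspace_scheme \<Rightarrow> bool" where
  "BSF X V \<longleftrightarrow> function_space X V \<and> banach_vspace V \<and>
     (\<forall>x\<in>X. \<exists>C. \<forall>f\<in>vcarrier V. \<bar>f x\<bar> \<le> C * vnorm V f)"

definition RKHS ::
  "'a set \<Rightarrow> ('a \<Rightarrow> real, 'z) ipspace_scheme \<Rightarrow> ('a \<Rightarrow> 'a \<Rightarrow> real) \<Rightarrow> bool" where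
  "RKHS X H k \<longleftrightarrow> function_space X H \<and> hilbert_vspace H \<and>
     (\<forall>x\<in>X. restrict (k x) X \<in> vcarrier H \<and>
        (\<forall>f\<in>vcarrier H. f x = vinner H f (restrict (k x) X)))"

definition measurable_functions :: "'a measure \<Rightarrow> ('a \<Rightarrow> real) set" where
  "measurable_functions M = borel_measurable M \<inter> extensional (space M)"

text \<open>Inserting 0 gives the supremum norm the value 0 when the space is empty.\<close>

definition bounded_functions :: "'a measure \<Rightarrow> ('a \<Rightarrow> real) nspace" where
  "bounded_functions M =
     \<lparr> vcarrier = {f \<in> measurable_functions M. bounded (f ` space M)},
       vzero = (\<lambda>x\<in>space M. 0),
       vadd = (\<lambda>f g. \<lambda>x\<in>space M. f x + g x),
       vscale = (\<lambda>a f. \<lambda>x\<in>space M. a * f x),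
       vnorm = (\<lambda>f. Sup (insert 0 ((\<lambda>x. \<bar>f x\<bar>) ` space M))) \<rparr>"

section \<open>Spaces of almost-everywhere classes\<close>

definition ae_class :: "'a measure \<Rightarrow> ('a \<Rightarrow> real) \<Rightarrow> ('a \<Rightarrow> real) set" where
  "ae_class M f = {g \<in> measurable_functions M. AE x in M. g x = f x}"

definition rep :: "('a \<Rightarrow> real) set \<Rightarrow> 'a \<Rightarrow> real" where
  "rep c = (SOME f. f \<in> c)"

definition class_add ::
  "'a measure \<Rightarrow> ('a \<Rightarrow> real) set \<Rightarrow> ('a \<Rightarrow> real) set \<Rightarrow> ('a \<Rightarrow> real) set" where
  "class_add M c d = ae_class M (\<lambda>x. rep c x + rep d x)"

definition class_scale ::
  "'a measure \<Rightarrow> real \<Rightarrow> ('a \<Rightarrow> real) set \<Rightarrow> ('a \<Rightarrow> real) set" where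
  "class_scale M a c = ae_class M (\<lambda>x. a * rep c x)"

definition square_integrable_functions :: "'a measure \<Rightarrow> ('a \<Rightarrow> real) set" where
  "square_integrable_functions M =
     {f \<in> measurable_functions M. integrable M (\<lambda>x. (f x)\<^sup>2)}"

definition L2 :: "'a measure \<Rightarrow> ('a \<Rightarrow> real) set ipspace" where
  "L2 M =
     \<lparr> vcarrier = ae_class M ` square_integrable_functions M,
       vzero = ae_class M (\<lambda>x. 0),
       vadd = class_add M,
       vscale = class_scale M,
       vnorm = (\<lambda>c. sqrt (\<integral>x. (rep c x)\<^sup>2 \<partial>M)),
       vinner = (\<lambda>c d. \<integral>x. rep c x * rep d x \<partial>M) \<rparr>"

text \<open>If \<open>M\<close> is the zero measure, the essential supremum is \<open>-\<infinity>\<close>, which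
  \<^const>\<open>real_of_ereal\<close> maps to 0.\<close>

definition L_infinity :: "'a measure \<Rightarrow> ('a \<Rightarrow> real) set nspace" where
  "L_infinity M =
     \<lparr> vcarrier = ae_class M ` {f \<in> measurable_functions M. \<exists>C. AE x in M. \<bar>f x\<bar> \<le> C},
       vzero = ae_class M (\<lambda>x. 0),
       vadd = class_add M,
       vscale = class_scale M,
       vnorm = (\<lambda>c. real_of_ereal (esssup M (\<lambda>x. ereal \<bar>rep c x\<bar>))) \<rparr>"

section \<open>The integral operator and its eigensystem\<close>

text \<open>The first conjunct makes \<open>f \<mapsto> [f]\<close> well defined: \<^const>\<open>ae_class\<close> is total, but
  represents the class of \<open>f\<close> only for measurable \<open>f\<close>.\<close>

definition compactly_embedded_L2 ::
  "'a measure \<Rightarrow> ('a \<Rightarrow> real, 'z) ipspace_scheme \<Rightarrow> bool" where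
  "compactly_embedded_L2 M H \<longleftrightarrow> vcarrier H \<subseteq> square_integrable_functions M \<and>
     compact_operator H (L2 M) (ae_class M)"

definition T_op :: "'a measure \<Rightarrow> ('a \<Rightarrow> real, 'z) ipspace_scheme
    \<Rightarrow> ('a \<Rightarrow> real) set \<Rightarrow> ('a \<Rightarrow> real) set" where
  "T_op M H c = ae_class M (adjoint_op H (L2 M) (ae_class M) c)"

text \<open>The condition on \<^const>\<open>has_dim\<close> says that every \<open>l \<noteq> 0\<close> is listed exactly as often as
  its multiplicity; for \<open>l\<close> not an eigenvalue both sides are 0. The index set is empty
  (\<open>n = 0\<close>) if the operator vanishes.\<close>

definition eigensystem :: "'a measure \<Rightarrow> ('a \<Rightarrow> real, 'z) ipspace_scheme
    \<Rightarrow> nat set \<Rightarrow> (nat \<Rightarrow> real) \<Rightarrow> (nat \<Rightarrow> 'a \<Rightarrow> real) \<Rightarrow> bool" where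
  "eigensystem M H I \<mu> e \<longleftrightarrow>
     ((\<exists>n. I = {1..n}) \<or> I = {1..}) \<and>
     (\<forall>i\<in>I. \<mu> i \<noteq> 0) \<and>
     (\<forall>i\<in>I. \<forall>j\<in>I. i \<le> j \<longrightarrow> \<mu> j \<le> \<mu> i) \<and>
     (\<forall>l. l \<noteq> 0 \<longrightarrow> finite {i \<in> I. \<mu> i = l} \<and>
        has_dim (L2 M) (eigenspace (L2 M) (T_op M H) l) (card {i \<in> I. \<mu> i = l})) \<and>
     (\<forall>i\<in>I. e i \<in> vcarrier H) \<and>
     vorthonormal (L2 M) I (\<lambda>i. ae_class M (e i)) \<and>
     (\<forall>i\<in>I. T_op M H (ae_class M (e i)) = vscale (L2 M) (\<mu> i) (ae_class M (e i))) \<and>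
     vorthonormal H I (\<lambda>i. vscale H (sqrt (\<mu> i)) (e i))"

section \<open>Power spaces\<close>

definition lr_finite :: "ereal \<Rightarrow> ('j \<Rightarrow> real) \<Rightarrow> bool" where
  "lr_finite r c = (if r = \<infinity> then bdd_above (range (\<lambda>j. \<bar>c j\<bar>))
                    else (\<lambda>j. \<bar>c j\<bar> powr real_of_ereal r) summable_on UNIV)"

definition lr_norm :: "ereal \<Rightarrow> ('j \<Rightarrow> real) \<Rightarrow> real" where
  "lr_norm r c = (if r = \<infinity> then (SUP j. \<bar>c j\<bar>)
                  else (\<Sum>\<^sub>\<infinity>j. \<bar>c j\<bar> powr real_of_ereal r) powr (1 / real_of_ereal r))"

text \<open>The index set of the sum is finite for every \<open>j\<close>, since the eigenvalues of a compact
  operator do not accumulate away from 0.\<close>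

definition block_norm ::
  "nat set \<Rightarrow> (nat \<Rightarrow> real) \<Rightarrow> real \<Rightarrow> (nat \<Rightarrow> real) \<Rightarrow> int \<Rightarrow> real" where
  "block_norm I \<mu> \<theta> b j =
     sqrt (\<Sum>i\<in>{i \<in> I. 2 powi j < \<mu> i \<and> \<mu> i \<le> 2 powi (j + 1)}. (b i)\<^sup>2 * \<mu> i powr (-\<theta>))"

definition seq_norm ::
  "nat set \<Rightarrow> (nat \<Rightarrow> real) \<Rightarrow> real \<Rightarrow> ereal \<Rightarrow> (nat \<Rightarrow> real) \<Rightarrow> real" where
  "seq_norm I \<mu> \<theta> r b = lr_norm r (block_norm I \<mu> \<theta> b)"

text \<open>Only the values of \<open>b\<close> on \<open>I\<close> matter.\<close>

definition seq_space ::
  "nat set \<Rightarrow> (nat \<Rightarrow> real) \<Rightarrow> real \<Rightarrow> ereal \<Rightarrow> (nat \<Rightarrow> real) set" where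
  "seq_space I \<mu> \<theta> r = {b. lr_finite r (block_norm I \<mu> \<theta> b)}"

definition class_expansion :: "'a measure \<Rightarrow> nat set \<Rightarrow> (nat \<Rightarrow> 'a \<Rightarrow> real)
    \<Rightarrow> (nat \<Rightarrow> real) \<Rightarrow> ('a \<Rightarrow> real) set \<Rightarrow> bool" where
  "class_expansion M I e b c \<longleftrightarrow>
     vsums (L2 M)
       (\<lambda>i. if i \<in> I then vscale (L2 M) (b i) (ae_class M (e i)) else vzero (L2 M)) c"

text \<open>The norm is well defined: the \<open>e i\<close> are orthonormal, so the coefficients \<open>b i\<close> with
  \<open>i \<in> I\<close> are determined by \<open>c\<close>.\<close>

definition power_space :: "'a measure \<Rightarrow> nat set \<Rightarrow> (nat \<Rightarrow> real) \<Rightarrow> (nat \<Rightarrow> 'a \<Rightarrow> real)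
    \<Rightarrow> real \<Rightarrow> ereal \<Rightarrow> ('a \<Rightarrow> real) set nspace" where
  "power_space M I \<mu> e \<theta> r =
     \<lparr> vcarrier = {c \<in> vcarrier (L2 M). \<exists>b\<in>seq_space I \<mu> \<theta> r. class_expansion M I e b c},
       vzero = vzero (L2 M),
       vadd = vadd (L2 M),
       vscale = vscale (L2 M),
       vnorm = (\<lambda>c. THE s. \<exists>b\<in>seq_space I \<mu> \<theta> r.
                  class_expansion M I e b c \<and> s = seq_norm I \<mu> \<theta> r b) \<rparr>"

end

theory Submission
  imports Defs
begin

text \<open>
  Let \<open>K\<close> be the norm of the embedding of the power space into \<^term>\<open>L_infinity M\<close>. The idea is to
  choose for every coefficient sequence \<open>b\<close> of finite norm the pointwise sum of the series of the
  \<open>b i * e i x\<close> as the representative of its class, after showing that this series converges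
  absolutely outside one null set that serves all sequences simultaneously.

  Write \<open>norm b\<close> for \<^term>\<open>seq_norm I \<mu> \<theta> r b\<close>. For a finitely supported \<open>b\<close>, the embedding
  bounds the absolute value of the sum at \<open>x\<close> by
  \<open>K * norm b\<close> for almost all \<open>x\<close>. There are only countably many finitely supported rational
  sequences, so the bound holds for all of them outside one null set \<open>N\<close>. The norm of \<open>b\<close> depends only
  on the absolute values of the \<open>b i\<close>, and monotonically. At a fixed point \<open>x\<close> outside \<open>N\<close> one may
  therefore match the signs of the coefficients to those of the \<open>e i x\<close> and approximate from below
  by rationals; this bounds even the sum of the \<open>\<bar>b i * e i x\<bar>\<close> by \<open>K * norm b\<close>, for every sequence of
  finite norm (\<open>sum_abs_summand_le\<close>). Hence the series converges absolutely outside \<open>N\<close>. With the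
  value 0 on \<open>N\<close>, its sum is a measurable function bounded by \<open>K * norm b\<close> everywhere
  (\<open>pointwise_sum_bound\<close>).

  Sequences of finite norm are square summable (\<open>norm_le_summable_square\<close>). By Fatou's lemma the
  series then also converges in \<^term>\<open>L2 M\<close> to the class of the pointwise sum
  (\<open>pointwise_sum_class_expansion\<close>). Thus the coefficient space, the space of pointwise sums and the
  power space are isometric. The coefficient space is complete (\<open>coef_space_banach\<close>), hence so is the
  space of pointwise sums. The bound by \<open>K\<close>, together with the fact that an essential supremum is at
  most the supremum, gives the equality of the two embedding norms.

  All this rests on two properties of the eigenvalues: they are positive (\<open>eigenvalue_pos\<close>, by the
  Riesz representation theorem), and only finitely many of them exceed a given positive number
  (\<open>finite_eigenvalues_above\<close>, by compactness). The constant \<open>K\<close> exists because the power space is a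
  normed space (\<open>power_space_normed\<close>), so that continuity of the inclusion means boundedness.
\<close>

section \<open>Normed spaces with explicit carriers\<close>

abbreviation vdiff :: "('v, 'z) nspace_scheme \<Rightarrow> 'v \<Rightarrow> 'v \<Rightarrow> 'v" where
  "vdiff V u v \<equiv> vadd V u (vscale V (-1) v)"

context real_vspace
begin

lemma diff_closed: "\<lbrakk>u \<in> vcarrier V; v \<in> vcarrier V\<rbrakk> \<Longrightarrow> vdiff V u v \<in> vcarrier V"
  by (simp add: add_closed scale_closed)

lemma add_zero_right: "v \<in> vcarrier V \<Longrightarrow> vadd V v (vzero V) = v"
  using add_zero add_commute zero_closed by metis

lemma scale_zero_left: "v \<in> vcarrier V \<Longrightarrow> vscale V 0 v = vzero V"
  using scale_add_left[of v 1 "-1"] by (simp add: scale_one add_inverse)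

lemma scale_zero_right: "vscale V a (vzero V) = vzero V"
  using scale_zero_left[OF zero_closed] scale_scale[OF zero_closed, of a 0] by simp

lemma diff_add_cancel:
  assumes "u \<in> vcarrier V" "v \<in> vcarrier V"
  shows "vadd V (vdiff V u v) v = u"
proof -
  have "vadd V (vdiff V u v) v = vadd V u (vdiff V v v)"
    using assms by (simp add: add_assoc add_commute scale_closed)
  then show ?thesis using assms by (simp add: add_inverse add_zero_right)
qed

lemma diff_eq_zero_iff:
  assumes "u \<in> vcarrier V" "v \<in> vcarrier V"
  shows "vdiff V u v = vzero V \<longleftrightarrow> u = v"
  using assms diff_add_cancel[of u v] add_zero[of v] add_inverse by auto

lemma diff_triangle:
  assumes "u \<in> vcarrier V" "v \<in> vcarrier V" "w \<in> vcarrier V"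
  shows "vadd V (vdiff V u v) (vdiff V v w) = vdiff V u w"
  using diff_add_cancel[of u v] assms add_assoc[of "vdiff V u v" v "vscale V (-1) w"]
  by (simp add: scale_closed diff_closed)

lemma diff_flip:
  assumes "u \<in> vcarrier V" "v \<in> vcarrier V"
  shows "vscale V (-1) (vdiff V u v) = vdiff V v u"
  using assms by (simp add: scale_add_right scale_scale scale_closed scale_one add_commute)

end

text \<open>Homogeneity needs only one inequality, because scaling by \<open>a \<noteq> 0\<close> is inverted by scaling
  by \<open>1 / a\<close>.\<close>

lemma (in real_vspace) normed_vspaceI:
  assumes nonneg: "\<And>v. v \<in> vcarrier V \<Longrightarrow> 0 \<le> vnorm V v"
    and zero: "vnorm V (vzero V) = 0"
    and definite: "\<And>v. \<lbrakk>v \<in> vcarrier V; vnorm V v = 0\<rbrakk> \<Longrightarrow> v = vzero V"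
    and scale: "\<And>a v. v \<in> vcarrier V \<Longrightarrow> vnorm V (vscale V a v) \<le> \<bar>a\<bar> * vnorm V v"
    and triangle: "\<And>u v. \<lbrakk>u \<in> vcarrier V; v \<in> vcarrier V\<rbrakk>
          \<Longrightarrow> vnorm V (vadd V u v) \<le> vnorm V u + vnorm V v"
  shows "normed_vspace V"
proof
  fix a v assume v: "v \<in> vcarrier V"
  show "vnorm V (vscale V a v) = \<bar>a\<bar> * vnorm V v"
  proof (cases "a = 0")
    case True
    then show ?thesis using v by (simp add: scale_zero_left zero)
  next
    case False
    have "vnorm V v = vnorm V (vscale V (inverse a) (vscale V a v))"
      using False v by (simp add: scale_scale scale_one)
    also have "\<dots> \<le> \<bar>inverse a\<bar> * vnorm V (vscale V a v)"
      using v by (intro scale scale_closed)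
    finally have "\<bar>a\<bar> * vnorm V v \<le> vnorm V (vscale V a v)"
      using False by (simp add: abs_inverse field_simps)
    then show ?thesis using scale[OF v, of a] by simp
  qed
qed (use nonneg zero definite triangle in auto)

lemma (in normed_vspace) metric_space: "Metric_space (vcarrier V) (vdist V)"
proof
  fix x y z
  show "0 \<le> vdist V x y"
    by (simp add: vdist_def norm_nonneg diff_closed)
  have "vnorm V (vdiff V y x) = vnorm V (vdiff V x y)" if "x \<in> vcarrier V" "y \<in> vcarrier V"
    using that norm_scale[OF diff_closed[OF that], of "-1"] by (simp add: diff_flip)
  then show "vdist V x y = vdist V y x"
    by (simp add: vdist_def)
  show "vdist V x y = 0 \<longleftrightarrow> x = y" if "x \<in> vcarrier V" "y \<in> vcarrier V"
    using that by (simp add: vdist_def norm_eq_0 diff_closed diff_eq_zero_iff)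
  show "vdist V x z \<le> vdist V x y + vdist V y z"
    if "x \<in> vcarrier V" "y \<in> vcarrier V" "z \<in> vcarrier V"
    using norm_triangle[OF diff_closed[OF that(1,2)] diff_closed[OF that(2,3)]] that
    by (simp add: vdist_def diff_triangle)
qed

lemma (in normed_vspace) limitin_iff:
  assumes "\<And>n. s n \<in> vcarrier V"
  shows "limitin (vtopology V) s l sequentially \<longleftrightarrow>
    l \<in> vcarrier V \<and> (\<lambda>n. vnorm V (vdiff V (s n) l)) \<longlonglongrightarrow> 0"
proof -
  have "vdist V (s n) l = vnorm V (vdiff V (s n) l)" if "l \<in> vcarrier V" for n
    using that assms by (simp add: vdist_def)
  moreover have "0 \<le> vnorm V (vdiff V (s n) l)" if "l \<in> vcarrier V" for n
    using that assms by (simp add: norm_nonneg diff_closed)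
  ultimately show ?thesis
    unfolding vtopology_def Metric_space.limit_metric_sequentially[OF metric_space]
    by (auto simp: LIMSEQ_iff assms)
qed

lemma (in normed_vspace) norm_zero: "vnorm V (vzero V) = 0"
  using norm_eq_0 zero_closed by blast

text \<open>The power space is identified with a subspace of the space of coefficient sequences;
  its norm axioms come from there.\<close>

lemma (in normed_vspace) subspace_normed:
  assumes "S \<subseteq> vcarrier V" "vzero V \<in> S"
    and "\<And>u v. \<lbrakk>u \<in> S; v \<in> S\<rbrakk> \<Longrightarrow> vadd V u v \<in> S"
    and "\<And>a v. v \<in> S \<Longrightarrow> vscale V a v \<in> S"
  shows "normed_vspace (V\<lparr>vcarrier := S\<rparr>)"
proof -
  have [simp]: "u \<in> vcarrier V" if "u \<in> S" for u using that assms(1) by auto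
  show ?thesis
    by unfold_locales
      (use assms(2-) in \<open>auto simp: add_assoc add_zero add_inverse scale_add_right scale_add_left
        scale_scale scale_one norm_nonneg norm_eq_0 norm_scale norm_triangle intro: add_commute\<close>)
qed

lemma isometric_iso_normed:
  assumes "normed_vspace E" and iso: "isometric_iso E F T" and zero: "T (vzero E) = vzero F"
  shows "normed_vspace F"
proof -
  interpret E: normed_vspace E by fact
  have carrier: "vcarrier F = T ` vcarrier E"
    using iso by (simp add: isometric_iso_def bij_betw_def)
  have inj: "T u = T v \<longleftrightarrow> u = v" if "u \<in> vcarrier E" "v \<in> vcarrier E" for u v
    using iso that by (auto simp: isometric_iso_def bij_betw_def inj_on_def)
  have op: "\<lbrakk>u \<in> vcarrier E; v \<in> vcarrier E\<rbrakk> \<Longrightarrow> vadd F (T u) (T v) = T (vadd E u v)"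
    "u \<in> vcarrier E \<Longrightarrow> vscale F a (T u) = T (vscale E a u)"
    "u \<in> vcarrier E \<Longrightarrow> vnorm F (T u) = vnorm E u" for a u v
    using iso by (auto simp: isometric_iso_def vlinear_def)
  show ?thesis
    by unfold_locales
      (auto simp: carrier op inj zero[symmetric] E.zero_closed E.add_closed E.scale_closed
        E.add_zero E.add_inverse E.add_assoc E.scale_add_right E.scale_add_left
        E.scale_scale E.scale_one E.norm_nonneg E.norm_eq_0 E.norm_zero E.norm_scale E.norm_triangle
        intro: E.add_commute)
qed

text \<open>Completeness of the function space of the theorem is inherited along an isometry from the
  space of coefficient sequences.\<close>

lemma isometric_iso_banach:
  assumes "banach_vspace E" and iso: "isometric_iso E F T" and zero: "T (vzero E) = vzero F"
  shows "banach_vspace F"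
proof -
  interpret E: normed_vspace E using assms(1) by (simp add: banach_vspace_def)
  interpret F: normed_vspace F by (rule isometric_iso_normed[OF E.normed_vspace_axioms iso zero])
  interpret EM: Metric_space "vcarrier E" "vdist E" by (rule E.metric_space)
  interpret FM: Metric_space "vcarrier F" "vdist F" by (rule F.metric_space)
  have dist: "vdist F (T u) (T v) = vdist E u v" if "u \<in> vcarrier E" "v \<in> vcarrier E" for u v
  proof -
    have "vdiff F (T u) (T v) = T (vdiff E u v)"
      using iso that E.scale_closed by (auto simp: isometric_iso_def vlinear_def)
    moreover have "vnorm F (T (vdiff E u v)) = vnorm E (vdiff E u v)"
      using iso that by (simp add: isometric_iso_def E.diff_closed)
    moreover have "T u \<in> vcarrier F" "T v \<in> vcarrier F"
      using iso that by (auto simp: isometric_iso_def bij_betw_def)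
    ultimately show ?thesis using that by (simp add: vdist_def)
  qed
  have mem: "T u \<in> vcarrier F" if "u \<in> vcarrier E" for u
    using iso that by (auto simp: isometric_iso_def bij_betw_def)
  have "\<exists>y. limitin FM.mtopology \<sigma> y sequentially" if \<sigma>: "FM.MCauchy \<sigma>" for \<sigma>
  proof -
    have "\<sigma> n \<in> T ` vcarrier E" for n
      using \<sigma> iso by (auto simp: FM.MCauchy_def isometric_iso_def bij_betw_def image_subset_iff)
    then have "\<forall>n. \<exists>u. u \<in> vcarrier E \<and> T u = \<sigma> n" by (metis imageE)
    then obtain s where s: "\<And>n. s n \<in> vcarrier E" "\<And>n. T (s n) = \<sigma> n" by metis
    have "EM.MCauchy s"
      using \<sigma> s(1) by (simp add: EM.MCauchy_def FM.MCauchy_def s(2)[symmetric] dist image_subset_iff)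
    then obtain x where x: "limitin EM.mtopology s x sequentially"
      using assms(1) by (auto simp: banach_vspace_def EM.mcomplete_def)
    then have "x \<in> vcarrier E" and "\<forall>\<epsilon>>0. \<exists>N. \<forall>n\<ge>N. vdist E (s n) x < \<epsilon>"
      unfolding EM.limit_metric_sequentially by blast+
    then have "limitin FM.mtopology \<sigma> (T x) sequentially"
      using mem s(1) by (simp add: FM.limit_metric_sequentially s(2)[symmetric] dist)
    then show ?thesis by blast
  qed
  then show ?thesis
    unfolding banach_vspace_def FM.mcomplete_def using F.normed_vspace_axioms by blast
qed

text \<open>The operations have to agree only on the smaller space, which is how two normed spaces on
  the same type of elements are compared.\<close>

locale normed_inclusion = E: normed_vspace E + F: normed_vspace F
  for E :: "('v, 'z) nspace_scheme" and F :: "('v, 'y) nspace_scheme" +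
  assumes carrier_subset: "vcarrier E \<subseteq> vcarrier F"
    and add_eq: "\<lbrakk>u \<in> vcarrier E; v \<in> vcarrier E\<rbrakk> \<Longrightarrow> vadd F u v = vadd E u v"
    and scale_eq: "u \<in> vcarrier E \<Longrightarrow> vscale F a u = vscale E a u"
begin

lemma zero_eq: "vzero F = vzero E"
  using E.scale_zero_left[OF E.zero_closed] F.scale_zero_left[of "vzero E"] carrier_subset
    E.zero_closed scale_eq by force

lemma vdist_eq:
  assumes "u \<in> vcarrier E" "v \<in> vcarrier E"
  shows "vdist F u v = vnorm F (vdiff E u v)"
  using assms carrier_subset by (auto simp: vdist_def add_eq scale_eq E.scale_closed)

lemma embeds_iff: "embeds E F \<longleftrightarrow> (\<exists>K. \<forall>u\<in>vcarrier E. vnorm F u \<le> K * vnorm E u)"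
proof -
  interpret EM: Metric_space "vcarrier E" "vdist E" by (rule E.metric_space)
  interpret FM: Metric_space "vcarrier F" "vdist F" by (rule F.metric_space)
  have cont: "embeds E F \<longleftrightarrow> (\<forall>a\<in>vcarrier E. \<forall>\<epsilon>>0. \<exists>\<delta>>0. \<forall>x. x \<in> vcarrier E \<and> vdist E a x < \<delta>
      \<longrightarrow> vdist F a x < \<epsilon>)"
    using carrier_subset unfolding embeds_def vtopology_def EM.metric_continuous_map[OF F.metric_space]
    by auto
  show ?thesis
  proof
    assume "embeds E F"
    then obtain \<delta> where \<delta>: "\<delta> > 0"
      "\<And>x. \<lbrakk>x \<in> vcarrier E; vdist E (vzero E) x < \<delta>\<rbrakk> \<Longrightarrow> vdist F (vzero E) x < 1"
      unfolding cont using E.zero_closed zero_less_one by metis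
    have small: "vnorm F x < 1" if x: "x \<in> vcarrier E" and "vnorm E x < \<delta>" for x
    proof -
      have "vdist E x (vzero E) = vnorm E x" "vdist F x (vzero E) = vnorm F x"
        using x vdist_eq[OF x E.zero_closed]
        by (simp_all add: vdist_def E.zero_closed E.scale_zero_right E.add_zero_right)
      then show ?thesis using \<delta>(2)[OF x] that(2) EM.commute FM.commute by metis
    qed
    have "vnorm F u \<le> (2 / \<delta>) * vnorm E u" if u: "u \<in> vcarrier E" for u
    proof (cases "vnorm E u = 0")
      case True
      then have "u = vzero F" using u E.norm_eq_0 zero_eq by simp
      then show ?thesis using True F.norm_zero by simp
    next
      case False
      then have pos: "vnorm E u > 0" using E.norm_nonneg[OF u] by simp
      define t where "t = \<delta> / (2 * vnorm E u)"
      have t: "t > 0" using pos \<delta>(1) by (simp add: t_def)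
      have "vnorm E (vscale E t u) < \<delta>" using u t pos \<delta>(1)
        by (simp add: E.norm_scale) (simp add: t_def)
      then have "vnorm F (vscale F t u) < 1"
        using small[OF E.scale_closed[OF u]] u scale_eq by simp
      then have "t * vnorm F u < 1" using F.norm_scale[of u t] u carrier_subset t by auto
      then have "vnorm F u < 1 / t" using t by (simp add: pos_less_divide_eq mult.commute)
      then show ?thesis by (simp add: t_def)
    qed
    then show "\<exists>K. \<forall>u\<in>vcarrier E. vnorm F u \<le> K * vnorm E u" by blast
  next
    assume "\<exists>K. \<forall>u\<in>vcarrier E. vnorm F u \<le> K * vnorm E u"
    then obtain K where K: "\<And>u. u \<in> vcarrier E \<Longrightarrow> vnorm F u \<le> K * vnorm E u" by blast
    show "embeds E F"
      unfolding cont
    proof (intro ballI allI impI)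
      fix a and \<epsilon> :: real assume a: "a \<in> vcarrier E" and \<epsilon>: "\<epsilon> > 0"
      have "vdist F a x < \<epsilon>" if x: "x \<in> vcarrier E" and d: "vdist E a x < \<epsilon> / (\<bar>K\<bar> + 1)" for x
      proof -
        have "vdist F a x \<le> K * vdist E a x"
          using K[OF E.diff_closed[OF a x]] vdist_eq[OF a x] a x by (simp add: vdist_def)
        also have "\<dots> \<le> (\<bar>K\<bar> + 1) * vdist E a x"
          by (intro mult_right_mono) auto
        also have "\<dots> < \<epsilon>" using d by (simp add: pos_less_divide_eq mult.commute)
        finally show ?thesis .
      qed
      moreover have "\<epsilon> / (\<bar>K\<bar> + 1) > 0" using \<epsilon> by (simp add: divide_pos_pos)
      ultimately show "\<exists>\<delta>>0. \<forall>x. x \<in> vcarrier E \<and> vdist E a x < \<delta> \<longrightarrow> vdist F a x < \<epsilon>"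
        by blast
    qed
  qed
qed

lemma bdd_above_unit_ball:
  assumes "embeds E F"
  shows "bdd_above ((\<lambda>u. vnorm F u) ` vunit_ball E)"
proof -
  obtain K where K: "\<And>u. u \<in> vcarrier E \<Longrightarrow> vnorm F u \<le> K * vnorm E u"
    using assms embeds_iff by blast
  have "vnorm F u \<le> \<bar>K\<bar>" if "u \<in> vunit_ball E" for u
  proof -
    have u: "u \<in> vcarrier E" "vnorm E u \<le> 1" using that by (auto simp: vunit_ball_def)
    have "K * vnorm E u \<le> \<bar>K\<bar> * 1"
      using u E.norm_nonneg[OF u(1)] by (intro mult_mono) auto
    then show ?thesis using K[OF u(1)] by simp
  qed
  then show ?thesis by (auto simp: bdd_above_def)
qed

lemma norm_le_embedding_norm:
  assumes "embeds E F" "u \<in> vunit_ball E"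
  shows "vnorm F u \<le> embedding_norm E F"
  unfolding embedding_norm_def operator_norm_def
  using assms bdd_above_unit_ball by (intro cSUP_upper) auto

lemma zero_in_unit_ball: "vzero E \<in> vunit_ball E"
  by (simp add: vunit_ball_def E.zero_closed E.norm_zero)

lemma embedding_norm_nonneg: "embeds E F \<Longrightarrow> 0 \<le> embedding_norm E F"
  using norm_le_embedding_norm[OF _ zero_in_unit_ball] F.norm_zero zero_eq by simp

lemma norm_le_embedding_norm_mult:
  assumes emb: "embeds E F" and u: "u \<in> vcarrier E"
  shows "vnorm F u \<le> embedding_norm E F * vnorm E u"
proof (cases "vnorm E u = 0")
  case True
  then have "u = vzero F" using u E.norm_eq_0 zero_eq by simp
  then show ?thesis using True F.norm_zero by simp
next
  case False
  then have pos: "vnorm E u > 0" using E.norm_nonneg[OF u] by simp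
  have "vscale E (1 / vnorm E u) u \<in> vunit_ball E"
    using pos u by (simp add: vunit_ball_def E.scale_closed E.norm_scale)
  then have "vnorm F (vscale F (1 / vnorm E u) u) \<le> embedding_norm E F"
    using norm_le_embedding_norm[OF emb] scale_eq u by simp
  then have "vnorm F u / vnorm E u \<le> embedding_norm E F"
    using F.norm_scale[of u] u carrier_subset pos by auto
  then show ?thesis using pos by (simp add: pos_divide_le_eq)
qed

end

section \<open>Inner product spaces\<close>

text \<open>A real quadratic polynomial without sign change has non-positive discriminant.\<close>

lemma quadratic_nonneg_imp:
  fixes p q s :: real
  assumes "\<And>t. 0 \<le> s + 2 * t * p + t\<^sup>2 * q" and "0 \<le> q"
  shows "p\<^sup>2 \<le> s * q"
proof (cases "q = 0")
  case True
  have "p = 0"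
  proof (rule ccontr)
    assume "p \<noteq> 0"
    then show False using assms(1)[of "- (s + 1) / (2 * p)"] True by (simp add: field_simps)
  qed
  then show ?thesis using True by simp
next
  case False
  then have q: "q > 0" using assms(2) by simp
  have "0 \<le> s + 2 * (- p / q) * p + (- p / q)\<^sup>2 * q" by (rule assms(1))
  also have "\<dots> = s - p\<^sup>2 / q" using q by (simp add: power2_eq_square field_simps)
  finally show ?thesis using q by (simp add: pos_divide_le_eq)
qed

text \<open>The axioms shared by \<open>H\<close> and \<^term>\<open>L2 M\<close>, so that the Cauchy--Schwarz and triangle
  inequalities are derived for both spaces at once.\<close>

locale ip_vspace = real_vspace V for V :: "('v, 'z) ipspace_scheme" +
  assumes inner_commute: "\<lbrakk>u \<in> vcarrier V; v \<in> vcarrier V\<rbrakk> \<Longrightarrow> vinner V u v = vinner V v u"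
    and inner_add_left: "\<lbrakk>u \<in> vcarrier V; v \<in> vcarrier V; w \<in> vcarrier V\<rbrakk>
          \<Longrightarrow> vinner V (vadd V u v) w = vinner V u w + vinner V v w"
    and inner_scale_left: "\<lbrakk>u \<in> vcarrier V; v \<in> vcarrier V\<rbrakk>
          \<Longrightarrow> vinner V (vscale V a u) v = a * vinner V u v"
    and inner_nonneg: "u \<in> vcarrier V \<Longrightarrow> 0 \<le> vinner V u u"
    and inner_eq_0: "\<lbrakk>u \<in> vcarrier V; vinner V u u = 0\<rbrakk> \<Longrightarrow> u = vzero V"
    and norm_eq_sqrt: "u \<in> vcarrier V \<Longrightarrow> vnorm V u = sqrt (vinner V u u)"
begin

lemma inner_add_right:
  assumes "u \<in> vcarrier V" "v \<in> vcarrier V" "w \<in> vcarrier V"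
  shows "vinner V w (vadd V u v) = vinner V w u + vinner V w v"
  using assms inner_commute[of w] by (simp add: add_closed inner_add_left)

lemma inner_scale_right:
  assumes "u \<in> vcarrier V" "v \<in> vcarrier V"
  shows "vinner V v (vscale V a u) = a * vinner V v u"
  using assms inner_commute[of v] by (simp add: scale_closed inner_scale_left)

lemma norm_sq: "u \<in> vcarrier V \<Longrightarrow> (vnorm V u)\<^sup>2 = vinner V u u"
  by (simp add: norm_eq_sqrt inner_nonneg)

lemma inner_add_scale_sq:
  assumes "u \<in> vcarrier V" "v \<in> vcarrier V"
  shows "vinner V (vadd V u (vscale V t v)) (vadd V u (vscale V t v))
    = vinner V u u + 2 * t * vinner V u v + t\<^sup>2 * vinner V v v"
  using assms inner_commute[of v u]
  by (simp add: inner_add_left inner_add_right inner_scale_left inner_scale_right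
    add_closed scale_closed power2_eq_square algebra_simps)

lemma cauchy_schwarz:
  assumes "u \<in> vcarrier V" "v \<in> vcarrier V"
  shows "\<bar>vinner V u v\<bar> \<le> vnorm V u * vnorm V v"
proof -
  have "(vinner V u v)\<^sup>2 \<le> vinner V u u * vinner V v v"
    using assms inner_nonneg[of "vadd V u (vscale V _ v)"]
    by (intro quadratic_nonneg_imp) (simp_all add: inner_add_scale_sq[symmetric] inner_nonneg add_closed scale_closed)
  then have "(vinner V u v)\<^sup>2 \<le> (vnorm V u * vnorm V v)\<^sup>2"
    using assms by (simp add: power_mult_distrib norm_sq)
  moreover have "0 \<le> vnorm V u * vnorm V v" using assms by (simp add: norm_eq_sqrt inner_nonneg)
  ultimately show ?thesis by (simp flip: abs_le_square_iff)
qed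

lemma normed: "normed_vspace V"
proof
  fix u v a
  assume u: "u \<in> vcarrier V"
  show "0 \<le> vnorm V u" using u by (simp add: norm_eq_sqrt inner_nonneg)
  have "vinner V (vzero V) (vzero V) = 0"
    using inner_scale_left[OF zero_closed zero_closed, of 0] scale_zero_left[OF zero_closed] by simp
  then show "vnorm V u = 0 \<longleftrightarrow> u = vzero V"
    using u inner_eq_0 by (auto simp: norm_eq_sqrt)
  show "vnorm V (vscale V a u) = \<bar>a\<bar> * vnorm V u"
    using u by (simp add: norm_eq_sqrt scale_closed inner_scale_left inner_scale_right
        real_sqrt_mult flip: mult.assoc)
  assume v: "v \<in> vcarrier V"
  have "(vnorm V (vadd V u v))\<^sup>2 = (vnorm V u)\<^sup>2 + 2 * vinner V u v + (vnorm V v)\<^sup>2"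
    using u v inner_add_scale_sq[OF u v, of 1] by (simp add: norm_sq add_closed scale_one)
  also have "\<dots> \<le> (vnorm V u + vnorm V v)\<^sup>2"
    using cauchy_schwarz[OF u v] by (simp add: power2_sum)
  finally show "vnorm V (vadd V u v) \<le> vnorm V u + vnorm V v"
    by (rule power2_le_imp_le) (use u v in \<open>simp add: norm_eq_sqrt inner_nonneg\<close>)
qed

end

lemma hilbert_ip_vspace:
  assumes "hilbert_vspace V" shows "ip_vspace V"
proof -
  interpret normed_vspace V using assms by (simp add: hilbert_vspace_def banach_vspace_def)
  show ?thesis
    by unfold_locales (use assms norm_eq_0 in \<open>force simp: hilbert_vspace_def\<close>)+
qed

text \<open>The representing vector minimises \<open>J u = \<langle>u, u\<rangle> - 2 \<phi>(u)\<close>: by the parallelogram law,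
  minimising sequences are Cauchy, and the first variation of \<open>J\<close> vanishes at their limit.\<close>

lemma riesz_representation:
  assumes H: "hilbert_vspace H"
    and add: "\<And>u v. \<lbrakk>u \<in> vcarrier H; v \<in> vcarrier H\<rbrakk> \<Longrightarrow> \<phi> (vadd H u v) = \<phi> u + \<phi> v"
    and scale: "\<And>a u. u \<in> vcarrier H \<Longrightarrow> \<phi> (vscale H a u) = a * \<phi> u"
    and bound: "\<And>u. u \<in> vcarrier H \<Longrightarrow> \<bar>\<phi> u\<bar> \<le> C * vnorm H u"
  shows "\<exists>v\<in>vcarrier H. \<forall>u\<in>vcarrier H. \<phi> u = vinner H u v"
proof -
  interpret ip_vspace H by (rule hilbert_ip_vspace[OF H])
  interpret normed_vspace H by (rule normed)
  interpret M: Metric_space "vcarrier H" "vdist H" by (rule metric_space)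
  define J where "J u = vinner H u u - 2 * \<phi> u" for u
  define d where "d = Inf (J ` vcarrier H)"
  have lower: "- C\<^sup>2 \<le> J u" if u: "u \<in> vcarrier H" for u
  proof -
    have "0 \<le> (vnorm H u - C)\<^sup>2" by simp
    moreover have "\<phi> u \<le> C * vnorm H u" using bound[OF u] by simp
    ultimately show ?thesis using norm_sq[OF u] by (simp add: J_def power2_diff mult.commute)
  qed
  then have bdd: "bdd_below (J ` vcarrier H)" by (meson bdd_belowI2)
  have d: "d \<le> J u" if "u \<in> vcarrier H" for u
    unfolding d_def using that by (intro cInf_lower bdd) auto
  \<comment> \<open>The midpoint of \<open>u\<close> and \<open>v\<close> cannot undercut the infimum \<open>d\<close>.\<close>
  have parallelogram: "(vnorm H (vdiff H u v))\<^sup>2 \<le> 2 * (J u + J v - 2 * d)"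
    if u: "u \<in> vcarrier H" and v: "v \<in> vcarrier H" for u v
  proof -
    let ?m = "vscale H (1/2) (vadd H u v)"
    have m: "?m \<in> vcarrier H" using u v by (simp add: scale_closed add_closed)
    have "vinner H ?m ?m = (vinner H u u + 2 * vinner H u v + vinner H v v) / 4"
      using u v inner_add_scale_sq[OF u v, of 1]
      by (simp add: inner_scale_left inner_scale_right scale_closed add_closed scale_one)
    moreover have "\<phi> ?m = (\<phi> u + \<phi> v) / 2" using u v by (simp add: add scale add_closed)
    moreover have "(vnorm H (vdiff H u v))\<^sup>2 = vinner H u u - 2 * vinner H u v + vinner H v v"
      using inner_add_scale_sq[OF u v, of "-1"] u v by (simp add: norm_sq diff_closed)
    ultimately show ?thesis using d[OF m] by (simp add: J_def field_simps)
  qed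
  have "\<exists>u\<in>vcarrier H. J u < d + inverse (real (Suc n))" for n
  proof -
    have "J ` vcarrier H \<noteq> {}" using zero_closed by blast
    moreover have "d < d + inverse (real (Suc n))" by simp
    ultimately have "\<exists>y\<in>J ` vcarrier H. y < d + inverse (real (Suc n))"
      unfolding d_def by (rule cInf_lessD)
    then show ?thesis by auto
  qed
  then obtain s where s: "\<And>n. s n \<in> vcarrier H" "\<And>n. J (s n) < d + inverse (real (Suc n))"
    by metis
  have "M.MCauchy s"
    unfolding M.MCauchy_def
  proof (intro conjI allI impI)
    show "range s \<subseteq> vcarrier H" using s(1) by auto
    fix \<epsilon> :: real assume \<epsilon>: "\<epsilon> > 0"
    obtain N where N: "inverse (real (Suc N)) < \<epsilon>\<^sup>2 / 4"
      using reals_Archimedean[of "\<epsilon>\<^sup>2 / 4"] \<epsilon> by auto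
    have "vdist H (s n) (s n') < \<epsilon>" if "N \<le> n" "N \<le> n'" for n n'
    proof -
      have near: "J (s m) < d + \<epsilon>\<^sup>2 / 4" if "N \<le> m" for m
      proof -
        have "inverse (real (Suc m)) \<le> inverse (real (Suc N))"
          using that by (simp add: inverse_eq_divide frac_le)
        then show ?thesis using s(2)[of m] N by linarith
      qed
      have "2 * (J (s n) + J (s n') - 2 * d) < \<epsilon>\<^sup>2"
        using near[OF that(1)] near[OF that(2)] by (simp add: field_simps)
      then have "(vnorm H (vdiff H (s n) (s n')))\<^sup>2 < \<epsilon>\<^sup>2"
        using parallelogram[OF s(1) s(1)] order_le_less_trans by blast
      then show ?thesis using \<epsilon> s(1) by (auto simp: vdist_def intro: power2_less_imp_less)
    qed
    then show "\<exists>N. \<forall>n n'. N \<le> n \<longrightarrow> N \<le> n' \<longrightarrow> vdist H (s n) (s n') < \<epsilon>" by blast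
  qed
  then obtain v where "limitin M.mtopology s v sequentially"
    using H by (auto simp: hilbert_vspace_def banach_vspace_def M.mcomplete_def)
  then have v: "v \<in> vcarrier H" and lim: "(\<lambda>n. vnorm H (vdiff H (s n) v)) \<longlonglongrightarrow> 0"
    using limitin_iff[OF s(1)] by (auto simp: vtopology_def)
  have "(\<lambda>n. J (s n)) \<longlonglongrightarrow> d"
  proof (rule tendsto_sandwich[of "\<lambda>n. d" _ _ "\<lambda>n. d + inverse (real (Suc n))"])
    show "(\<lambda>n. d + inverse (real (Suc n))) \<longlonglongrightarrow> d"
      using tendsto_add[OF tendsto_const LIMSEQ_inverse_real_of_nat, of d] by simp
    show "\<forall>\<^sub>F n in sequentially. d \<le> J (s n)" using d s(1) by simp
    show "\<forall>\<^sub>F n in sequentially. J (s n) \<le> d + inverse (real (Suc n))"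
      using s(2) less_imp_le by (intro always_eventually allI) blast
  qed simp
  moreover have "J (s n) = J v + (2 * vinner H v (vdiff H (s n) v)
      + (vnorm H (vdiff H (s n) v))\<^sup>2 - 2 * \<phi> (vdiff H (s n) v))" for n
  proof -
    let ?w = "vdiff H (s n) v"
    have w: "?w \<in> vcarrier H" using v s(1) by (simp add: diff_closed)
    have "s n = vadd H v ?w" using diff_add_cancel[OF s(1) v] add_commute[OF v w] by simp
    then have "J (s n) = J (vadd H v (vscale H 1 ?w))" using w by (simp add: scale_one)
    then show ?thesis using inner_add_scale_sq[OF v w, of 1] v w
      by (simp add: J_def scale_one norm_sq add)
  qed
  moreover have "(\<lambda>n. J v + (2 * vinner H v (vdiff H (s n) v)
      + (vnorm H (vdiff H (s n) v))\<^sup>2 - 2 * \<phi> (vdiff H (s n) v))) \<longlonglongrightarrow> J v + (2 * 0 + 0\<^sup>2 - 2 * 0)"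
  proof (intro tendsto_intros lim)
    have "norm (vinner H v (vdiff H (s n) v)) \<le> vnorm H v * vnorm H (vdiff H (s n) v)" for n
      using cauchy_schwarz[OF v diff_closed[OF s(1) v]] by simp
    then show "(\<lambda>n. vinner H v (vdiff H (s n) v)) \<longlonglongrightarrow> 0"
      by (rule Lim_null_comparison[OF always_eventually[OF allI] tendsto_mult_right_zero[OF lim]])
    have "norm (\<phi> (vdiff H (s n) v)) \<le> C * vnorm H (vdiff H (s n) v)" for n
      using bound[OF diff_closed[OF s(1) v]] by simp
    then show "(\<lambda>n. \<phi> (vdiff H (s n) v)) \<longlonglongrightarrow> 0"
      by (rule Lim_null_comparison[OF always_eventually[OF allI] tendsto_mult_right_zero[OF lim]])
  qed
  ultimately have "J v = d"
    using LIMSEQ_unique by fastforce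
  \<comment> \<open>\<open>J (v + t u) - J v\<close> is a nonnegative polynomial in \<open>t\<close> without constant term, so its linear
    coefficient vanishes.\<close>
  moreover have "\<phi> u = vinner H u v" if u: "u \<in> vcarrier H" for u
  proof -
    have "0 \<le> 0 + 2 * t * (vinner H u v - \<phi> u) + t\<^sup>2 * vinner H u u" for t
      using d[of "vadd H v (vscale H t u)"] \<open>J v = d\<close> u v inner_add_scale_sq[OF v u, of t] inner_commute[OF u v]
      by (simp add: J_def add_closed scale_closed add scale algebra_simps)
    then have "(vinner H u v - \<phi> u)\<^sup>2 \<le> 0 * vinner H u u"
      by (rule quadratic_nonneg_imp) (rule inner_nonneg[OF u])
    then show ?thesis by simp
  qed
  ultimately show ?thesis using v by blast
qed

section \<open>The sequence norms\<close>

text \<open>Finiteness of the \<open>r\<close>-norm together with the bound \<open>C\<close>, as a family of conditions on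
  finite sets of indices (lemma \<open>lr_le_iff\<close>). In this form the bound passes to pointwise limits, and
  the norm axioms reduce to inequalities between finite sums.\<close>

definition lr_le :: "ereal \<Rightarrow> ('j \<Rightarrow> real) \<Rightarrow> real \<Rightarrow> bool" where
  "lr_le r c C \<longleftrightarrow> 0 \<le> C \<and> (if r = \<infinity> then \<forall>j. \<bar>c j\<bar> \<le> C
     else \<forall>F. finite F \<longrightarrow> (\<Sum>j\<in>F. \<bar>c j\<bar> powr real_of_ereal r) \<le> C powr real_of_ereal r)"

lemma real_of_ereal_ge_1: "\<lbrakk>1 \<le> r; r \<noteq> \<infinity>\<rbrakk> \<Longrightarrow> 1 \<le> real_of_ereal r"
  by (cases r) auto

lemma powr_le_cancel:
  fixes x y p :: real
  assumes "x powr p \<le> y powr p" "0 < p" "0 \<le> x" "0 \<le> y"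
  shows "x \<le> y"
proof (rule ccontr)
  assume "\<not> x \<le> y"
  then show False using assms powr_less_mono2[of p y x] by simp
qed

lemma lr_le_component:
  assumes "1 \<le> r" "lr_le r c C"
  shows "\<bar>c j\<bar> \<le> C"
proof (cases "r = \<infinity>")
  case False
  then have p: "1 \<le> real_of_ereal r" using assms(1) by (rule real_of_ereal_ge_1[rotated])
  have "(\<Sum>j\<in>{j}. \<bar>c j\<bar> powr real_of_ereal r) \<le> C powr real_of_ereal r"
    using assms(2) False unfolding lr_le_def by (metis finite.emptyI finite.insertI)
  then have "\<bar>c j\<bar> powr real_of_ereal r \<le> C powr real_of_ereal r" by simp
  then show ?thesis
    by (rule powr_le_cancel) (use assms(2) p in \<open>auto simp: lr_le_def\<close>)
qed (use assms in \<open>auto simp: lr_le_def\<close>)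

lemma lr_le_iff:
  assumes r: "1 \<le> r"
  shows "lr_le r c C \<longleftrightarrow> lr_finite r c \<and> lr_norm r c \<le> C"
proof (cases "r = \<infinity>")
  case True
  have "0 \<le> C \<and> (\<forall>j. \<bar>c j\<bar> \<le> C) \<longleftrightarrow> bdd_above (range (\<lambda>j. \<bar>c j\<bar>)) \<and> (SUP j. \<bar>c j\<bar>) \<le> C"
  proof
    assume "0 \<le> C \<and> (\<forall>j. \<bar>c j\<bar> \<le> C)"
    then show "bdd_above (range (\<lambda>j. \<bar>c j\<bar>)) \<and> (SUP j. \<bar>c j\<bar>) \<le> C"
      by (auto intro!: cSUP_least bdd_aboveI)
  next
    assume *: "bdd_above (range (\<lambda>j. \<bar>c j\<bar>)) \<and> (SUP j. \<bar>c j\<bar>) \<le> C"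
    then have "\<bar>c j\<bar> \<le> C" for j using cSUP_upper[of j UNIV "\<lambda>j. \<bar>c j\<bar>"] by fastforce
    then show "0 \<le> C \<and> (\<forall>j. \<bar>c j\<bar> \<le> C)" by (meson abs_ge_zero order_trans)
  qed
  then show ?thesis using True by (simp add: lr_le_def lr_finite_def lr_norm_def)
next
  case False
  define p where "p = real_of_ereal r"
  have p: "1 \<le> p" unfolding p_def using r False by (rule real_of_ereal_ge_1)
  let ?f = "\<lambda>j. \<bar>c j\<bar> powr p"
  have "0 \<le> C \<and> (\<forall>F. finite F \<longrightarrow> sum ?f F \<le> C powr p)
    \<longleftrightarrow> ?f summable_on UNIV \<and> infsum ?f UNIV powr (1 / p) \<le> C"
  proof
    assume *: "0 \<le> C \<and> (\<forall>F. finite F \<longrightarrow> sum ?f F \<le> C powr p)"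
    have summ: "?f summable_on UNIV"
      by (rule nonneg_bdd_above_summable_on) (use * in \<open>auto intro!: bdd_aboveI\<close>)
    then have "infsum ?f UNIV \<le> C powr p" using * by (intro infsum_le_finite_sums) auto
    then have "infsum ?f UNIV powr (1 / p) \<le> (C powr p) powr (1 / p)"
      using p by (intro powr_mono2) (auto intro: infsum_nonneg)
    then show "?f summable_on UNIV \<and> infsum ?f UNIV powr (1 / p) \<le> C"
      using summ * p by (simp add: powr_powr)
  next
    assume *: "?f summable_on UNIV \<and> infsum ?f UNIV powr (1 / p) \<le> C"
    have "sum ?f F \<le> C powr p" if "finite F" for F
    proof -
      have "sum ?f F \<le> infsum ?f UNIV" using * that by (intro finite_sum_le_infsum) auto
      also have "\<dots> = (infsum ?f UNIV powr (1 / p)) powr p"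
        using p infsum_nonneg[of UNIV ?f] by (simp add: powr_powr)
      also have "\<dots> \<le> C powr p" using * p by (intro powr_mono2) auto
      finally show ?thesis .
    qed
    moreover have "0 \<le> C" using * powr_ge_zero order_trans by blast
    ultimately show "0 \<le> C \<and> (\<forall>F. finite F \<longrightarrow> sum ?f F \<le> C powr p)" by blast
  qed
  then show ?thesis using False by (simp add: lr_le_def lr_finite_def lr_norm_def p_def)
qed

lemma lr_le_mono:
  assumes r: "1 \<le> r" and "lr_le r c C" "\<And>j. \<bar>d j\<bar> \<le> \<bar>c j\<bar>"
  shows "lr_le r d C"
proof (cases "r = \<infinity>")
  case True
  then show ?thesis using assms by (auto simp: lr_le_def intro: order_trans)
next
  case False
  then have p: "1 \<le> real_of_ereal r" using r by (rule real_of_ereal_ge_1[rotated])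
  have "(\<Sum>j\<in>F. \<bar>d j\<bar> powr real_of_ereal r) \<le> (\<Sum>j\<in>F. \<bar>c j\<bar> powr real_of_ereal r)" for F
    using assms(3) p by (intro sum_mono powr_mono2) auto
  then show ?thesis using False assms(2) by (auto simp: lr_le_def intro: order_trans)
qed

lemma lr_le_scale:
  assumes r: "1 \<le> r" and "lr_le r c C"
  shows "lr_le r (\<lambda>j. a * c j) (\<bar>a\<bar> * C)"
proof (cases "r = \<infinity>")
  case True
  then show ?thesis using assms by (auto simp: lr_le_def abs_mult intro: mult_left_mono)
next
  case False
  then show ?thesis using assms
    by (auto simp: lr_le_def abs_mult powr_mult sum_distrib_left[symmetric] intro: mult_left_mono)
qed

text \<open>Convexity of the power function on the closed half line; the endpoint 0 is treated
  separately, with \<open>s powr p \<le> s\<close> for \<open>s\<close> in the unit interval.\<close>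

lemma powr_convex_combination:
  fixes x y t p :: real
  assumes "1 \<le> p" "0 \<le> x" "0 \<le> y" "0 \<le> t" "t \<le> 1"
  shows "(t * x + (1 - t) * y) powr p \<le> t * x powr p + (1 - t) * y powr p"
proof -
  have le: "s powr p \<le> s" if "0 \<le> s" "s \<le> 1" for s
    using powr_mono'[of 1 p s] that assms(1) by simp
  consider "x = 0" | "y = 0" | "0 < x" "0 < y" using assms by fastforce
  then show ?thesis
  proof cases
    case 1
    then show ?thesis using assms le[of "1 - t"] by (simp add: powr_mult mult_right_mono)
  next
    case 2
    then show ?thesis using assms le[of t] by (simp add: powr_mult mult_right_mono)
  next
    case 3
    then show ?thesis
      using convex_onD[OF powr_convex[OF assms(1)], of "1 - t" x y] assms by simp
  qed
qed

text \<open>Minkowski's inequality: \<open>(c + d) / (A + B)\<close> is a convex combination of \<open>c / A\<close> and \<open>d / B\<close>,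
  whose \<open>p\<close>-th powers have sums at most 1.\<close>

lemma lr_le_add:
  assumes r: "1 \<le> r" and c: "lr_le r c A" and d: "lr_le r d B"
  shows "lr_le r (\<lambda>j. c j + d j) (A + B)"
proof (cases "r = \<infinity>")
  case True
  then show ?thesis using c d unfolding lr_le_def
    by (auto intro!: order_trans[OF abs_triangle_ineq] add_mono)
next
  case False
  define p where "p = real_of_ereal r"
  have p: "1 \<le> p" unfolding p_def using r False by (rule real_of_ereal_ge_1)
  have nonneg: "0 \<le> A" "0 \<le> B" using c d by (auto simp: lr_le_def)
  consider "A = 0" | "B = 0" | "0 < A" "0 < B" using nonneg by fastforce
  then show ?thesis
  proof cases
    case 1
    then have "c j = 0" for j using lr_le_component[OF r c, of j] by simp
    then show ?thesis using d 1 by simp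
  next
    case 2
    then have "d j = 0" for j using lr_le_component[OF r d, of j] by simp
    then show ?thesis using c 2 by simp
  next
    case 3
    define t where "t = A / (A + B)"
    have t: "0 \<le> t" "t \<le> 1" "1 - t = B / (A + B)" using 3 by (auto simp: t_def field_simps)
    have summand: "\<bar>c j + d j\<bar> powr p \<le> (A + B) powr p *
      (t * (\<bar>c j\<bar> powr p / A powr p) + (1 - t) * (\<bar>d j\<bar> powr p / B powr p))" for j
    proof -
      have "(A + B) * (t * (\<bar>c j\<bar> / A) + (1 - t) * (\<bar>d j\<bar> / B)) = \<bar>c j\<bar> + \<bar>d j\<bar>"
      proof -
        have "(A + B) * t = A" "(A + B) * (1 - t) = B" using 3 by (simp_all add: t(3)) (simp add: t_def)
        then have "(A + B) * (t * (\<bar>c j\<bar> / A) + (1 - t) * (\<bar>d j\<bar> / B)) = A * (\<bar>c j\<bar> / A) + B * (\<bar>d j\<bar> / B)"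
          by (metis distrib_left mult.assoc)
        then show ?thesis using 3 by simp
      qed
      then have "\<bar>c j + d j\<bar> powr p \<le> ((A + B) * (t * (\<bar>c j\<bar> / A) + (1 - t) * (\<bar>d j\<bar> / B))) powr p"
        using p by (intro powr_mono2) auto
      also have "\<dots> = (A + B) powr p * (t * (\<bar>c j\<bar> / A) + (1 - t) * (\<bar>d j\<bar> / B)) powr p"
        using 3 t by (simp add: powr_mult)
      also have "\<dots> \<le> (A + B) powr p * (t * (\<bar>c j\<bar> / A) powr p + (1 - t) * (\<bar>d j\<bar> / B) powr p)"
        using p t 3 by (intro mult_left_mono powr_convex_combination) auto
      finally show ?thesis using 3 by (simp add: powr_divide)
    qed
    have "(\<Sum>j\<in>F. \<bar>c j + d j\<bar> powr p) \<le> (A + B) powr p" if F: "finite F" for F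
    proof -
      have cF: "(\<Sum>j\<in>F. \<bar>c j\<bar> powr p) / A powr p \<le> 1"
        using c F False 3 by (simp add: lr_le_def p_def)
      have dF: "(\<Sum>j\<in>F. \<bar>d j\<bar> powr p) / B powr p \<le> 1"
        using d F False 3 by (simp add: lr_le_def p_def)
      have "(\<Sum>j\<in>F. \<bar>c j + d j\<bar> powr p) \<le> (\<Sum>j\<in>F. (A + B) powr p *
        (t * (\<bar>c j\<bar> powr p / A powr p) + (1 - t) * (\<bar>d j\<bar> powr p / B powr p)))"
        by (intro sum_mono summand)
      also have "\<dots> = (A + B) powr p * (t * ((\<Sum>j\<in>F. \<bar>c j\<bar> powr p) / A powr p)
          + (1 - t) * ((\<Sum>j\<in>F. \<bar>d j\<bar> powr p) / B powr p))"
        by (simp add: sum_distrib_left sum.distrib sum_divide_distrib distrib_left)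
      also have "\<dots> \<le> (A + B) powr p * (t * 1 + (1 - t) * 1)"
        using t cF dF by (intro mult_left_mono add_mono) auto
      finally show ?thesis by simp
    qed
    then show ?thesis using False nonneg by (simp add: lr_le_def p_def)
  qed
qed

lemma lr_le_limit:
  assumes r: "1 \<le> r" and lim: "\<And>j. (\<lambda>m. c m j) \<longlonglongrightarrow> d j"
    and le: "\<And>m. N \<le> m \<Longrightarrow> lr_le r (c m) C"
  shows "lr_le r d C"
proof (cases "r = \<infinity>")
  case True
  have "\<bar>d j\<bar> \<le> C" for j
    by (rule LIMSEQ_le_const2[OF tendsto_rabs[OF lim]]) (use le True in \<open>auto simp: lr_le_def\<close>)
  then show ?thesis using True le[of N] by (simp add: lr_le_def)
next
  case False
  define p where "p = real_of_ereal r"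
  have p: "1 \<le> p" unfolding p_def using r False by (rule real_of_ereal_ge_1)
  have "(\<Sum>j\<in>F. \<bar>d j\<bar> powr p) \<le> C powr p" if F: "finite F" for F
  proof (rule LIMSEQ_le_const2)
    show "(\<lambda>m. \<Sum>j\<in>F. \<bar>c m j\<bar> powr p) \<longlonglongrightarrow> (\<Sum>j\<in>F. \<bar>d j\<bar> powr p)"
      using p by (intro tendsto_sum tendsto_powr' tendsto_rabs lim tendsto_const) auto
    show "\<exists>N. \<forall>m\<ge>N. (\<Sum>j\<in>F. \<bar>c m j\<bar> powr p) \<le> C powr p"
      using le False F by (auto simp: lr_le_def p_def)
  qed
  then show ?thesis using False le[of N] by (simp add: lr_le_def p_def)
qed

lemma finite_support_lr_finite:
  assumes fin: "finite {j. c j \<noteq> 0}" and r: "1 \<le> r"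
  shows "lr_finite r c"
proof (cases "r = \<infinity>")
  case True
  have "range (\<lambda>j. \<bar>c j\<bar>) \<subseteq> insert 0 ((\<lambda>j. \<bar>c j\<bar>) ` {j. c j \<noteq> 0})" by auto
  then have "finite (range (\<lambda>j. \<bar>c j\<bar>))" using fin by (meson finite_imageI finite_insert finite_subset)
  then show ?thesis using True by (simp add: lr_finite_def bdd_above_finite)
next
  case False
  have "(\<lambda>j. \<bar>c j\<bar> powr real_of_ereal r) summable_on UNIV"
    using fin by (intro finite_nonzero_values_imp_summable_on) auto
  then show ?thesis using False by (simp add: lr_finite_def)
qed

section \<open>The weighted coefficient space\<close>

definition block :: "nat set \<Rightarrow> (nat \<Rightarrow> real) \<Rightarrow> int \<Rightarrow> nat set" where
  "block I \<mu> j = {i \<in> I. 2 powi j < \<mu> i \<and> \<mu> i \<le> 2 powi (j + 1)}"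

text \<open>The block norm is a Euclidean norm of the weighted coefficients, which gives its triangle
  inequality.\<close>

lemma block_norm_eq_L2_set:
  "block_norm I \<mu> \<theta> b j = L2_set (\<lambda>i. b i * \<mu> i powr (- \<theta> / 2)) (block I \<mu> j)"
proof -
  have "(\<mu> i powr (- \<theta> / 2))\<^sup>2 = \<mu> i powr (- \<theta>)" for i
    by (simp add: power2_eq_square flip: powr_add)
  then show ?thesis
    by (simp add: block_norm_def L2_set_def block_def power_mult_distrib)
qed

lemma block_norm_nonneg: "0 \<le> block_norm I \<mu> \<theta> b j"
  by (simp add: block_norm_eq_L2_set)

lemma block_norm_add:
  "block_norm I \<mu> \<theta> (\<lambda>i. b i + b' i) j \<le> block_norm I \<mu> \<theta> b j + block_norm I \<mu> \<theta> b' j"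
  unfolding block_norm_eq_L2_set distrib_right by (rule L2_set_triangle_ineq)

lemma block_norm_scale: "block_norm I \<mu> \<theta> (\<lambda>i. a * b i) j = \<bar>a\<bar> * block_norm I \<mu> \<theta> b j"
proof -
  have "block_norm I \<mu> \<theta> (\<lambda>i. a * b i) j = L2_set (\<lambda>i. a * (b i * \<mu> i powr (- \<theta> / 2))) (block I \<mu> j)"
    unfolding block_norm_eq_L2_set by (simp only: mult.assoc)
  then show ?thesis by (simp add: L2_set_def block_norm_eq_L2_set power_mult_distrib real_sqrt_mult
        flip: sum_distrib_left)
qed

lemma block_norm_mono:
  assumes "\<And>i. i \<in> I \<Longrightarrow> \<bar>b i\<bar> \<le> \<bar>b' i\<bar>"
  shows "block_norm I \<mu> \<theta> b j \<le> block_norm I \<mu> \<theta> b' j"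
  unfolding block_norm_def
  using assms by (intro real_sqrt_le_mono sum_mono mult_right_mono) (auto simp: abs_le_square_iff)

lemma block_norm_cong:
  assumes "\<And>i. i \<in> I \<Longrightarrow> b i = b' i"
  shows "block_norm I \<mu> \<theta> b = block_norm I \<mu> \<theta> b'"
  using assms by (intro ext) (simp add: block_norm_def)

lemma tendsto_block_norm:
  assumes "\<And>i. i \<in> I \<Longrightarrow> (\<lambda>m. b m i) \<longlonglongrightarrow> b' i"
  shows "(\<lambda>m. block_norm I \<mu> \<theta> (b m) j) \<longlonglongrightarrow> block_norm I \<mu> \<theta> b' j"
  unfolding block_norm_def using assms by (intro tendsto_intros) auto

lemma two_powi: "(2::real) powi j = 2 powr real_of_int j"
  by (simp add: powr_real_of_int')

lemma ex_dyadic_interval: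
  fixes x :: real
  assumes "0 < x"
  shows "\<exists>j::int. 2 powi j < x \<and> x \<le> 2 powi (j + 1)"
proof -
  have "2 powr real_of_int (\<lceil>log 2 x\<rceil> - 1) < x"
    using assms by (subst less_log_iff[symmetric]) (auto, linarith)
  moreover have "x \<le> 2 powr real_of_int (\<lceil>log 2 x\<rceil> - 1 + 1)"
    using assms by (subst log_le_iff[symmetric]) auto
  ultimately show ?thesis unfolding two_powi by blast
qed

text \<open>Coefficients outside the index set are fixed to 0, so that a sequence is determined by its
  values on the index set.\<close>

definition coef_space :: "nat set \<Rightarrow> (nat \<Rightarrow> real) \<Rightarrow> real \<Rightarrow> ereal \<Rightarrow> (nat \<Rightarrow> real) nspace" where
  "coef_space I \<mu> \<theta> r =
     \<lparr> vcarrier = {b \<in> seq_space I \<mu> \<theta> r. \<forall>i. i \<notin> I \<longrightarrow> b i = 0},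
       vzero = (\<lambda>i. 0),
       vadd = (\<lambda>b b' i. b i + b' i),
       vscale = (\<lambda>a b i. a * b i),
       vnorm = seq_norm I \<mu> \<theta> r \<rparr>"

lemma coef_space_simps [simp]:
  "vcarrier (coef_space I \<mu> \<theta> r) = {b \<in> seq_space I \<mu> \<theta> r. \<forall>i. i \<notin> I \<longrightarrow> b i = 0}"
  "vzero (coef_space I \<mu> \<theta> r) = (\<lambda>i. 0)"
  "vadd (coef_space I \<mu> \<theta> r) b b' = (\<lambda>i. b i + b' i)"
  "vscale (coef_space I \<mu> \<theta> r) a b = (\<lambda>i. a * b i)"
  "vnorm (coef_space I \<mu> \<theta> r) = seq_norm I \<mu> \<theta> r"
  by (simp_all add: coef_space_def)

text \<open>The finiteness assumption makes every dyadic block finite. An infinite block would have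
  block norm 0, because sums over infinite sets are 0, and the sequence norm would degenerate.\<close>

locale dyadic_weights =
  fixes I :: "nat set" and \<mu> :: "nat \<Rightarrow> real" and \<theta> :: real and r :: ereal
  assumes mu_pos: "i \<in> I \<Longrightarrow> 0 < \<mu> i"
    and finite_above: "0 < \<epsilon> \<Longrightarrow> finite {i \<in> I. \<epsilon> < \<mu> i}"
    and theta_pos: "0 < \<theta>"
    and r_ge_1: "1 \<le> r"
begin

abbreviation "norm_le b C \<equiv> lr_le r (block_norm I \<mu> \<theta> b) C"

lemma norm_le_iff: "norm_le b C \<longleftrightarrow> b \<in> seq_space I \<mu> \<theta> r \<and> seq_norm I \<mu> \<theta> r b \<le> C"
  by (simp add: lr_le_iff[OF r_ge_1] seq_space_def seq_norm_def)

lemma norm_le_seq_norm: "b \<in> seq_space I \<mu> \<theta> r \<Longrightarrow> norm_le b (seq_norm I \<mu> \<theta> r b)"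
  by (simp add: norm_le_iff)

lemma seq_norm_nonneg: "b \<in> seq_space I \<mu> \<theta> r \<Longrightarrow> 0 \<le> seq_norm I \<mu> \<theta> r b"
  using norm_le_seq_norm by (auto simp: lr_le_def)

lemma norm_le_add:
  assumes "norm_le b A" "norm_le b' B" shows "norm_le (\<lambda>i. b i + b' i) (A + B)"
proof (rule lr_le_mono[OF r_ge_1 lr_le_add[OF r_ge_1 assms]])
  fix j show "\<bar>block_norm I \<mu> \<theta> (\<lambda>i. b i + b' i) j\<bar> \<le> \<bar>block_norm I \<mu> \<theta> b j + block_norm I \<mu> \<theta> b' j\<bar>"
    using block_norm_add[of I \<mu> \<theta> b b' j] block_norm_nonneg[of I \<mu> \<theta> "\<lambda>i. b i + b' i" j] by simp
qed

lemma norm_le_scale: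
  assumes "norm_le b A" shows "norm_le (\<lambda>i. a * b i) (\<bar>a\<bar> * A)"
  using lr_le_scale[OF r_ge_1 assms, of "\<bar>a\<bar>"] by (simp add: block_norm_scale[abs_def])

text \<open>The norm sees only the absolute values of the coefficients. This is what turns upper bounds for
  sums into bounds on sums of absolute values later on.\<close>

lemma norm_le_mono:
  assumes "norm_le b C" "\<And>i. i \<in> I \<Longrightarrow> \<bar>b' i\<bar> \<le> \<bar>b i\<bar>" shows "norm_le b' C"
proof (rule lr_le_mono[OF r_ge_1 assms(1)])
  fix j show "\<bar>block_norm I \<mu> \<theta> b' j\<bar> \<le> \<bar>block_norm I \<mu> \<theta> b j\<bar>"
    using block_norm_mono[of I b' b \<mu> \<theta> j] assms(2) by (simp add: block_norm_nonneg)
qed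

lemma norm_le_limit:
  assumes "\<And>i. i \<in> I \<Longrightarrow> (\<lambda>m. b m i) \<longlonglongrightarrow> b' i" "\<And>m. N \<le> m \<Longrightarrow> norm_le (b m) C"
  shows "norm_le b' C"
proof (rule lr_le_limit[OF r_ge_1])
  show "(\<lambda>m. block_norm I \<mu> \<theta> (b m) j) \<longlonglongrightarrow> block_norm I \<mu> \<theta> b' j" for j
    by (rule tendsto_block_norm[OF assms(1)])
qed (fact assms(2))

lemma finite_block: "finite (block I \<mu> j)"
  by (rule finite_subset[OF _ finite_above[of "2 powi j"]]) (auto simp: block_def)

lemma norm_le_block:
  assumes "norm_le b C" "F \<subseteq> block I \<mu> j"
  shows "(\<Sum>i\<in>F. (b i)\<^sup>2 * \<mu> i powr (-\<theta>)) \<le> C\<^sup>2"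
proof -
  have "(\<Sum>i\<in>F. (b i)\<^sup>2 * \<mu> i powr (-\<theta>)) \<le> (\<Sum>i\<in>block I \<mu> j. (b i)\<^sup>2 * \<mu> i powr (-\<theta>))"
    using assms(2) finite_block by (intro sum_mono2) auto
  also have "\<dots> = (block_norm I \<mu> \<theta> b j)\<^sup>2"
    by (simp add: block_norm_def block_def[symmetric] sum_nonneg)
  also have "\<dots> \<le> C\<^sup>2"
    using lr_le_component[OF r_ge_1 assms(1), of j] block_norm_nonneg[of I \<mu> \<theta> b j]
    by (intro power_mono) auto
  finally show ?thesis .
qed

lemma norm_le_component:
  assumes "norm_le b C" "i \<in> I"
  shows "\<bar>b i\<bar> \<le> \<mu> i powr (\<theta> / 2) * C"
proof -
  have \<mu>: "0 < \<mu> i" using mu_pos assms(2) by simp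
  obtain j where "i \<in> block I \<mu> j"
    using ex_dyadic_interval[OF \<mu>] assms(2) by (auto simp: block_def)
  then have "(b i)\<^sup>2 * \<mu> i powr (-\<theta>) \<le> C\<^sup>2"
    using norm_le_block[OF assms(1), of "{i}" j] by simp
  then have "(b i)\<^sup>2 \<le> \<mu> i powr \<theta> * C\<^sup>2"
    using \<mu> by (simp add: powr_minus divide_simps mult.commute)
  also have "\<mu> i powr \<theta> = (\<mu> i powr (\<theta> / 2))\<^sup>2"
    by (simp add: power2_eq_square flip: powr_add)
  finally have "(b i)\<^sup>2 \<le> (\<mu> i powr (\<theta> / 2) * C)\<^sup>2" by (simp add: power_mult_distrib)
  moreover have "0 \<le> \<mu> i powr (\<theta> / 2) * C" using assms(1) by (simp add: lr_le_def)
  ultimately show ?thesis by (simp flip: abs_le_square_iff)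
qed

text \<open>On the block \<open>j\<close> the weight \<open>\<mu> i powr (-\<theta>)\<close> is at least \<open>2 powr (-\<theta> (j + 1))\<close>, and the
  indices of the occupied blocks are bounded above. The unweighted square sums of the blocks are
  therefore dominated by a geometric series.\<close>

lemma norm_le_summable_square:
  assumes b: "norm_le b C"
  shows "summable (\<lambda>i. if i \<in> I then (b i)\<^sup>2 else 0)"
proof -
  obtain jj where jj: "\<And>i. i \<in> I \<Longrightarrow> i \<in> block I \<mu> (jj i)"
    using ex_dyadic_interval[OF mu_pos] unfolding block_def by (metis (mono_tags, lifting) mem_Collect_eq)
  have "finite (jj ` {i \<in> I. 1 < \<mu> i})" using finite_above[of 1] by simp
  then have "bdd_above (jj ` {i \<in> I. 1 < \<mu> i})" by (rule bdd_above_finite)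
  then obtain J0 where J0: "\<And>i. \<lbrakk>i \<in> I; 1 < \<mu> i\<rbrakk> \<Longrightarrow> jj i \<le> J0"
    by (auto simp: bdd_above_def)
  define J where "J = max J0 0"
  have J: "jj i \<le> J" if i: "i \<in> I" for i
  proof (cases "1 < \<mu> i")
    case True then show ?thesis using J0[OF i] by (simp add: J_def)
  next
    case False
    then have "2 powr real_of_int (jj i) < 2 powr 0"
      using jj[OF i] by (auto simp: block_def two_powi)
    then have "jj i < 0" by (subst (asm) powr_less_cancel_iff) auto
    then show ?thesis by (simp add: J_def)
  qed
  \<comment> \<open>The series runs over \<open>m = J - j\<close>, the distance of the block \<open>j\<close> to the highest admissible
    block \<open>J\<close>.\<close>
  define q where "q = 2 powr (-\<theta>)"
  have q: "0 < q" "q < 1" using theta_pos powr_less_mono[of "-\<theta>" 0 2] by (simp_all add: q_def)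
  define A where "A = 2 powr (\<theta> * (real_of_int J + 1)) * C\<^sup>2"
  define m where "m i = nat (J - jj i)" for i
  have weight: "\<mu> i powr \<theta> \<le> 2 powr (\<theta> * (real_of_int J + 1)) * q ^ m i" if i: "i \<in> I" for i
  proof -
    have "\<mu> i \<le> 2 powr (real_of_int (jj i) + 1)"
      using jj[OF i] by (simp add: block_def two_powi)
    then have "\<mu> i powr \<theta> \<le> (2 powr (real_of_int (jj i) + 1)) powr \<theta>"
      using mu_pos[OF i] theta_pos by (intro powr_mono2) auto
    also have "\<dots> = 2 powr (\<theta> * (real_of_int (jj i) + 1))" by (simp add: powr_powr mult.commute)
    also have "\<theta> * (real_of_int (jj i) + 1) = \<theta> * (real_of_int J + 1) + (-\<theta>) * real (m i)"
      using J[OF i] by (simp add: m_def algebra_simps)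
    also have "2 powr \<dots> = 2 powr (\<theta> * (real_of_int J + 1)) * 2 powr ((-\<theta>) * real (m i))"
      by (rule powr_add)
    also have "2 powr ((-\<theta>) * real (m i)) = q ^ m i"
      using q by (simp add: q_def powr_powr flip: powr_realpow)
    finally show ?thesis .
  qed
  have bound: "(\<Sum>i\<in>F. (b i)\<^sup>2) \<le> A * (1 / (1 - q))" if F: "finite F" "F \<subseteq> I" for F
  proof -
    have piece: "(\<Sum>i\<in>{i\<in>F. m i = n}. (b i)\<^sup>2) \<le> A * q ^ n" for n
    proof -
      have sub: "{i\<in>F. m i = n} \<subseteq> block I \<mu> (J - int n)"
      proof
        fix i assume "i \<in> {i\<in>F. m i = n}"
        then have i: "i \<in> I" "m i = n" using F(2) by auto
        then have "jj i = J - int n" using J[OF i(1)] by (simp add: m_def)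
        then show "i \<in> block I \<mu> (J - int n)" using jj[OF i(1)] by simp
      qed
      have "(b i)\<^sup>2 \<le> (2 powr (\<theta> * (real_of_int J + 1)) * q ^ n) * ((b i)\<^sup>2 * \<mu> i powr (-\<theta>))"
        if i: "i \<in> {i\<in>F. m i = n}" for i
      proof -
        have iI: "i \<in> I" using i F(2) by auto
        have "(b i)\<^sup>2 = \<mu> i powr \<theta> * ((b i)\<^sup>2 * \<mu> i powr (-\<theta>))"
          using mu_pos[OF iI] by (simp add: powr_minus)
        also have "\<dots> \<le> (2 powr (\<theta> * (real_of_int J + 1)) * q ^ n) * ((b i)\<^sup>2 * \<mu> i powr (-\<theta>))"
          using weight[OF iI] i by (intro mult_right_mono) auto
        finally show ?thesis .
      qed
      then have "(\<Sum>i\<in>{i\<in>F. m i = n}. (b i)\<^sup>2)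
        \<le> (2 powr (\<theta> * (real_of_int J + 1)) * q ^ n) * (\<Sum>i\<in>{i\<in>F. m i = n}. (b i)\<^sup>2 * \<mu> i powr (-\<theta>))"
        unfolding sum_distrib_left by (rule sum_mono)
      also have "\<dots> \<le> (2 powr (\<theta> * (real_of_int J + 1)) * q ^ n) * C\<^sup>2"
        using q norm_le_block[OF b sub] by (intro mult_left_mono) auto
      finally show ?thesis by (simp add: A_def mult_ac)
    qed
    have "(\<Sum>i\<in>F. (b i)\<^sup>2) = (\<Sum>n\<in>m ` F. \<Sum>i\<in>{i\<in>F. m i = n}. (b i)\<^sup>2)"
      using F(1) by (rule sum.image_gen)
    also have "\<dots> \<le> (\<Sum>n\<in>m ` F. A * q ^ n)" by (intro sum_mono piece)
    also have "\<dots> \<le> (\<Sum>n. A * q ^ n)"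
      using q F(1) by (intro sum_le_suminf summable_mult summable_geometric) (auto simp: A_def)
    also have "\<dots> = A * (1 / (1 - q))"
      using q by (subst suminf_mult) (auto simp: suminf_geometric)
    finally show ?thesis .
  qed
  show ?thesis
  proof (rule summableI_nonneg_bounded)
    fix n
    have "(\<Sum>i<n. if i \<in> I then (b i)\<^sup>2 else 0) = (\<Sum>i\<in>{..<n} \<inter> I. (b i)\<^sup>2)"
      by (simp add: sum.inter_restrict)
    also have "\<dots> \<le> A * (1 / (1 - q))" by (rule bound) auto
    finally show "(\<Sum>i<n. if i \<in> I then (b i)\<^sup>2 else 0) \<le> A * (1 / (1 - q))" .
  qed auto
qed

lemma finite_support_in_seq_space:
  assumes fin: "finite {i \<in> I. b i \<noteq> 0}"
  shows "b \<in> seq_space I \<mu> \<theta> r"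
proof -
  have less: "j < j' + 1" if "i \<in> block I \<mu> j" "i \<in> block I \<mu> j'" for i j j'
  proof -
    have "2 powr real_of_int j < \<mu> i" "\<mu> i \<le> 2 powr real_of_int (j' + 1)"
      using that unfolding block_def two_powi by auto
    then have "2 powr real_of_int j < 2 powr real_of_int (j' + 1)" by (rule order_less_le_trans)
    then have "real_of_int j < real_of_int (j' + 1)" by (subst (asm) powr_less_cancel_iff) auto
    then show ?thesis by (simp only: of_int_less_iff)
  qed
  have unique: "j = j'" if "i \<in> block I \<mu> j" "i \<in> block I \<mu> j'" for i j j'
    using less[OF that] less[OF that(2,1)] by simp
  have "finite {j. i \<in> block I \<mu> j}" for i
  proof (cases "\<exists>j. i \<in> block I \<mu> j")
    case True
    then obtain j where "i \<in> block I \<mu> j" by blast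
    then have "{j. i \<in> block I \<mu> j} \<subseteq> {j}" using unique by blast
    then show ?thesis by (rule finite_subset) simp
  qed simp
  then have "finite (\<Union>i\<in>{i \<in> I. b i \<noteq> 0}. {j. i \<in> block I \<mu> j})" using fin by (intro finite_UN_I) auto
  moreover have "{j. block_norm I \<mu> \<theta> b j \<noteq> 0} \<subseteq> (\<Union>i\<in>{i \<in> I. b i \<noteq> 0}. {j. i \<in> block I \<mu> j})"
  proof
    fix j assume "j \<in> {j. block_norm I \<mu> \<theta> b j \<noteq> 0}"
    then have "(\<Sum>i\<in>block I \<mu> j. (b i)\<^sup>2 * \<mu> i powr (-\<theta>)) \<noteq> 0"
      by (simp add: block_norm_def block_def)
    then obtain i where "i \<in> block I \<mu> j" "(b i)\<^sup>2 * \<mu> i powr (-\<theta>) \<noteq> 0"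
      by (meson sum.neutral)
    then show "j \<in> (\<Union>i\<in>{i \<in> I. b i \<noteq> 0}. {j. i \<in> block I \<mu> j})" by (auto simp: block_def)
  qed
  ultimately show ?thesis
    unfolding seq_space_def using finite_support_lr_finite[OF _ r_ge_1] finite_subset by blast
qed

lemma zero_in_seq_space: "(\<lambda>i. 0) \<in> seq_space I \<mu> \<theta> r" "seq_norm I \<mu> \<theta> r (\<lambda>i. 0) = 0"
proof -
  have "norm_le (\<lambda>i. 0) 0"
    by (simp add: lr_le_def block_norm_def)
  then show "(\<lambda>i. 0) \<in> seq_space I \<mu> \<theta> r" "seq_norm I \<mu> \<theta> r (\<lambda>i. 0) = 0"
    using seq_norm_nonneg by (auto simp: norm_le_iff order_antisym)
qed

lemma add_in_seq_space:
  assumes "b \<in> seq_space I \<mu> \<theta> r" "b' \<in> seq_space I \<mu> \<theta> r"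
  shows "(\<lambda>i. b i + b' i) \<in> seq_space I \<mu> \<theta> r"
  using norm_le_add[OF norm_le_seq_norm[OF assms(1)] norm_le_seq_norm[OF assms(2)]]
  by (simp add: norm_le_iff)

lemma scale_in_seq_space:
  assumes "b \<in> seq_space I \<mu> \<theta> r" shows "(\<lambda>i. a * b i) \<in> seq_space I \<mu> \<theta> r"
  using norm_le_scale[OF norm_le_seq_norm[OF assms]] by (simp add: norm_le_iff)

lemma seq_norm_scale_le:
  assumes "b \<in> seq_space I \<mu> \<theta> r"
  shows "seq_norm I \<mu> \<theta> r (\<lambda>i. a * b i) \<le> \<bar>a\<bar> * seq_norm I \<mu> \<theta> r b"
  using norm_le_scale[OF norm_le_seq_norm[OF assms]] by (simp add: norm_le_iff)

lemma seq_norm_eq_0: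
  assumes "b \<in> seq_space I \<mu> \<theta> r" "seq_norm I \<mu> \<theta> r b = 0" "i \<in> I"
  shows "b i = 0"
  using norm_le_component[OF norm_le_seq_norm[OF assms(1)] assms(3)] assms(2) by simp

lemma coef_space_normed: "normed_vspace (coef_space I \<mu> \<theta> r)"
proof -
  interpret real_vspace "coef_space I \<mu> \<theta> r"
    by unfold_locales
      (auto simp: zero_in_seq_space add_in_seq_space scale_in_seq_space algebra_simps)
  show ?thesis
  proof (rule normed_vspaceI)
    fix b b' :: "nat \<Rightarrow> real"
    assume b: "b \<in> vcarrier (coef_space I \<mu> \<theta> r)"
    show "b = vzero (coef_space I \<mu> \<theta> r)" if "vnorm (coef_space I \<mu> \<theta> r) b = 0"
    proof -
      have "b i = 0" for i using b that seq_norm_eq_0[of b i] by (cases "i \<in> I") auto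
      then show ?thesis by auto
    qed
    assume b': "b' \<in> vcarrier (coef_space I \<mu> \<theta> r)"
    show "vnorm (coef_space I \<mu> \<theta> r) (vadd (coef_space I \<mu> \<theta> r) b b')
      \<le> vnorm (coef_space I \<mu> \<theta> r) b + vnorm (coef_space I \<mu> \<theta> r) b'"
      using norm_le_add[OF norm_le_seq_norm norm_le_seq_norm] b b' by (simp add: norm_le_iff)
  qed (auto simp: zero_in_seq_space seq_norm_nonneg seq_norm_scale_le)
qed

text \<open>Single coefficients are bounded by the norm, so a Cauchy sequence converges
  coefficientwise; norm bounds pass to the coefficientwise limit by \<open>norm_le_limit\<close>.\<close>

lemma coef_space_banach: "banach_vspace (coef_space I \<mu> \<theta> r)"
proof -
  interpret Q: normed_vspace "coef_space I \<mu> \<theta> r" by (rule coef_space_normed)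
  interpret M: Metric_space "vcarrier (coef_space I \<mu> \<theta> r)" "vdist (coef_space I \<mu> \<theta> r)"
    by (rule Q.metric_space)
  have "\<exists>b. limitin M.mtopology s b sequentially" if cauchy: "M.MCauchy s" for s
  proof -
    have s: "s n \<in> seq_space I \<mu> \<theta> r" "i \<notin> I \<Longrightarrow> s n i = 0" for n i
      using cauchy unfolding M.MCauchy_def image_subset_iff by simp_all
    have dist: "vdist (coef_space I \<mu> \<theta> r) (s n) (s m) = seq_norm I \<mu> \<theta> r (\<lambda>i. s n i - s m i)" for n m
      using s by (simp add: vdist_def)
    have diff: "(\<lambda>i. s n i - s m i) \<in> seq_space I \<mu> \<theta> r" for n m
      using add_in_seq_space[OF s(1) scale_in_seq_space[OF s(1), of "-1"], of n m] by simp
    have close: "\<exists>N. \<forall>n\<ge>N. \<forall>m\<ge>N. norm_le (\<lambda>i. s n i - s m i) \<epsilon>" if "0 < \<epsilon>" for \<epsilon>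
    proof -
      have "\<forall>\<epsilon>>0. \<exists>N. \<forall>n m. N \<le> n \<longrightarrow> N \<le> m \<longrightarrow> vdist (coef_space I \<mu> \<theta> r) (s n) (s m) < \<epsilon>"
        using cauchy unfolding M.MCauchy_def by (rule conjunct2)
      from this[rule_format, OF \<open>0 < \<epsilon>\<close>]
      obtain N where "\<And>n m. \<lbrakk>N \<le> n; N \<le> m\<rbrakk> \<Longrightarrow> vdist (coef_space I \<mu> \<theta> r) (s n) (s m) < \<epsilon>"
        by blast
      then have "norm_le (\<lambda>i. s n i - s m i) \<epsilon>" if "N \<le> n" "N \<le> m" for n m
        using that diff by (simp add: norm_le_iff less_imp_le flip: dist)
      then show ?thesis by blast
    qed
    have "\<exists>l. (\<lambda>n. s n i) \<longlonglongrightarrow> l \<and> (i \<notin> I \<longrightarrow> l = 0)" for i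
    proof (cases "i \<in> I")
      case True
      have "Cauchy (\<lambda>n. s n i)"
      proof (rule metric_CauchyI)
        fix \<epsilon> :: real assume \<epsilon>: "0 < \<epsilon>"
        define \<delta> where "\<delta> = \<epsilon> / (2 * \<mu> i powr (\<theta> / 2))"
        have pos: "0 < \<mu> i powr (\<theta> / 2)" using mu_pos[OF True] by simp
        then have "0 < \<delta>" using \<epsilon> by (simp add: \<delta>_def)
        then obtain N where N: "\<And>n m. \<lbrakk>N \<le> n; N \<le> m\<rbrakk> \<Longrightarrow> norm_le (\<lambda>i. s n i - s m i) \<delta>"
          using close by blast
        have "dist (s m i) (s n i) < \<epsilon>" if "N \<le> m" "N \<le> n" for m n
        proof -
          have "\<bar>s m i - s n i\<bar> \<le> \<mu> i powr (\<theta> / 2) * \<delta>"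
            using norm_le_component[OF N[OF that] True] .
          also have "\<dots> = \<epsilon> / 2" using pos by (simp add: \<delta>_def)
          finally show ?thesis using \<epsilon> by (simp add: dist_real_def)
        qed
        then show "\<exists>N. \<forall>m\<ge>N. \<forall>n\<ge>N. dist (s m i) (s n i) < \<epsilon>" by blast
      qed
      then obtain l where "(\<lambda>n. s n i) \<longlonglongrightarrow> l"
        unfolding Cauchy_convergent_iff convergent_def by blast
      then show ?thesis using True by blast
    next
      case False then show ?thesis using s(2)[OF False] by (intro exI[of _ 0]) simp
    qed
    then obtain b where b: "\<And>i. (\<lambda>n. s n i) \<longlonglongrightarrow> b i" "\<And>i. i \<notin> I \<Longrightarrow> b i = 0" by metis
    have conv: "\<exists>N. \<forall>n\<ge>N. norm_le (\<lambda>i. s n i - b i) \<epsilon>" if \<epsilon>: "0 < \<epsilon>" for \<epsilon>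
    proof -
      obtain N where N: "\<And>n m. \<lbrakk>N \<le> n; N \<le> m\<rbrakk> \<Longrightarrow> norm_le (\<lambda>i. s n i - s m i) \<epsilon>"
        using close[OF \<epsilon>] by blast
      have "norm_le (\<lambda>i. s n i - b i) \<epsilon>" if "N \<le> n" for n
      proof (rule norm_le_limit[where b = "\<lambda>m i. s n i - s m i" and N = N])
        show "(\<lambda>m. s n i - s m i) \<longlonglongrightarrow> s n i - b i" for i
          by (intro tendsto_diff tendsto_const b(1))
      qed (use N that in blast)
      then show ?thesis by blast
    qed
    obtain n0 where "norm_le (\<lambda>i. s n0 i - b i) 1" using conv[of 1] by auto
    then have "(\<lambda>i. s n0 i - b i) \<in> seq_space I \<mu> \<theta> r" by (simp add: norm_le_iff)
    from add_in_seq_space[OF s(1)[of n0] scale_in_seq_space[OF this, of "-1"]]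
    have bS: "b \<in> seq_space I \<mu> \<theta> r" by simp
    have "limitin M.mtopology s b sequentially"
      unfolding M.limit_metric_sequentially
    proof (intro conjI allI impI)
      show "b \<in> vcarrier (coef_space I \<mu> \<theta> r)" using bS b(2) by simp
      fix \<epsilon> :: real assume \<epsilon>: "0 < \<epsilon>"
      then obtain N where N: "\<And>n. N \<le> n \<Longrightarrow> norm_le (\<lambda>i. s n i - b i) (\<epsilon> / 2)"
        using conv[of "\<epsilon> / 2"] by auto
      have "vdist (coef_space I \<mu> \<theta> r) (s n) b < \<epsilon>" if "N \<le> n" for n
      proof -
        have "vdist (coef_space I \<mu> \<theta> r) (s n) b = seq_norm I \<mu> \<theta> r (\<lambda>i. s n i - b i)"
          using s bS b(2) by (simp add: vdist_def)
        also have "\<dots> \<le> \<epsilon> / 2" using N[OF that] by (simp add: norm_le_iff)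
        finally show ?thesis using \<epsilon> by simp
      qed
      moreover have "s n \<in> vcarrier (coef_space I \<mu> \<theta> r)" for n using s by simp
      ultimately show "\<exists>N. \<forall>n\<ge>N. s n \<in> vcarrier (coef_space I \<mu> \<theta> r)
          \<and> vdist (coef_space I \<mu> \<theta> r) (s n) b < \<epsilon>"
        by blast
    qed
    then show ?thesis by blast
  qed
  then show ?thesis
    unfolding banach_vspace_def M.mcomplete_def using coef_space_normed by blast
qed

end

section \<open>Spaces of classes and of bounded functions\<close>

lemma mem_ae_class: "g \<in> ae_class M f \<longleftrightarrow> g \<in> measurable_functions M \<and> (AE x in M. g x = f x)"
  by (simp add: ae_class_def)

lemma ae_class_cong:
  assumes "AE x in M. f x = g x" shows "ae_class M f = ae_class M g"
proof -
  have "(AE x in M. h x = f x) \<longleftrightarrow> (AE x in M. h x = g x)" for h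
    using assms by (auto elim: eventually_elim2)
  then show ?thesis by (simp add: ae_class_def)
qed

lemma restrict_measurable_functions:
  assumes "f \<in> borel_measurable M" shows "restrict f (space M) \<in> measurable_functions M"
  using assms by (auto simp: measurable_functions_def cong: measurable_cong_simp)

lemma restrict_mem_ae_class:
  "f \<in> borel_measurable M \<Longrightarrow> restrict f (space M) \<in> ae_class M f"
  by (simp add: mem_ae_class restrict_measurable_functions)

lemma ae_class_restrict: "ae_class M (restrict f (space M)) = ae_class M f"
  by (rule ae_class_cong) simp

lemma ae_class_eq_iff:
  assumes "f \<in> borel_measurable M"
  shows "ae_class M f = ae_class M g \<longleftrightarrow> (AE x in M. f x = g x)"
proof
  assume "ae_class M f = ae_class M g"
  then have "restrict f (space M) \<in> ae_class M g" using restrict_mem_ae_class[OF assms] by simp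
  then show "AE x in M. f x = g x" by (auto simp: mem_ae_class)
qed (rule ae_class_cong)

lemma rep_ae_class:
  assumes "f \<in> borel_measurable M"
  shows "rep (ae_class M f) \<in> borel_measurable M" "AE x in M. rep (ae_class M f) x = f x"
proof -
  have "rep (ae_class M f) \<in> ae_class M f"
    unfolding rep_def
    by (rule someI[of "\<lambda>g. g \<in> ae_class M f"]) (rule restrict_mem_ae_class[OF assms])
  then show "rep (ae_class M f) \<in> borel_measurable M" "AE x in M. rep (ae_class M f) x = f x"
    by (auto simp: mem_ae_class measurable_functions_def)
qed

lemma class_add_ae_class:
  assumes "f \<in> borel_measurable M" "g \<in> borel_measurable M"
  shows "class_add M (ae_class M f) (ae_class M g) = ae_class M (\<lambda>x. f x + g x)"
  unfolding class_add_def
  by (rule ae_class_cong) (use rep_ae_class(2)[OF assms(1)] rep_ae_class(2)[OF assms(2)] in \<open>auto elim: eventually_elim2\<close>)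

lemma class_scale_ae_class:
  assumes "f \<in> borel_measurable M"
  shows "class_scale M a (ae_class M f) = ae_class M (\<lambda>x. a * f x)"
  unfolding class_scale_def
  by (rule ae_class_cong) (use rep_ae_class(2)[OF assms] in \<open>auto elim: eventually_mono\<close>)

lemma ae_class_real_vspace:
  assumes carrier: "vcarrier V = ae_class M ` S" and S: "S \<subseteq> borel_measurable M"
    and ops: "vzero V = ae_class M (\<lambda>x. 0)" "vadd V = class_add M" "vscale V = class_scale M"
    and closed: "(\<lambda>x. 0) \<in> S" "\<And>f g. \<lbrakk>f \<in> S; g \<in> S\<rbrakk> \<Longrightarrow> (\<lambda>x. f x + g x) \<in> S"
      "\<And>a f. f \<in> S \<Longrightarrow> (\<lambda>x. a * f x) \<in> S"
  shows "real_vspace V"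
proof -
  have [measurable]: "f \<in> borel_measurable M" if "f \<in> S" for f using S that by auto
  show ?thesis
    by unfold_locales
      (auto simp: carrier ops class_add_ae_class class_scale_ae_class closed imageI algebra_simps)
qed

text \<open>Unlike \<^const>\<open>square_integrable_functions\<close>, this does not fix the values outside
  \<^term>\<open>space M\<close>, so that sums and multiples can be written as plain functions.\<close>

definition sq_integrable :: "'a measure \<Rightarrow> ('a \<Rightarrow> real) \<Rightarrow> bool" where
  "sq_integrable M f \<longleftrightarrow> f \<in> borel_measurable M \<and> integrable M (\<lambda>x. (f x)\<^sup>2)"

lemma sq_integrable_measurable: "sq_integrable M f \<Longrightarrow> f \<in> borel_measurable M"
  by (simp add: sq_integrable_def)

lemma sq_integrable_mult:
  assumes "sq_integrable M f" "sq_integrable M g"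
  shows "integrable M (\<lambda>x. f x * g x)"
proof (rule Bochner_Integration.integrable_bound)
  show "integrable M (\<lambda>x. (f x)\<^sup>2 + (g x)\<^sup>2)" using assms by (simp add: sq_integrable_def)
  show "(\<lambda>x. f x * g x) \<in> borel_measurable M"
    using assms by (intro borel_measurable_times) (auto simp: sq_integrable_def)
  have "\<bar>a * b\<bar> \<le> a\<^sup>2 + b\<^sup>2" for a b :: real
  proof -
    have "2 * (\<bar>a\<bar> * \<bar>b\<bar>) \<le> a\<^sup>2 + b\<^sup>2" using sum_squares_bound[of "\<bar>a\<bar>" "\<bar>b\<bar>"] by (simp add: mult.assoc)
    moreover have "0 \<le> \<bar>a\<bar> * \<bar>b\<bar>" by simp
    ultimately show ?thesis unfolding abs_mult by linarith
  qed
  then show "AE x in M. norm (f x * g x) \<le> norm ((f x)\<^sup>2 + (g x)\<^sup>2)" by simp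
qed

lemma sq_integrable_zero: "sq_integrable M (\<lambda>x. 0)"
  by (simp add: sq_integrable_def)

lemma sq_integrable_add:
  assumes "sq_integrable M f" "sq_integrable M g"
  shows "sq_integrable M (\<lambda>x. f x + g x)"
proof -
  have "integrable M (\<lambda>x. (f x)\<^sup>2 + (g x)\<^sup>2 + 2 * (f x * g x))"
    using assms sq_integrable_mult[OF assms] by (simp add: sq_integrable_def)
  moreover have "(\<lambda>x. f x + g x) \<in> borel_measurable M"
    using assms by (intro borel_measurable_add) (auto simp: sq_integrable_def)
  ultimately show ?thesis by (simp add: sq_integrable_def power2_sum mult.assoc)
qed

lemma sq_integrable_scale: "sq_integrable M f \<Longrightarrow> sq_integrable M (\<lambda>x. a * f x)"
  by (auto simp: sq_integrable_def power_mult_distrib intro: borel_measurable_times)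

lemma sq_integrable_diff:
  assumes "sq_integrable M f" "sq_integrable M g"
  shows "sq_integrable M (\<lambda>x. f x - g x)"
  using sq_integrable_add[OF assms(1) sq_integrable_scale[OF assms(2), of "-1"]] by simp

lemma sq_integrable_sum:
  assumes "\<And>i. i \<in> A \<Longrightarrow> sq_integrable M (f i)"
  shows "sq_integrable M (\<lambda>x. \<Sum>i\<in>A. f i x)"
  using assms
  by (induction A rule: infinite_finite_induct) (auto simp: sq_integrable_zero sq_integrable_add)

lemma L2_simps [simp]:
  "vzero (L2 M) = ae_class M (\<lambda>x. 0)" "vadd (L2 M) = class_add M" "vscale (L2 M) = class_scale M"
  by (simp_all add: L2_def)

lemma L2_carrier: "vcarrier (L2 M) = ae_class M ` {f. sq_integrable M f}"
proof
  show "vcarrier (L2 M) \<subseteq> ae_class M ` {f. sq_integrable M f}"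
    by (auto simp: L2_def square_integrable_functions_def measurable_functions_def sq_integrable_def)
  show "ae_class M ` {f. sq_integrable M f} \<subseteq> vcarrier (L2 M)"
  proof
    fix c assume "c \<in> ae_class M ` {f. sq_integrable M f}"
    then obtain f where f: "sq_integrable M f" "c = ae_class M f" by auto
    have "integrable M (\<lambda>x. (restrict f (space M) x)\<^sup>2)"
      using f(1) by (simp add: sq_integrable_def cong: Bochner_Integration.integrable_cong)
    then have "restrict f (space M) \<in> square_integrable_functions M"
      using f(1) by (simp add: square_integrable_functions_def restrict_measurable_functions sq_integrable_def)
    then have "ae_class M (restrict f (space M)) \<in> vcarrier (L2 M)"
      by (simp add: L2_def)
    then show "c \<in> vcarrier (L2 M)" by (simp add: f(2) ae_class_restrict)
  qed
qed

lemma ae_class_in_L2: "sq_integrable M f \<Longrightarrow> ae_class M f \<in> vcarrier (L2 M)"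
  by (simp add: L2_carrier)

lemma L2_inner:
  assumes "sq_integrable M f" "sq_integrable M g"
  shows "vinner (L2 M) (ae_class M f) (ae_class M g) = (\<integral>x. f x * g x \<partial>M)"
proof -
  have [measurable]: "f \<in> borel_measurable M" "g \<in> borel_measurable M"
    using assms by (auto simp: sq_integrable_def)
  note [measurable] = rep_ae_class(1)[of f M] rep_ae_class(1)[of g M]
  have "(\<integral>x. rep (ae_class M f) x * rep (ae_class M g) x \<partial>M) = (\<integral>x. f x * g x \<partial>M)"
  proof (rule integral_cong_AE)
    show "AE x in M. rep (ae_class M f) x * rep (ae_class M g) x = f x * g x"
      using rep_ae_class(2)[of f M] rep_ae_class(2)[of g M] by (auto elim: eventually_elim2)
  qed auto
  then show ?thesis by (simp add: L2_def)
qed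

lemma L2_ip_vspace: "ip_vspace (L2 M)"
proof -
  interpret real_vspace "L2 M"
    by (rule ae_class_real_vspace[OF L2_carrier])
      (auto simp: sq_integrable_zero sq_integrable_add sq_integrable_scale sq_integrable_measurable)
  show ?thesis
  proof
    fix u v w a
    assume "u \<in> vcarrier (L2 M)"
    then obtain f where f: "sq_integrable M f" "u = ae_class M f" by (auto simp: L2_carrier)
    note fm = sq_integrable_measurable[OF f(1)]
    show "0 \<le> vinner (L2 M) u u" using f by (simp add: L2_inner)
    show "vnorm (L2 M) u = sqrt (vinner (L2 M) u u)" by (simp add: L2_def power2_eq_square)
    show "u = vzero (L2 M)" if "vinner (L2 M) u u = 0"
    proof -
      have "(\<integral>x. f x * f x \<partial>M) = 0" using that f by (simp add: L2_inner)
      then have "AE x in M. f x * f x = 0"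
        using sq_integrable_mult[OF f(1) f(1)] by (subst (asm) integral_nonneg_eq_0_iff_AE) auto
      then show ?thesis by (simp add: f(2) ae_class_eq_iff[OF fm])
    qed
    assume "v \<in> vcarrier (L2 M)"
    then obtain g where g: "sq_integrable M g" "v = ae_class M g" by (auto simp: L2_carrier)
    note gm = sq_integrable_measurable[OF g(1)]
    show "vinner (L2 M) u v = vinner (L2 M) v u" using f g by (simp add: L2_inner mult.commute)
    show "vinner (L2 M) (vscale (L2 M) a u) v = a * vinner (L2 M) u v"
      using f g fm by (simp add: class_scale_ae_class L2_inner sq_integrable_scale mult.assoc)
    assume "w \<in> vcarrier (L2 M)"
    then obtain h where h: "sq_integrable M h" "w = ae_class M h" by (auto simp: L2_carrier)
    show "vinner (L2 M) (vadd (L2 M) u v) w = vinner (L2 M) u w + vinner (L2 M) v w"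
      using f g h fm gm
      by (simp add: class_add_ae_class L2_inner sq_integrable_add distrib_right sq_integrable_mult)
  qed
qed

lemma L2_normed: "normed_vspace (L2 M)"
  by (rule ip_vspace.normed[OF L2_ip_vspace])

lemma L2_norm:
  assumes "sq_integrable M f"
  shows "vnorm (L2 M) (ae_class M f) = sqrt (\<integral>x. (f x)\<^sup>2 \<partial>M)"
  using ip_vspace.norm_eq_sqrt[OF L2_ip_vspace ae_class_in_L2[OF assms]] assms
  by (simp add: L2_inner power2_eq_square)

lemma L2_diff:
  assumes "f \<in> borel_measurable M" "g \<in> borel_measurable M"
  shows "vdiff (L2 M) (ae_class M f) (ae_class M g) = ae_class M (\<lambda>x. f x - g x)"
  using assms by (simp add: class_scale_ae_class class_add_ae_class)

lemma L_infinity_simps [simp]: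
  "vzero (L_infinity M) = ae_class M (\<lambda>x. 0)" "vadd (L_infinity M) = class_add M"
  "vscale (L_infinity M) = class_scale M"
  by (simp_all add: L_infinity_def)

lemma L_infinity_carrier:
  "vcarrier (L_infinity M) = ae_class M ` {f \<in> borel_measurable M. \<exists>C. AE x in M. \<bar>f x\<bar> \<le> C}"
proof
  show "vcarrier (L_infinity M) \<subseteq> ae_class M ` {f \<in> borel_measurable M. \<exists>C. AE x in M. \<bar>f x\<bar> \<le> C}"
    by (auto simp: L_infinity_def measurable_functions_def)
  show "ae_class M ` {f \<in> borel_measurable M. \<exists>C. AE x in M. \<bar>f x\<bar> \<le> C} \<subseteq> vcarrier (L_infinity M)"
  proof
    fix c assume "c \<in> ae_class M ` {f \<in> borel_measurable M. \<exists>C. AE x in M. \<bar>f x\<bar> \<le> C}"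
    then obtain f C where f: "f \<in> borel_measurable M" "AE x in M. \<bar>f x\<bar> \<le> C" "c = ae_class M f" by auto
    have "AE x in M. \<bar>restrict f (space M) x\<bar> \<le> C"
      using f(2) AE_space by eventually_elim auto
    then have "ae_class M (restrict f (space M)) \<in> vcarrier (L_infinity M)"
      using restrict_measurable_functions[OF f(1)] by (auto simp: L_infinity_def intro!: imageI exI[of _ C])
    then show "c \<in> vcarrier (L_infinity M)" by (simp add: f(3) ae_class_restrict)
  qed
qed

lemma L_infinity_norm:
  assumes "f \<in> borel_measurable M"
  shows "vnorm (L_infinity M) (ae_class M f) = real_of_ereal (esssup M (\<lambda>x. ereal \<bar>f x\<bar>))"
proof -
  have "esssup M (\<lambda>x. ereal \<bar>rep (ae_class M f) x\<bar>) = esssup M (\<lambda>x. ereal \<bar>f x\<bar>)"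
    using rep_ae_class[OF assms] assms by (intro esssup_AE_cong) (auto elim: eventually_mono)
  then show ?thesis by (simp add: L_infinity_def)
qed

lemma esssup_abs_nonneg:
  fixes f :: "'a \<Rightarrow> real"
  assumes "emeasure M (space M) \<noteq> 0"
  shows "0 \<le> esssup M (\<lambda>x. ereal \<bar>f x\<bar>)"
proof (rule ccontr)
  assume neg: "\<not> 0 \<le> esssup M (\<lambda>x. ereal \<bar>f x\<bar>)"
  have "AE x in M. False"
    using esssup_AE[of "\<lambda>x. ereal \<bar>f x\<bar>" M]
  proof eventually_elim
    case (elim x)
    have "0 \<le> ereal \<bar>f x\<bar>" by simp
    then show False using elim neg order_trans by blast
  qed
  then show False using assms by (simp add: AE_iff_null null_sets_def)
qed

text \<open>The next three lemmas characterise the norm as the least nonnegative essential bound. This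
  includes the case of the zero measure, where the essential supremum is \<open>-\<infinity>\<close> and the norm is 0.\<close>

lemma L_infinity_norm_nonneg:
  assumes "f \<in> borel_measurable M" shows "0 \<le> vnorm (L_infinity M) (ae_class M f)"
proof (cases "emeasure M (space M) = 0")
  case True
  then show ?thesis using assms by (simp add: L_infinity_norm esssup_zero_space)
next
  case False
  then show ?thesis using assms esssup_abs_nonneg[OF False, of f]
    by (simp add: L_infinity_norm real_of_ereal_pos)
qed

lemma L_infinity_norm_le:
  assumes f: "f \<in> borel_measurable M" and "0 \<le> C" "AE x in M. \<bar>f x\<bar> \<le> C"
  shows "vnorm (L_infinity M) (ae_class M f) \<le> C"
proof -
  have "esssup M (\<lambda>x. ereal \<bar>f x\<bar>) \<le> ereal C"
    using assms by (intro esssup_I) auto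
  then show ?thesis using \<open>0 \<le> C\<close> f
    by (cases "esssup M (\<lambda>x. ereal \<bar>f x\<bar>)") (auto simp: L_infinity_norm)
qed

lemma AE_le_L_infinity_norm:
  assumes f: "f \<in> borel_measurable M" and bound: "AE x in M. \<bar>f x\<bar> \<le> C"
  shows "AE x in M. \<bar>f x\<bar> \<le> vnorm (L_infinity M) (ae_class M f)"
proof (cases "emeasure M (space M) = 0")
  case True
  then have "space M \<in> null_sets M" by auto
  then show ?thesis by (rule AE_I') auto
next
  case False
  have "esssup M (\<lambda>x. ereal \<bar>f x\<bar>) \<le> ereal C"
    using f bound by (intro esssup_I) auto
  then have "esssup M (\<lambda>x. ereal \<bar>f x\<bar>) = ereal (vnorm (L_infinity M) (ae_class M f))"
    using esssup_abs_nonneg[OF False, of f] f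
    by (cases "esssup M (\<lambda>x. ereal \<bar>f x\<bar>)") (auto simp: L_infinity_norm)
  then show ?thesis using esssup_AE[of "\<lambda>x. ereal \<bar>f x\<bar>" M] by simp
qed

lemma L_infinity_normed: "normed_vspace (L_infinity M)"
proof -
  have bdd_add: "\<exists>D. AE x in M. \<bar>f x + g x\<bar> \<le> D"
    if "AE x in M. \<bar>f x\<bar> \<le> A" "AE x in M. \<bar>g x\<bar> \<le> B" for f g :: "'a \<Rightarrow> real" and A B
    using that by (intro exI[of _ "A + B"]) (auto elim!: eventually_elim2)
  have bdd_scale: "\<exists>D. AE x in M. \<bar>a * f x\<bar> \<le> D" if "AE x in M. \<bar>f x\<bar> \<le> A" for f :: "'a \<Rightarrow> real" and a A
    using that by (intro exI[of _ "\<bar>a\<bar> * A"]) (auto elim!: eventually_mono simp: abs_mult mult_left_mono)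
  interpret real_vspace "L_infinity M"
    by (rule ae_class_real_vspace[OF L_infinity_carrier]) (auto intro: bdd_add bdd_scale)
  show ?thesis
  proof (rule normed_vspaceI)
    have "vnorm (L_infinity M) (ae_class M (\<lambda>x. 0)) \<le> 0" by (rule L_infinity_norm_le) auto
    then show "vnorm (L_infinity M) (vzero (L_infinity M)) = 0"
      using L_infinity_norm_nonneg[of "\<lambda>x. 0" M] by simp
    fix c d a
    assume "c \<in> vcarrier (L_infinity M)"
    then obtain f A where f: "f \<in> borel_measurable M" "AE x in M. \<bar>f x\<bar> \<le> A" "c = ae_class M f"
      by (auto simp: L_infinity_carrier)
    note fle = AE_le_L_infinity_norm[OF f(1,2)] and f0 = L_infinity_norm_nonneg[OF f(1)]
    show "0 \<le> vnorm (L_infinity M) c" using f0 f(3) by simp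
    show "c = vzero (L_infinity M)" if "vnorm (L_infinity M) c = 0"
      using fle that f by (auto simp: ae_class_eq_iff)
    have "AE x in M. \<bar>a * f x\<bar> \<le> \<bar>a\<bar> * vnorm (L_infinity M) (ae_class M f)"
      using fle by (auto elim!: eventually_mono simp: abs_mult mult_left_mono)
    then show "vnorm (L_infinity M) (vscale (L_infinity M) a c) \<le> \<bar>a\<bar> * vnorm (L_infinity M) c"
      using f f0 by (auto simp: class_scale_ae_class intro!: L_infinity_norm_le)
    assume "d \<in> vcarrier (L_infinity M)"
    then obtain g B where g: "g \<in> borel_measurable M" "AE x in M. \<bar>g x\<bar> \<le> B" "d = ae_class M g"
      by (auto simp: L_infinity_carrier)
    note gle = AE_le_L_infinity_norm[OF g(1,2)] and g0 = L_infinity_norm_nonneg[OF g(1)]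
    have "AE x in M. \<bar>f x + g x\<bar> \<le> vnorm (L_infinity M) (ae_class M f) + vnorm (L_infinity M) (ae_class M g)"
      using fle gle by eventually_elim auto
    then show "vnorm (L_infinity M) (vadd (L_infinity M) c d)
      \<le> vnorm (L_infinity M) c + vnorm (L_infinity M) d"
      using f g f0 g0 by (auto simp: class_add_ae_class intro!: L_infinity_norm_le)
  qed
qed

lemma bounded_functions_simps [simp]:
  "vcarrier (bounded_functions M) = {f \<in> measurable_functions M. bounded (f ` space M)}"
  "vzero (bounded_functions M) = (\<lambda>x\<in>space M. 0)"
  "vadd (bounded_functions M) f g = (\<lambda>x\<in>space M. f x + g x)"
  "vscale (bounded_functions M) a f = (\<lambda>x\<in>space M. a * f x)"
  by (simp_all add: bounded_functions_def)

lemma bounded_functions_norm_le_iff: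
  assumes "bounded (f ` space M)"
  shows "vnorm (bounded_functions M) f \<le> C \<longleftrightarrow> 0 \<le> C \<and> (\<forall>x\<in>space M. \<bar>f x\<bar> \<le> C)"
proof -
  obtain D where "\<And>x. x \<in> space M \<Longrightarrow> \<bar>f x\<bar> \<le> D" using assms by (auto simp: bounded_iff)
  then have "bdd_above (insert 0 ((\<lambda>x. \<bar>f x\<bar>) ` space M))"
    by (auto intro!: bdd_aboveI2[where M = D])
  then show ?thesis by (auto simp: bounded_functions_def cSup_le_iff)
qed

lemma bounded_image_iff: "bounded ((f :: 'a \<Rightarrow> real) ` S) \<longleftrightarrow> (\<exists>C. \<forall>x\<in>S. \<bar>f x\<bar> \<le> C)"
  by (auto simp: bounded_iff)

lemma bounded_functions_normed: "normed_vspace (bounded_functions M)"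
proof -
  have meas: "f \<in> borel_measurable M" "f \<in> extensional (space M)" if "f \<in> measurable_functions M" for f
    using that by (auto simp: measurable_functions_def)
  have add: "\<bar>f x + g x\<bar> \<le> A + B" if "\<bar>f x\<bar> \<le> A" "\<bar>g x\<bar> \<le> B" for f g :: "'a \<Rightarrow> real" and x A B
    using that by simp
  have scale: "\<bar>a * f x\<bar> \<le> \<bar>a\<bar> * A" if "\<bar>f x\<bar> \<le> A" for f :: "'a \<Rightarrow> real" and a x A
    using that by (simp add: abs_mult mult_left_mono)
  have add_bounded: "bounded ((\<lambda>x. f x + g x) ` space M)"
    if "bounded (f ` space M)" "bounded (g ` space M)" for f g :: "'a \<Rightarrow> real"
    using that add unfolding bounded_image_iff by metis
  have scale_bounded: "bounded ((\<lambda>x. a * f x) ` space M)"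
    if "bounded (f ` space M)" for f :: "'a \<Rightarrow> real" and a
    using that scale unfolding bounded_image_iff by metis
  interpret real_vspace "bounded_functions M"
  proof
    show "vadd (bounded_functions M) (vzero (bounded_functions M)) v = v"
      "vscale (bounded_functions M) 1 v = v"
      if "v \<in> vcarrier (bounded_functions M)" for v
      using that meas[of v] by (auto simp: extensional_def fun_eq_iff)
    show "vzero (bounded_functions M) \<in> vcarrier (bounded_functions M)"
      by (auto simp: bounded_image_iff intro!: restrict_measurable_functions)
  qed (auto simp: add_bounded scale_bounded meas fun_eq_iff algebra_simps
        intro!: restrict_measurable_functions borel_measurable_add borel_measurable_times)
  have upper: "\<bar>f x\<bar> \<le> vnorm (bounded_functions M) f"
    if "f \<in> vcarrier (bounded_functions M)" "x \<in> space M" for f x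
    using bounded_functions_norm_le_iff[of f M "vnorm (bounded_functions M) f"] that by simp
  have nonneg: "0 \<le> vnorm (bounded_functions M) f" if "f \<in> vcarrier (bounded_functions M)" for f
    using bounded_functions_norm_le_iff[of f M "vnorm (bounded_functions M) f"] that by simp
  show ?thesis
  proof (rule normed_vspaceI)
    have "vnorm (bounded_functions M) (vzero (bounded_functions M)) \<le> 0"
      by (subst bounded_functions_norm_le_iff) (auto simp: bounded_image_iff)
    then show "vnorm (bounded_functions M) (vzero (bounded_functions M)) = 0"
      using nonneg[OF zero_closed] by simp
    fix f g a
    assume f: "f \<in> vcarrier (bounded_functions M)"
    show "0 \<le> vnorm (bounded_functions M) f" by (rule nonneg[OF f])
    show "f = vzero (bounded_functions M)" if "vnorm (bounded_functions M) f = 0"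
      using upper[OF f] that meas(2)[of f] f by (auto simp: extensional_def fun_eq_iff)
    show "vnorm (bounded_functions M) (vscale (bounded_functions M) a f) \<le> \<bar>a\<bar> * vnorm (bounded_functions M) f"
      using scale_closed[OF f, of a] upper[OF f] nonneg[OF f]
      by (subst bounded_functions_norm_le_iff) (auto simp: abs_mult mult_left_mono)
    assume g: "g \<in> vcarrier (bounded_functions M)"
    show "vnorm (bounded_functions M) (vadd (bounded_functions M) f g)
      \<le> vnorm (bounded_functions M) f + vnorm (bounded_functions M) g"
      using add_closed[OF f g] upper[OF f] nonneg[OF f] upper[OF g] nonneg[OF g]
      by (subst bounded_functions_norm_le_iff) (auto intro!: add)
  qed
qed

section \<open>The eigenvalues of the compact embedding\<close>

lemma compact_embedding_props:
  assumes H: "hilbert_vspace H" and emb: "compactly_embedded_L2 M H"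
  shows sq_integrable_RKHS: "\<And>f. f \<in> vcarrier H \<Longrightarrow> sq_integrable M f"
    and ae_class_linear: "vlinear H (L2 M) (ae_class M)"
    and totally_bounded_image: "Metric_space.mtotally_bounded (vcarrier (L2 M)) (vdist (L2 M))
          (ae_class M ` vunit_ball H)"
proof -
  interpret L2: normed_vspace "L2 M" by (rule L2_normed)
  interpret L2M: Metric_space "vcarrier (L2 M)" "vdist (L2 M)" by (rule L2.metric_space)
  show "sq_integrable M f" if "f \<in> vcarrier H" for f
    using emb that by (auto simp: compactly_embedded_L2_def square_integrable_functions_def
        measurable_functions_def sq_integrable_def)
  show lin: "vlinear H (L2 M) (ae_class M)"
    using emb by (simp add: compactly_embedded_L2_def compact_operator_def)
  show "L2M.mtotally_bounded (ae_class M ` vunit_ball H)"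
  proof (rule L2M.compact_closure_of_imp_mtotally_bounded)
    show "ae_class M ` vunit_ball H \<subseteq> vcarrier (L2 M)"
      using lin by (auto simp: vlinear_def vunit_ball_def)
  qed (use emb in \<open>simp add: compactly_embedded_L2_def compact_operator_def vtopology_def\<close>)
qed

lemma embedding_bounded:
  assumes H: "hilbert_vspace H" and emb: "compactly_embedded_L2 M H"
  shows "\<exists>C. \<forall>u\<in>vcarrier H. vnorm (L2 M) (ae_class M u) \<le> C * vnorm H u"
proof -
  interpret H: ip_vspace H by (rule hilbert_ip_vspace[OF H])
  interpret H: normed_vspace H by (rule H.normed)
  interpret L2: normed_vspace "L2 M" by (rule L2_normed)
  interpret L2M: Metric_space "vcarrier (L2 M)" "vdist (L2 M)" by (rule L2.metric_space)
  note lin = ae_class_linear[OF H emb]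
  have mem: "ae_class M u \<in> vcarrier (L2 M)" if "u \<in> vcarrier H" for u
    using lin that by (auto simp: vlinear_def)
  have zero: "ae_class M (vzero H) = vzero (L2 M)"
  proof -
    have "ae_class M (vscale H 0 (vzero H)) = vscale (L2 M) 0 (ae_class M (vzero H))"
      using lin H.zero_closed unfolding vlinear_def by blast
    then show ?thesis
      using H.scale_zero_left[OF H.zero_closed] L2.scale_zero_left[OF mem[OF H.zero_closed]] by simp
  qed
  have "\<exists>B. \<forall>x\<in>ae_class M ` vunit_ball H. \<forall>y\<in>ae_class M ` vunit_ball H. vdist (L2 M) x y \<le> B"
    using L2M.mtotally_bounded_imp_mbounded[OF totally_bounded_image[OF H emb]]
    unfolding L2M.mbounded_alt by (rule conjunct2)
  then obtain B where B: "\<And>x y. \<lbrakk>x \<in> ae_class M ` vunit_ball H; y \<in> ae_class M ` vunit_ball H\<rbrakk>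
      \<Longrightarrow> vdist (L2 M) x y \<le> B"
    by auto
  have ball: "vnorm (L2 M) (ae_class M u) \<le> B" if u: "u \<in> vunit_ball H" for u
  proof -
    have u': "u \<in> vcarrier H" using u by (simp add: vunit_ball_def)
    have "vzero H \<in> vunit_ball H" by (simp add: vunit_ball_def H.zero_closed H.norm_zero)
    then have "vdist (L2 M) (ae_class M u) (ae_class M (vzero H)) \<le> B" using u by (intro B) auto
    moreover have "vdiff (L2 M) (ae_class M u) (vzero (L2 M)) = ae_class M u"
      using L2.add_zero_right[OF mem[OF u']] L2.scale_zero_right by (simp del: L2_simps)
    ultimately show ?thesis using mem[OF u'] L2.zero_closed by (simp add: vdist_def zero del: L2_simps)
  qed
  have "vnorm (L2 M) (ae_class M u) \<le> B * vnorm H u" if u: "u \<in> vcarrier H" for u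
  proof (cases "vnorm H u = 0")
    case True
    then have "u = vzero H" using u H.norm_eq_0 by simp
    then show ?thesis using True zero L2.norm_zero by simp
  next
    case False
    then have pos: "0 < vnorm H u" using H.norm_nonneg[OF u] by simp
    let ?w = "vscale H (1 / vnorm H u) u"
    have "?w \<in> vunit_ball H" using pos u by (simp add: vunit_ball_def H.scale_closed H.norm_scale)
    then have "vnorm (L2 M) (ae_class M ?w) \<le> B" by (rule ball)
    moreover have "ae_class M ?w = vscale (L2 M) (1 / vnorm H u) (ae_class M u)"
      using lin u unfolding vlinear_def by blast
    ultimately have "(1 / vnorm H u) * vnorm (L2 M) (ae_class M u) \<le> B"
      using L2.norm_scale[OF mem[OF u], of "1 / vnorm H u"] pos by simp
    then show ?thesis using pos by (simp add: pos_divide_le_eq)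
  qed
  then show ?thesis by blast
qed

text \<open>The Riesz representation theorem provides the vector that the definite description in
  \<^const>\<open>adjoint_op\<close> asks for.\<close>

lemma adjoint_op_ae_class:
  assumes H: "hilbert_vspace H" and emb: "compactly_embedded_L2 M H" and c: "c \<in> vcarrier (L2 M)"
  defines "v \<equiv> adjoint_op H (L2 M) (ae_class M) c"
  shows "v \<in> vcarrier H" and "\<And>u. u \<in> vcarrier H \<Longrightarrow> vinner (L2 M) (ae_class M u) c = vinner H u v"
proof -
  interpret H: ip_vspace H by (rule hilbert_ip_vspace[OF H])
  interpret L2: ip_vspace "L2 M" by (rule L2_ip_vspace)
  note lin = ae_class_linear[OF H emb]
  have mem: "ae_class M u \<in> vcarrier (L2 M)" if "u \<in> vcarrier H" for u
    using lin that by (auto simp: vlinear_def)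
  obtain C where C: "\<And>u. u \<in> vcarrier H \<Longrightarrow> vnorm (L2 M) (ae_class M u) \<le> C * vnorm H u"
    using embedding_bounded[OF H emb] by blast
  have "\<exists>v\<in>vcarrier H. \<forall>u\<in>vcarrier H. vinner (L2 M) (ae_class M u) c = vinner H u v"
  proof (rule riesz_representation[OF H])
    fix u v a assume u: "u \<in> vcarrier H"
    have "ae_class M (vscale H a u) = vscale (L2 M) a (ae_class M u)"
      using lin u unfolding vlinear_def by blast
    then show "vinner (L2 M) (ae_class M (vscale H a u)) c = a * vinner (L2 M) (ae_class M u) c"
      using L2.inner_scale_left[OF mem[OF u] c] by simp
    have "\<bar>vinner (L2 M) (ae_class M u) c\<bar> \<le> vnorm (L2 M) (ae_class M u) * vnorm (L2 M) c"
      by (rule L2.cauchy_schwarz[OF mem[OF u] c])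
    also have "\<dots> \<le> (C * vnorm H u) * vnorm (L2 M) c"
      using C[OF u] normed_vspace.norm_nonneg[OF L2_normed c] by (rule mult_right_mono)
    finally show "\<bar>vinner (L2 M) (ae_class M u) c\<bar> \<le> (C * vnorm (L2 M) c) * vnorm H u"
      by (simp add: mult_ac)
    assume v: "v \<in> vcarrier H"
    have "ae_class M (vadd H u v) = vadd (L2 M) (ae_class M u) (ae_class M v)"
      using lin u v unfolding vlinear_def by blast
    then show "vinner (L2 M) (ae_class M (vadd H u v)) c
        = vinner (L2 M) (ae_class M u) c + vinner (L2 M) (ae_class M v) c"
      using L2.inner_add_left[OF mem[OF u] mem[OF v] c] by simp
  qed
  moreover have "w = w'"
    if w: "w \<in> vcarrier H" "\<forall>u\<in>vcarrier H. vinner (L2 M) (ae_class M u) c = vinner H u w"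
      and w': "w' \<in> vcarrier H" "\<forall>u\<in>vcarrier H. vinner (L2 M) (ae_class M u) c = vinner H u w'"
    for w w'
  proof -
    have d: "vdiff H w w' \<in> vcarrier H" using w(1) w'(1) by (rule H.diff_closed)
    have "vinner H (vdiff H w w') (vdiff H w w')
        = vinner H (vdiff H w w') w - vinner H (vdiff H w w') w'"
      using H.inner_add_right[OF w(1) H.scale_closed[OF w'(1)] d] H.inner_scale_right[OF w'(1) d]
      by simp
    also have "\<dots> = 0" using w(2) w'(2) d by (metis diff_self)
    finally have "vdiff H w w' = vzero H" using d by (rule H.inner_eq_0[rotated])
    then show ?thesis using H.diff_eq_zero_iff w(1) w'(1) by simp
  qed
  ultimately have "\<exists>!v. v \<in> vcarrier H \<and> (\<forall>u\<in>vcarrier H. vinner (L2 M) (ae_class M u) c = vinner H u v)"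
    by blast
  from theI'[OF this]
  show "v \<in> vcarrier H" "\<And>u. u \<in> vcarrier H \<Longrightarrow> vinner (L2 M) (ae_class M u) c = vinner H u v"
    unfolding v_def adjoint_op_def by blast+
qed

lemma eigensystem_L2_orthonormal:
  assumes "eigensystem M H I \<mu> e"
  shows "i \<in> I \<Longrightarrow> ae_class M (e i) \<in> vcarrier (L2 M)"
    and "\<lbrakk>i \<in> I; j \<in> I\<rbrakk> \<Longrightarrow> vinner (L2 M) (ae_class M (e i)) (ae_class M (e j)) = (if i = j then 1 else 0)"
  using assms by (auto simp: eigensystem_def vorthonormal_def)

text \<open>If \<open>v\<close> is the image of \<open>c = [e i]\<close> under the adjoint of the embedding, then
  \<open>\<mu> i = \<langle>[v], c\<rangle> = \<langle>v, v\<rangle>\<close>, with the first inner product in \<^term>\<open>L2 M\<close> and the second in \<open>H\<close>.\<close>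

lemma eigenvalue_pos:
  assumes H: "hilbert_vspace H" and emb: "compactly_embedded_L2 M H"
    and sys: "eigensystem M H I \<mu> e" and i: "i \<in> I"
  shows "0 < \<mu> i"
proof -
  interpret H: ip_vspace H by (rule hilbert_ip_vspace[OF H])
  interpret L2: ip_vspace "L2 M" by (rule L2_ip_vspace)
  let ?c = "ae_class M (e i)"
  note c = eigensystem_L2_orthonormal(1)[OF sys i]
  let ?v = "adjoint_op H (L2 M) (ae_class M) ?c"
  note v = adjoint_op_ae_class[OF H emb c]
  have "ae_class M ?v = vscale (L2 M) (\<mu> i) ?c"
    using sys i by (simp add: eigensystem_def T_op_def)
  then have "\<mu> i = vinner (L2 M) (ae_class M ?v) ?c"
    using L2.inner_scale_left[OF c c, of "\<mu> i"] eigensystem_L2_orthonormal(2)[OF sys i i] by simp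
  also have "\<dots> = vinner H ?v ?v" by (rule v(2)[OF v(1)])
  finally have "0 \<le> \<mu> i" using H.inner_nonneg[OF v(1)] by simp
  moreover have "\<mu> i \<noteq> 0" using sys i by (simp add: eigensystem_def)
  ultimately show ?thesis by simp
qed

text \<open>The vectors \<open>sqrt (\<mu> i) e i\<close> lie in the unit ball of \<open>H\<close>, and their classes have mutual
  distances \<open>sqrt (\<mu> i + \<mu> j)\<close>. A totally bounded set contains only finitely many points whose
  mutual distances are bounded below.\<close>

lemma finite_eigenvalues_above:
  assumes H: "hilbert_vspace H" and emb: "compactly_embedded_L2 M H"
    and sys: "eigensystem M H I \<mu> e" and \<epsilon>: "0 < \<epsilon>"
  shows "finite {i \<in> I. \<epsilon> < \<mu> i}"
proof -
  interpret H: ip_vspace H by (rule hilbert_ip_vspace[OF H])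
  interpret L2: ip_vspace "L2 M" by (rule L2_ip_vspace)
  interpret L2: normed_vspace "L2 M" by (rule L2_normed)
  interpret L2M: Metric_space "vcarrier (L2 M)" "vdist (L2 M)" by (rule L2.metric_space)
  define g where "g i = vscale (L2 M) (sqrt (\<mu> i)) (ae_class M (e i))" for i
  have g: "g i \<in> vcarrier (L2 M)" if "i \<in> I" for i
    unfolding g_def using eigensystem_L2_orthonormal(1)[OF sys that] by (rule L2.scale_closed)
  have image: "g i \<in> ae_class M ` vunit_ball H" if i: "i \<in> I" for i
  proof -
    have e: "e i \<in> vcarrier H" using sys i by (simp add: eigensystem_def)
    have "vinner H (vscale H (sqrt (\<mu> i)) (e i)) (vscale H (sqrt (\<mu> i)) (e i)) = 1"
      using sys i by (simp add: eigensystem_def vorthonormal_def)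
    then have "vscale H (sqrt (\<mu> i)) (e i) \<in> vunit_ball H"
      using e by (simp add: vunit_ball_def H.norm_eq_sqrt H.scale_closed)
    moreover have "g i = ae_class M (vscale H (sqrt (\<mu> i)) (e i))"
      using ae_class_linear[OF H emb] e unfolding vlinear_def g_def by metis
    ultimately show ?thesis by blast
  qed
  have inner_g: "vinner (L2 M) (g i) (g j) = (if i = j then \<mu> i else 0)"
    if i: "i \<in> I" and j: "j \<in> I" for i j
  proof -
    note ei = eigensystem_L2_orthonormal(1)[OF sys i] and ej = eigensystem_L2_orthonormal(1)[OF sys j]
    have "vinner (L2 M) (g i) (g j) = sqrt (\<mu> i) * (sqrt (\<mu> j) * (if i = j then 1 else 0))"
      unfolding g_def
      using L2.inner_scale_left[OF ei L2.scale_closed[OF ej]] L2.inner_scale_right[OF ej ei]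
        eigensystem_L2_orthonormal(2)[OF sys i j] by simp
    then show ?thesis using eigenvalue_pos[OF H emb sys i] by auto
  qed
  have dist_g: "(vdist (L2 M) (g i) (g j))\<^sup>2 = \<mu> i + \<mu> j" if "i \<in> I" "j \<in> I" "i \<noteq> j" for i j
  proof -
    have "(vdist (L2 M) (g i) (g j))\<^sup>2 = vinner (L2 M) (vdiff (L2 M) (g i) (g j)) (vdiff (L2 M) (g i) (g j))"
      using g that L2.norm_sq[OF L2.diff_closed] by (simp add: vdist_def del: L2_simps)
    also have "\<dots> = \<mu> i + \<mu> j"
      using L2.inner_add_scale_sq[of "g i" "g j" "-1"] g that by (simp add: inner_g del: L2_simps)
    finally show ?thesis .
  qed
  \<comment> \<open>Two points in a common ball of this radius have distance less than \<open>sqrt (2 \<epsilon>)\<close>.\<close>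
  define \<delta> where "\<delta> = sqrt (2 * \<epsilon>) / 2"
  have "0 < \<delta>" using \<epsilon> by (simp add: \<delta>_def)
  from totally_bounded_image[OF H emb, unfolded L2M.mtotally_bounded_def, rule_format, OF this]
  obtain K where K: "finite K" "ae_class M ` vunit_ball H \<subseteq> (\<Union>x\<in>K. L2M.mball x \<delta>)"
    by (elim exE conjE)
  have "\<exists>x\<in>K. g i \<in> L2M.mball x \<delta>" if "i \<in> I" for i
    using subsetD[OF K(2) image[OF that]] by (rule UN_E) (rule bexI)
  then obtain x where x: "\<And>i. i \<in> I \<Longrightarrow> x i \<in> K" "\<And>i. i \<in> I \<Longrightarrow> g i \<in> L2M.mball (x i) \<delta>" by metis
  have "inj_on x {i \<in> I. \<epsilon> < \<mu> i}"
  proof (rule inj_onI, rule ccontr)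
    fix i j assume i: "i \<in> {i \<in> I. \<epsilon> < \<mu> i}" and j: "j \<in> {i \<in> I. \<epsilon> < \<mu> i}" and "x i = x j" "i \<noteq> j"
    have bi: "x i \<in> vcarrier (L2 M)" "vdist (L2 M) (x i) (g i) < \<delta>"
      and bj: "vdist (L2 M) (x i) (g j) < \<delta>"
      using x(2)[of i] x(2)[of j] i j \<open>x i = x j\<close> by auto
    have "vdist (L2 M) (g i) (g j) \<le> vdist (L2 M) (g i) (x i) + vdist (L2 M) (x i) (g j)"
      using i j g bi(1) by (intro L2M.triangle) auto
    then have "vdist (L2 M) (g i) (g j) < sqrt (2 * \<epsilon>)"
      using bi(2) bj L2M.commute[of "g i" "x i"] by (simp add: \<delta>_def)
    then have "(vdist (L2 M) (g i) (g j))\<^sup>2 < (sqrt (2 * \<epsilon>))\<^sup>2"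
      by (intro power_strict_mono) auto
    then show False using dist_g[of i j] i j \<open>i \<noteq> j\<close> \<epsilon> by simp
  qed
  then show ?thesis
    by (rule inj_on_finite[OF _ _ K(1)]) (use x(1) in auto)
qed

section \<open>Expansions in an orthonormal system\<close>

locale orthonormal_expansion = dyadic_weights I \<mu> \<theta> r
  for I :: "nat set" and \<mu> :: "nat \<Rightarrow> real" and \<theta> :: real and r :: ereal +
  fixes M :: "'a measure" and e :: "nat \<Rightarrow> 'a \<Rightarrow> real"
  assumes sq_integrable_e: "i \<in> I \<Longrightarrow> sq_integrable M (e i)"
    and orthonormal: "\<lbrakk>i \<in> I; j \<in> I\<rbrakk> \<Longrightarrow> (\<integral>x. e i x * e j x \<partial>M) = (if i = j then 1 else 0)"
begin

definition summand :: "(nat \<Rightarrow> real) \<Rightarrow> 'a \<Rightarrow> nat \<Rightarrow> real" where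
  "summand b x i = (if i \<in> I then b i * e i x else 0)"

definition partial_sum :: "(nat \<Rightarrow> real) \<Rightarrow> nat \<Rightarrow> 'a \<Rightarrow> real" where
  "partial_sum b n x = (\<Sum>i<n. summand b x i)"

lemma sq_integrable_summand: "sq_integrable M (\<lambda>x. summand b x i)"
  unfolding summand_def using sq_integrable_scale[OF sq_integrable_e, of i "b i"] sq_integrable_zero
  by (cases "i \<in> I") auto

lemma sq_integrable_partial_sum: "sq_integrable M (partial_sum b n)"
  unfolding partial_sum_def[abs_def] by (intro sq_integrable_sum sq_integrable_summand)

lemma measurable_summand [measurable]: "(\<lambda>x. summand b x i) \<in> borel_measurable M"
  using sq_integrable_summand by (rule sq_integrable_measurable)

lemma measurable_partial_sum [measurable]: "partial_sum b n \<in> borel_measurable M"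
  using sq_integrable_partial_sum by (rule sq_integrable_measurable)

lemma vpartial_sum_L2:
  "vpartial_sum (L2 M) (\<lambda>i. if i \<in> I then vscale (L2 M) (b i) (ae_class M (e i)) else vzero (L2 M)) n
    = ae_class M (partial_sum b n)"
proof (induction n)
  case 0
  then show ?case by (simp add: partial_sum_def[abs_def])
next
  case (Suc n)
  have "(if n \<in> I then vscale (L2 M) (b n) (ae_class M (e n)) else vzero (L2 M))
      = ae_class M (\<lambda>x. summand b x n)"
    using sq_integrable_measurable[OF sq_integrable_e]
    by (simp add: summand_def class_scale_ae_class)
  then show ?case using Suc
    by (simp add: class_add_ae_class del: L2_simps(3)) (simp add: partial_sum_def[abs_def])
qed

definition L2_error :: "(nat \<Rightarrow> real) \<Rightarrow> ('a \<Rightarrow> real) \<Rightarrow> nat \<Rightarrow> real" where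
  "L2_error b f n = vnorm (L2 M) (ae_class M (\<lambda>x. partial_sum b n x - f x))"

lemma class_expansion_iff:
  assumes f: "sq_integrable M f"
  shows "class_expansion M I e b (ae_class M f) \<longleftrightarrow> L2_error b f \<longlonglongrightarrow> 0"
proof -
  have "vpartial_sum (L2 M) (\<lambda>i. if i \<in> I then vscale (L2 M) (b i) (ae_class M (e i)) else vzero (L2 M))
      = (\<lambda>n. ae_class M (partial_sum b n))"
    by (rule ext) (rule vpartial_sum_L2)
  moreover have "L2_error b f
      = (\<lambda>n. vnorm (L2 M) (vdiff (L2 M) (ae_class M (partial_sum b n)) (ae_class M f)))"
    unfolding L2_error_def[abs_def]
    by (simp only: L2_diff[OF measurable_partial_sum sq_integrable_measurable[OF f]])
  ultimately show ?thesis
    unfolding class_expansion_def vsums_def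
    using normed_vspace.limitin_iff[OF L2_normed, of "\<lambda>n. ae_class M (partial_sum b n)" M "ae_class M f"]
      ae_class_in_L2[OF f] ae_class_in_L2[OF sq_integrable_partial_sum] by simp
qed

lemma class_expansion_unique:
  assumes "class_expansion M I e b c" "class_expansion M I e b d"
  shows "c = d"
  by (rule Metric_space.limitin_metric_unique[OF normed_vspace.metric_space[OF L2_normed]
        assms[unfolded class_expansion_def vsums_def vtopology_def] sequentially_bot])

lemma class_expansion_cong:
  assumes "\<And>i. i \<in> I \<Longrightarrow> b i = b' i"
  shows "class_expansion M I e b = class_expansion M I e b'"
proof -
  have "(\<lambda>i. if i \<in> I then vscale (L2 M) (b i) (ae_class M (e i)) else vzero (L2 M))
    = (\<lambda>i. if i \<in> I then vscale (L2 M) (b' i) (ae_class M (e i)) else vzero (L2 M))"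
    by (rule ext) (simp add: assms)
  then show ?thesis unfolding class_expansion_def[abs_def] by simp
qed

lemma L2_error_nonneg: "sq_integrable M f \<Longrightarrow> 0 \<le> L2_error b f n"
  unfolding L2_error_def
  by (intro normed_vspace.norm_nonneg[OF L2_normed] ae_class_in_L2 sq_integrable_diff sq_integrable_partial_sum)

lemma class_expansion_add:
  assumes f: "sq_integrable M f" "class_expansion M I e b (ae_class M f)"
    and g: "sq_integrable M g" "class_expansion M I e b' (ae_class M g)"
  shows "class_expansion M I e (\<lambda>i. b i + b' i) (ae_class M (\<lambda>x. f x + g x))"
proof -
  have fg: "sq_integrable M (\<lambda>x. f x + g x)" using f(1) g(1) by (rule sq_integrable_add)
  have le: "L2_error (\<lambda>i. b i + b' i) (\<lambda>x. f x + g x) n \<le> L2_error b f n + L2_error b' g n" for n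
  proof -
    let ?u = "\<lambda>x. partial_sum b n x - f x" and ?v = "\<lambda>x. partial_sum b' n x - g x"
    have uv: "sq_integrable M ?u" "sq_integrable M ?v"
      using f(1) g(1) by (auto intro: sq_integrable_diff sq_integrable_partial_sum)
    have "partial_sum (\<lambda>i. b i + b' i) n x = partial_sum b n x + partial_sum b' n x" for x
      by (auto simp: partial_sum_def summand_def distrib_right simp flip: sum.distrib intro!: sum.cong)
    then have "ae_class M (\<lambda>x. partial_sum (\<lambda>i. b i + b' i) n x - (f x + g x))
      = vadd (L2 M) (ae_class M ?u) (ae_class M ?v)"
      using uv by (simp add: class_add_ae_class sq_integrable_measurable algebra_simps)
    then show ?thesis
      unfolding L2_error_def
      using normed_vspace.norm_triangle[OF L2_normed ae_class_in_L2[OF uv(1)] ae_class_in_L2[OF uv(2)]]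
      by simp
  qed
  have "(\<lambda>n. L2_error b f n + L2_error b' g n) \<longlonglongrightarrow> 0"
    using tendsto_add[of "L2_error b f" 0 sequentially "L2_error b' g" 0] f g
    by (simp add: class_expansion_iff)
  then have "L2_error (\<lambda>i. b i + b' i) (\<lambda>x. f x + g x) \<longlonglongrightarrow> 0"
    by (rule Lim_null_comparison[rotated]) (use le L2_error_nonneg[OF fg] in simp)
  then show ?thesis using class_expansion_iff[OF fg] by simp
qed

lemma class_expansion_scale:
  assumes f: "sq_integrable M f" "class_expansion M I e b (ae_class M f)"
  shows "class_expansion M I e (\<lambda>i. a * b i) (ae_class M (\<lambda>x. a * f x))"
proof -
  have af: "sq_integrable M (\<lambda>x. a * f x)" using f(1) by (rule sq_integrable_scale)
  have "L2_error (\<lambda>i. a * b i) (\<lambda>x. a * f x) n = \<bar>a\<bar> * L2_error b f n" for n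
  proof -
    let ?u = "\<lambda>x. partial_sum b n x - f x"
    have u: "sq_integrable M ?u"
      using f(1) by (auto intro: sq_integrable_diff sq_integrable_partial_sum)
    have "partial_sum (\<lambda>i. a * b i) n x = a * partial_sum b n x" for x
      by (auto simp: partial_sum_def summand_def sum_distrib_left intro!: sum.cong)
    then have "ae_class M (\<lambda>x. partial_sum (\<lambda>i. a * b i) n x - a * f x)
      = vscale (L2 M) a (ae_class M ?u)"
      using u by (simp add: class_scale_ae_class sq_integrable_measurable algebra_simps)
    then show ?thesis
      unfolding L2_error_def using normed_vspace.norm_scale[OF L2_normed ae_class_in_L2[OF u]] by simp
  qed
  then have "L2_error (\<lambda>i. a * b i) (\<lambda>x. a * f x) = (\<lambda>n. \<bar>a\<bar> * L2_error b f n)" by auto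
  moreover have "(\<lambda>n. \<bar>a\<bar> * L2_error b f n) \<longlonglongrightarrow> 0"
    using f by (intro tendsto_mult_right_zero) (simp add: class_expansion_iff)
  ultimately show ?thesis using class_expansion_iff[OF af] by simp
qed

lemma integral_partial_sum_mult:
  assumes i: "i \<in> I" and n: "i < n"
  shows "(\<integral>x. partial_sum b n x * e i x \<partial>M) = b i"
proof -
  have "(\<integral>x. partial_sum b n x * e i x \<partial>M) = (\<integral>x. (\<Sum>k<n. summand b x k * e i x) \<partial>M)"
    by (simp add: partial_sum_def sum_distrib_right)
  also have "\<dots> = (\<Sum>k<n. \<integral>x. summand b x k * e i x \<partial>M)"
    by (intro Bochner_Integration.integral_sum sq_integrable_mult sq_integrable_summand sq_integrable_e i)
  also have "\<dots> = (\<Sum>k<n. if k = i then b i else 0)"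
  proof (rule sum.cong[OF refl])
    fix k
    show "(\<integral>x. summand b x k * e i x \<partial>M) = (if k = i then b i else 0)"
      using i orthonormal[of k i] by (cases "k \<in> I") (auto simp: summand_def mult.assoc)
  qed
  also have "\<dots> = b i" using n by simp
  finally show ?thesis .
qed

text \<open>The partial sums beyond \<open>i\<close> have inner product \<open>b i\<close> with \<open>e i\<close>, and the inner product is
  continuous by the Cauchy--Schwarz inequality.\<close>

lemma class_expansion_coefficient:
  assumes f: "sq_integrable M f" "class_expansion M I e b (ae_class M f)" and i: "i \<in> I"
  shows "b i = (\<integral>x. f x * e i x \<partial>M)"
proof -
  interpret L2: ip_vspace "L2 M" by (rule L2_ip_vspace)
  note e = sq_integrable_e[OF i]
  have diff: "\<bar>b i - (\<integral>x. f x * e i x \<partial>M)\<bar> \<le> L2_error b f n" if n: "i < n" for n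
  proof -
    let ?u = "\<lambda>x. partial_sum b n x - f x"
    have u: "sq_integrable M ?u"
      using f(1) by (auto intro: sq_integrable_diff sq_integrable_partial_sum)
    have "b i - (\<integral>x. f x * e i x \<partial>M) = (\<integral>x. partial_sum b n x * e i x - f x * e i x \<partial>M)"
      using integral_partial_sum_mult[OF i n] f(1) e
      by (subst Bochner_Integration.integral_diff)
        (auto intro: sq_integrable_mult sq_integrable_partial_sum)
    also have "\<dots> = vinner (L2 M) (ae_class M ?u) (ae_class M (e i))"
      using L2_inner[OF u e] by (simp add: left_diff_distrib)
    finally have "\<bar>b i - (\<integral>x. f x * e i x \<partial>M)\<bar> \<le> L2_error b f n * vnorm (L2 M) (ae_class M (e i))"
      unfolding L2_error_def using L2.cauchy_schwarz[OF ae_class_in_L2[OF u] ae_class_in_L2[OF e]] by simp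
    moreover have "vnorm (L2 M) (ae_class M (e i)) = 1"
      using orthonormal[OF i i] by (simp add: L2_norm[OF e] power2_eq_square)
    ultimately show ?thesis by simp
  qed
  have "\<bar>b i - (\<integral>x. f x * e i x \<partial>M)\<bar> \<le> 0"
  proof (rule LIMSEQ_le_const)
    show "L2_error b f \<longlonglongrightarrow> 0" using f by (simp add: class_expansion_iff)
    show "\<exists>N. \<forall>n\<ge>N. \<bar>b i - (\<integral>x. f x * e i x \<partial>M)\<bar> \<le> L2_error b f n"
      using diff by (intro exI[of _ "Suc i"]) auto
  qed
  then show ?thesis by simp
qed

lemma class_expansion_coefficients_unique:
  assumes "c \<in> vcarrier (L2 M)" "class_expansion M I e b c" "class_expansion M I e b' c" "i \<in> I"
  shows "b i = b' i"
proof -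
  obtain f where "sq_integrable M f" "c = ae_class M f" using assms(1) by (auto simp: L2_carrier)
  then show ?thesis
    using class_expansion_coefficient[of f b i] class_expansion_coefficient[of f b' i] assms(2-4) by simp
qed

lemma integral_partial_sum_diff_sq:
  assumes nm: "n \<le> m"
  shows "(\<integral>x. (partial_sum b m x - partial_sum b n x)\<^sup>2 \<partial>M) = (\<Sum>i\<in>{n..<m}. if i \<in> I then (b i)\<^sup>2 else 0)"
proof -
  have diff: "partial_sum b m x - partial_sum b n x = (\<Sum>i\<in>{n..<m}. summand b x i)" for x
    using sum_diff_nat_ivl[of 0 n m "summand b x"] nm by (simp add: partial_sum_def atLeast0LessThan)
  have "(\<integral>x. (partial_sum b m x - partial_sum b n x)\<^sup>2 \<partial>M)
      = (\<integral>x. (\<Sum>i\<in>{n..<m}. \<Sum>k\<in>{n..<m}. summand b x i * summand b x k) \<partial>M)"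
    unfolding diff power2_eq_square sum_product ..
  also have "\<dots> = (\<Sum>i\<in>{n..<m}. \<Sum>k\<in>{n..<m}. \<integral>x. summand b x i * summand b x k \<partial>M)"
    by (simp add: Bochner_Integration.integral_sum sq_integrable_mult sq_integrable_summand)
  also have "\<dots> = (\<Sum>i\<in>{n..<m}. \<Sum>k\<in>{n..<m}. if k = i then (if i \<in> I then (b i)\<^sup>2 else 0) else 0)"
  proof (intro sum.cong refl)
    fix i k
    have "(\<integral>x. summand b x i * summand b x k \<partial>M) = b i * (b k * (\<integral>x. e i x * e k x \<partial>M))"
      if "i \<in> I" "k \<in> I"
    proof -
      have "(\<integral>x. summand b x i * summand b x k \<partial>M) = (\<integral>x. b i * (b k * (e i x * e k x)) \<partial>M)"
        using that by (simp add: summand_def mult_ac)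
      then show ?thesis by simp
    qed
    then show "(\<integral>x. summand b x i * summand b x k \<partial>M)
        = (if k = i then (if i \<in> I then (b i)\<^sup>2 else 0) else 0)"
      using orthonormal[of i k]
      by (cases "i \<in> I"; cases "k \<in> I") (auto simp: summand_def power2_eq_square)
  qed
  also have "\<dots> = (\<Sum>i\<in>{n..<m}. if i \<in> I then (b i)\<^sup>2 else 0)" by (simp add: sum.delta)
  finally show ?thesis .
qed

text \<open>By Fatou's lemma, the distance of a partial sum to the pointwise sum is at most the limit
  inferior of its distances to the later partial sums. By orthonormality this is the square root of
  a tail of the convergent series of the \<open>(b i)\<^sup>2\<close>.\<close>

lemma pointwise_sum_class_expansion:
  assumes b: "b \<in> seq_space I \<mu> \<theta> r" and f: "f \<in> borel_measurable M"
    and sums: "AE x in M. summand b x sums f x"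
  shows "sq_integrable M f" and "class_expansion M I e b (ae_class M f)"
proof -
  define a where "a i = (if i \<in> I then (b i)\<^sup>2 else 0)" for i
  have a: "summable a" "0 \<le> a i" for i
    using norm_le_summable_square[OF norm_le_seq_norm[OF b]] by (simp_all add: a_def[abs_def])
  define tail where "tail n = suminf a - sum a {..<n}" for n
  have tail_nonneg: "0 \<le> tail n" for n using sum_le_suminf[OF a(1), of "{..<n}"] a(2) by (simp add: tail_def)
  have tail: "tail \<longlonglongrightarrow> 0"
    using tendsto_diff[OF tendsto_const summable_LIMSEQ[OF a(1)], of "suminf a"] by (simp add: tail_def[abs_def])
  note [measurable] = f
  have nn: "(\<integral>\<^sup>+x. ennreal ((partial_sum b n x - f x)\<^sup>2) \<partial>M) \<le> ennreal (tail n)" for n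
  proof -
    let ?u = "\<lambda>m x. ennreal ((partial_sum b n x - partial_sum b m x)\<^sup>2)"
    have "(\<integral>\<^sup>+x. ennreal ((partial_sum b n x - f x)\<^sup>2) \<partial>M) = (\<integral>\<^sup>+x. liminf (\<lambda>m. ?u m x) \<partial>M)"
    proof (rule nn_integral_cong_AE)
      show "AE x in M. ennreal ((partial_sum b n x - f x)\<^sup>2) = liminf (\<lambda>m. ?u m x)"
        using sums
      proof eventually_elim
        case (elim x)
        then have "(\<lambda>m. partial_sum b m x) \<longlonglongrightarrow> f x" by (simp add: sums_def partial_sum_def)
        then have "(\<lambda>m. ?u m x) \<longlonglongrightarrow> ennreal ((partial_sum b n x - f x)\<^sup>2)"
          by (intro tendsto_ennrealI tendsto_intros)
        then show ?case by (rule lim_imp_Liminf[symmetric, rotated]) simp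
      qed
    qed
    also have "\<dots> \<le> liminf (\<lambda>m. \<integral>\<^sup>+x. ?u m x \<partial>M)"
      by (rule nn_integral_liminf) measurable
    also have "\<dots> \<le> ennreal (tail n)"
    proof (rule Liminf_le)
      show "\<forall>\<^sub>F m in sequentially. (\<integral>\<^sup>+x. ?u m x \<partial>M) \<le> ennreal (tail n)"
        using eventually_ge_at_top[of n]
      proof eventually_elim
        case (elim m)
        have "integrable M (\<lambda>x. (partial_sum b n x - partial_sum b m x)\<^sup>2)"
          using sq_integrable_diff[OF sq_integrable_partial_sum sq_integrable_partial_sum]
          by (simp add: sq_integrable_def)
        then have "(\<integral>\<^sup>+x. ?u m x \<partial>M) = ennreal (\<integral>x. (partial_sum b m x - partial_sum b n x)\<^sup>2 \<partial>M)"
          by (subst nn_integral_eq_integral) (auto simp: power2_commute)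
        also have "(\<integral>x. (partial_sum b m x - partial_sum b n x)\<^sup>2 \<partial>M) = sum a {n..<m}"
          unfolding a_def by (rule integral_partial_sum_diff_sq[OF elim])
        also have "sum a {n..<m} = sum a {..<m} - sum a {..<n}"
          using sum_diff_nat_ivl[of 0 n m a] elim by (simp add: atLeast0LessThan)
        also have "\<dots> \<le> tail n" using sum_le_suminf[OF a(1), of "{..<m}"] a(2) by (simp add: tail_def)
        finally show ?case by (simp add: ennreal_leI)
      qed
    qed simp
    finally show ?thesis .
  qed
  have int: "integrable M (\<lambda>x. (partial_sum b n x - f x)\<^sup>2)" for n
  proof (rule integrableI_bounded)
    show "(\<integral>\<^sup>+x. ennreal (norm ((partial_sum b n x - f x)\<^sup>2)) \<partial>M) < \<infinity>"
      using nn[of n] by (simp add: order_le_less_trans)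
  qed measurable
  have "sq_integrable M (\<lambda>x. partial_sum b 0 x - f x)" using int[of 0] by (simp add: sq_integrable_def)
  then have "sq_integrable M (\<lambda>x. (-1) * (partial_sum b 0 x - f x))" by (rule sq_integrable_scale)
  then show sq: "sq_integrable M f" by (simp add: partial_sum_def)
  have le: "L2_error b f n \<le> sqrt (tail n)" for n
  proof -
    have "ennreal (\<integral>x. (partial_sum b n x - f x)\<^sup>2 \<partial>M) \<le> ennreal (tail n)"
      using nn[of n] by (subst (asm) nn_integral_eq_integral[OF int]) auto
    then have "(\<integral>x. (partial_sum b n x - f x)\<^sup>2 \<partial>M) \<le> tail n"
      using tail_nonneg by (simp add: ennreal_le_iff)
    then show ?thesis
      unfolding L2_error_def
      using sq_integrable_diff[OF sq_integrable_partial_sum sq, of b n] by (simp add: L2_norm)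
  qed
  have "(\<lambda>n. sqrt (tail n)) \<longlonglongrightarrow> 0" using tendsto_real_sqrt[OF tail] by simp
  then have "L2_error b f \<longlonglongrightarrow> 0"
    by (rule Lim_null_comparison[rotated]) (use le L2_error_nonneg[OF sq] in simp)
  then show "class_expansion M I e b (ae_class M f)" using class_expansion_iff[OF sq] by simp
qed

section \<open>The power space\<close>

abbreviation "P \<equiv> power_space M I \<mu> e \<theta> r"

lemma power_space_simps:
  "vcarrier P = {c \<in> vcarrier (L2 M). \<exists>b\<in>seq_space I \<mu> \<theta> r. class_expansion M I e b c}"
  "vzero P = ae_class M (\<lambda>x. 0)" "vadd P = class_add M" "vscale P = class_scale M"
  by (simp_all add: power_space_def)

lemma power_space_norm:
  assumes c: "c \<in> vcarrier (L2 M)" and b: "b \<in> seq_space I \<mu> \<theta> r" "class_expansion M I e b c"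
  shows "vnorm P c = seq_norm I \<mu> \<theta> r b"
proof -
  have eq: "seq_norm I \<mu> \<theta> r b' = seq_norm I \<mu> \<theta> r b" if "class_expansion M I e b' c" for b'
    using block_norm_cong[OF class_expansion_coefficients_unique[OF c that b(2)]]
    by (simp add: seq_norm_def)
  have "(THE s. \<exists>b\<in>seq_space I \<mu> \<theta> r. class_expansion M I e b c \<and> s = seq_norm I \<mu> \<theta> r b)
      = seq_norm I \<mu> \<theta> r b"
  proof (rule the_equality)
    fix s assume "\<exists>b\<in>seq_space I \<mu> \<theta> r. class_expansion M I e b c \<and> s = seq_norm I \<mu> \<theta> r b"
    then show "s = seq_norm I \<mu> \<theta> r b" using eq by blast
  qed (use b in blast)
  then show ?thesis by (simp add: power_space_def)
qed

lemma power_space_coefficients: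
  assumes "c \<in> vcarrier P"
  obtains b where "c \<in> vcarrier (L2 M)" "b \<in> vcarrier (coef_space I \<mu> \<theta> r)" "class_expansion M I e b c"
proof -
  obtain b where c: "c \<in> vcarrier (L2 M)" and b: "b \<in> seq_space I \<mu> \<theta> r" "class_expansion M I e b c"
    using assms by (auto simp: power_space_simps)
  define b' where "b' i = (if i \<in> I then b i else 0)" for i
  have "class_expansion M I e b' c" using b(2) class_expansion_cong[of b b'] by (simp add: b'_def)
  moreover have "b' \<in> vcarrier (coef_space I \<mu> \<theta> r)"
    using b(1) block_norm_cong[of I b b'] by (simp add: seq_space_def b'_def)
  ultimately show thesis using c that by blast
qed

text \<open>The power space is isometric to the space of those coefficient sequences whose expansion
  converges in \<^term>\<open>L2 M\<close>. That every sequence of finite norm is of this kind follows from the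
  pointwise sums, whose construction uses the norm axioms established here.\<close>

lemma power_space_normed: "normed_vspace P"
proof -
  interpret Q: normed_vspace "coef_space I \<mu> \<theta> r" by (rule coef_space_normed)
  define D where "D = {b \<in> vcarrier (coef_space I \<mu> \<theta> r). \<exists>c\<in>vcarrier (L2 M). class_expansion M I e b c}"
  define S where "S b = (SOME c. c \<in> vcarrier (L2 M) \<and> class_expansion M I e b c)" for b
  have S: "S b \<in> vcarrier (L2 M)" "class_expansion M I e b (S b)" if "b \<in> D" for b
  proof -
    have "\<exists>c. c \<in> vcarrier (L2 M) \<and> class_expansion M I e b c" using that unfolding D_def by blast
    from someI_ex[OF this] show "S b \<in> vcarrier (L2 M)" "class_expansion M I e b (S b)"
      by (simp_all add: S_def)
  qed
  have S_eq: "S b = c" if "b \<in> D" "class_expansion M I e b c" for b c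
    using class_expansion_unique[OF S(2)[OF that(1)] that(2)] .
  have Drep: "\<exists>f. sq_integrable M f \<and> class_expansion M I e b (ae_class M f) \<and> S b = ae_class M f"
    if b: "b \<in> D" for b
  proof -
    obtain f where f: "sq_integrable M f" "S b = ae_class M f" using S(1)[OF b] by (auto simp: L2_carrier)
    then show ?thesis using S(2)[OF b] by auto
  qed
  have zero: "(\<lambda>i. 0) \<in> D" "S (\<lambda>i. 0) = vzero P"
  proof -
    have "partial_sum (\<lambda>i. 0) n x = 0" for n x
      by (auto simp: partial_sum_def summand_def intro!: sum.neutral)
    then have "L2_error (\<lambda>i. 0) (\<lambda>x. 0) = (\<lambda>n. 0)"
      by (simp add: L2_error_def[abs_def] L2_norm sq_integrable_zero)
    then have "class_expansion M I e (\<lambda>i. 0) (ae_class M (\<lambda>x. 0))"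
      by (simp add: class_expansion_iff sq_integrable_zero)
    then show "(\<lambda>i. 0) \<in> D"
      using ae_class_in_L2[OF sq_integrable_zero] Q.zero_closed by (auto simp: D_def)
    then show "S (\<lambda>i. 0) = vzero P"
      using \<open>class_expansion M I e (\<lambda>i. 0) (ae_class M (\<lambda>x. 0))\<close> by (simp add: S_eq power_space_simps)
  qed
  have add: "(\<lambda>i. b i + b' i) \<in> D \<and> S (\<lambda>i. b i + b' i) = vadd P (S b) (S b')"
    if b: "b \<in> D" and b': "b' \<in> D" for b b'
  proof -
    obtain f g where f: "sq_integrable M f" "class_expansion M I e b (ae_class M f)" "S b = ae_class M f"
      and g: "sq_integrable M g" "class_expansion M I e b' (ae_class M g)" "S b' = ae_class M g"
      using Drep b b' by metis
    note fg = class_expansion_add[OF f(1,2) g(1,2)]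
    have D: "(\<lambda>i. b i + b' i) \<in> D"
      using b b' fg ae_class_in_L2[OF sq_integrable_add[OF f(1) g(1)]] add_in_seq_space
      by (auto simp: D_def)
    then show ?thesis
      using S_eq[OF D fg] f g by (simp add: power_space_simps class_add_ae_class sq_integrable_measurable)
  qed
  have scale: "(\<lambda>i. a * b i) \<in> D \<and> S (\<lambda>i. a * b i) = vscale P a (S b)" if b: "b \<in> D" for a b
  proof -
    obtain f where f: "sq_integrable M f" "class_expansion M I e b (ae_class M f)" "S b = ae_class M f"
      using Drep b by metis
    note af = class_expansion_scale[OF f(1,2), of a]
    have D: "(\<lambda>i. a * b i) \<in> D"
      using b af ae_class_in_L2[OF sq_integrable_scale[OF f(1), of a]] scale_in_seq_space
      by (auto simp: D_def)
    then show ?thesis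
      using S_eq[OF D af] f by (simp add: power_space_simps class_scale_ae_class sq_integrable_measurable)
  qed
  have inj: "inj_on S D"
  proof (rule inj_onI)
    fix b b' assume b: "b \<in> D" "b' \<in> D" and eq: "S b = S b'"
    have "b i = b' i" for i
    proof (cases "i \<in> I")
      case True
      then show ?thesis
        using class_expansion_coefficients_unique[OF S(1)[OF b(1)] S(2)[OF b(1)], of b'] S(2)[OF b(2)] eq
        by simp
    qed (use b in \<open>simp add: D_def\<close>)
    then show "b = b'" by auto
  qed
  have image: "S ` D = vcarrier P"
  proof
    show "S ` D \<subseteq> vcarrier P" using S by (auto simp: power_space_simps D_def)
    show "vcarrier P \<subseteq> S ` D"
    proof
      fix c assume "c \<in> vcarrier P"
      then obtain b where b: "c \<in> vcarrier (L2 M)" "b \<in> vcarrier (coef_space I \<mu> \<theta> r)"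
          "class_expansion M I e b c"
        by (rule power_space_coefficients)
      then have "b \<in> D" unfolding D_def by blast
      then show "c \<in> S ` D" using S_eq b(3) by blast
    qed
  qed
  have norm: "vnorm P (S b) = seq_norm I \<mu> \<theta> r b" if "b \<in> D" for b
    using power_space_norm[OF S(1)[OF that] _ S(2)[OF that]] that by (simp add: D_def)
  show ?thesis
  proof (rule isometric_iso_normed)
    show "normed_vspace (coef_space I \<mu> \<theta> r\<lparr>vcarrier := D\<rparr>)"
      using zero add scale by (intro Q.subspace_normed) (auto simp: D_def)
    show "isometric_iso (coef_space I \<mu> \<theta> r\<lparr>vcarrier := D\<rparr>) P S"
      using inj image norm add scale by (auto simp: isometric_iso_def vlinear_def bij_betw_def)
    show "S (vzero (coef_space I \<mu> \<theta> r\<lparr>vcarrier := D\<rparr>)) = vzero P"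
      using zero by simp
  qed
qed

end

section \<open>Pointwise sums of expansions\<close>

lemma floor_fraction_tendsto:
  fixes y :: real
  shows "(\<lambda>m. real_of_int \<lfloor>real (Suc m) * y\<rfloor> / real (Suc m)) \<longlonglongrightarrow> y"
proof (rule tendsto_sandwich)
  have upper: "real_of_int \<lfloor>real (Suc m) * y\<rfloor> / real (Suc m) \<le> y" for m
    using of_int_floor_le[of "real (Suc m) * y"] by (simp add: pos_divide_le_eq mult.commute)
  have lower: "y - inverse (real (Suc m)) \<le> real_of_int \<lfloor>real (Suc m) * y\<rfloor> / real (Suc m)" for m
  proof -
    have "real (Suc m) * y - 1 \<le> real_of_int \<lfloor>real (Suc m) * y\<rfloor>" by linarith
    then have "(real (Suc m) * y - 1) / real (Suc m) \<le> real_of_int \<lfloor>real (Suc m) * y\<rfloor> / real (Suc m)"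
      by (intro divide_right_mono) auto
    moreover have "(real (Suc m) * y - 1) / real (Suc m) = y - inverse (real (Suc m))"
      by (simp add: diff_divide_distrib inverse_eq_divide)
    ultimately show ?thesis by simp
  qed
  show "\<forall>\<^sub>F m in sequentially. y - inverse (real (Suc m)) \<le> real_of_int \<lfloor>real (Suc m) * y\<rfloor> / real (Suc m)"
    using lower by (rule always_eventually[OF allI])
  show "\<forall>\<^sub>F m in sequentially. real_of_int \<lfloor>real (Suc m) * y\<rfloor> / real (Suc m) \<le> y"
    using upper by (rule always_eventually[OF allI])
  show "(\<lambda>m. y - inverse (real (Suc m))) \<longlonglongrightarrow> y"
    using tendsto_diff[OF tendsto_const LIMSEQ_inverse_real_of_nat, of y] by simp
qed simp

locale embedded_expansion = orthonormal_expansion I \<mu> \<theta> r M e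
  for I :: "nat set" and \<mu> :: "nat \<Rightarrow> real" and \<theta> :: real and r :: ereal
    and M :: "'a measure" and e :: "nat \<Rightarrow> 'a \<Rightarrow> real" +
  assumes embeds: "embeds P (L_infinity M)"
begin

lemma power_space_L_infinity_inclusion: "normed_inclusion P (L_infinity M)"
  using embeds
  by (intro normed_inclusion.intro normed_inclusion_axioms.intro power_space_normed L_infinity_normed)
    (auto simp: embeds_def power_space_simps(3,4))

abbreviation "K \<equiv> embedding_norm P (L_infinity M)"

lemma K_nonneg: "0 \<le> K"
  by (rule normed_inclusion.embedding_norm_nonneg[OF power_space_L_infinity_inclusion embeds])

text \<open>A finite sum is its own expansion, so the embedding bounds its essential supremum.\<close>

lemma partial_sum_AE_bound:
  assumes b: "b \<in> seq_space I \<mu> \<theta> r" and support: "\<And>i. n \<le> i \<Longrightarrow> b i = 0"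
  shows "AE x in M. \<bar>partial_sum b n x\<bar> \<le> K * seq_norm I \<mu> \<theta> r b"
proof -
  let ?f = "partial_sum b n"
  have "L2_error b ?f m = 0" if "n \<le> m" for m
  proof -
    have "(\<Sum>i<n. summand b x i) = (\<Sum>i<m. summand b x i)" for x
      using that support by (intro sum.mono_neutral_left) (auto simp: summand_def)
    then have "(\<lambda>x. partial_sum b m x - ?f x) = (\<lambda>x. 0)" by (simp add: partial_sum_def)
    then show ?thesis by (simp add: L2_error_def L2_norm sq_integrable_zero)
  qed
  then have "\<forall>\<^sub>F m in sequentially. L2_error b ?f m = 0" by (rule eventually_sequentiallyI)
  then have "L2_error b ?f \<longlonglongrightarrow> 0" by (rule tendsto_eventually)
  then have ex: "class_expansion M I e b (ae_class M ?f)"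
    using class_expansion_iff[OF sq_integrable_partial_sum] by simp
  note L2 = ae_class_in_L2[OF sq_integrable_partial_sum, of b n]
  have P: "ae_class M ?f \<in> vcarrier P" using L2 ex b by (auto simp: power_space_simps(1))
  then have "ae_class M ?f \<in> vcarrier (L_infinity M)" using embeds by (auto simp: embeds_def)
  then obtain g C where g: "AE x in M. \<bar>g x\<bar> \<le> C" "ae_class M ?f = ae_class M g"
    by (auto simp: L_infinity_carrier)
  then have "AE x in M. ?f x = g x" by (simp add: ae_class_eq_iff[OF measurable_partial_sum])
  with g(1) have "AE x in M. \<bar>?f x\<bar> \<le> C" by eventually_elim simp
  then have "AE x in M. \<bar>?f x\<bar> \<le> vnorm (L_infinity M) (ae_class M ?f)"
    by (rule AE_le_L_infinity_norm[OF measurable_partial_sum])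
  moreover have "vnorm (L_infinity M) (ae_class M ?f) \<le> K * seq_norm I \<mu> \<theta> r b"
    using normed_inclusion.norm_le_embedding_norm_mult[OF power_space_L_infinity_inclusion embeds P]
    by (simp add: power_space_norm[OF L2 b ex])
  ultimately show ?thesis by (auto elim: eventually_mono)
qed

text \<open>The finitely supported rational coefficient sequences, indexed by the countable type of
  rational lists: the exceptional null sets of countably many sequences can be united.\<close>

definition rational_coefs :: "rat list \<Rightarrow> nat \<Rightarrow> real" where
  "rational_coefs l i = (if i \<in> I \<and> i < length l then of_rat (l ! i) else 0)"

lemma exists_exceptional_set:
  "\<exists>N. N \<in> null_sets M \<and> (\<forall>x\<in>space M - N. \<forall>l. \<bar>partial_sum (rational_coefs l) (length l) x\<bar>
     \<le> K * seq_norm I \<mu> \<theta> r (rational_coefs l))"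
proof -
  have "AE x in M. \<bar>partial_sum (rational_coefs l) (length l) x\<bar>
     \<le> K * seq_norm I \<mu> \<theta> r (rational_coefs l)" for l
  proof (rule partial_sum_AE_bound)
    have "{i \<in> I. rational_coefs l i \<noteq> 0} \<subseteq> {..<length l}" by (auto simp: rational_coefs_def)
    then show "rational_coefs l \<in> seq_space I \<mu> \<theta> r"
      by (intro finite_support_in_seq_space) (rule finite_subset, auto)
  qed (simp add: rational_coefs_def)
  then have "AE x in M. \<forall>l. \<bar>partial_sum (rational_coefs l) (length l) x\<bar>
     \<le> K * seq_norm I \<mu> \<theta> r (rational_coefs l)"
    by (simp add: AE_all_countable)
  then show ?thesis by (elim AE_E3) blast
qed

definition exceptional_set :: "'a set" where
  "exceptional_set = (SOME N. N \<in> null_sets M \<and> (\<forall>x\<in>space M - N. \<forall>l.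
     \<bar>partial_sum (rational_coefs l) (length l) x\<bar> \<le> K * seq_norm I \<mu> \<theta> r (rational_coefs l)))"

lemma exceptional_set:
  shows exceptional_set_null: "exceptional_set \<in> null_sets M"
    and rational_bound: "\<And>x l. x \<in> space M - exceptional_set \<Longrightarrow>
      \<bar>partial_sum (rational_coefs l) (length l) x\<bar> \<le> K * seq_norm I \<mu> \<theta> r (rational_coefs l)"
  using someI_ex[OF exists_exceptional_set, folded exceptional_set_def] by blast+

text \<open>Off the exceptional set the bound for rational finite sequences improves to a bound for the
  sums of absolute values of arbitrary sequences. The norm does not change if the signs of the
  coefficients are chosen to match the signs of the \<open>e i x\<close>, and it does not increase if their
  absolute values are rounded down to multiples of \<open>1 / (m + 1)\<close>; then \<open>m\<close> tends to infinity.\<close>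

lemma sum_abs_summand_le:
  assumes x: "x \<in> space M - exceptional_set" and b: "b \<in> seq_space I \<mu> \<theta> r"
  shows "(\<Sum>i<n. \<bar>summand b x i\<bar>) \<le> K * seq_norm I \<mu> \<theta> r b"
proof -
  \<comment> \<open>\<open>s\<close> is the sign of \<open>e i x\<close>, and \<open>q m\<close> lists the rounded coefficients with these signs.\<close>
  define s :: "nat \<Rightarrow> rat" where "s i = (if 0 \<le> e i x then 1 else -1)" for i
  define q where "q m = map (\<lambda>i. s i * (of_int \<lfloor>real (Suc m) * \<bar>b i\<bar>\<rfloor> / of_nat (Suc m))) [0..<n]" for m
  have coef: "rational_coefs (q m) i
      = of_rat (s i) * (real_of_int \<lfloor>real (Suc m) * \<bar>b i\<bar>\<rfloor> / real (Suc m))"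
    if "i \<in> I" "i < n" for m i
    using that by (simp add: rational_coefs_def q_def of_rat_mult of_rat_divide del: of_nat_Suc)
  have floor_le: "\<bar>real_of_int \<lfloor>real (Suc m) * \<bar>b i\<bar>\<rfloor> / real (Suc m)\<bar> \<le> \<bar>b i\<bar>" for m i
  proof -
    have "0 \<le> \<lfloor>real (Suc m) * \<bar>b i\<bar>\<rfloor>" by simp
    then show ?thesis using of_int_floor_le[of "real (Suc m) * \<bar>b i\<bar>"]
      by (simp add: pos_divide_le_eq mult.commute del: of_nat_Suc)
  qed
  have le: "\<bar>rational_coefs (q m) i\<bar> \<le> \<bar>b i\<bar>" if "i \<in> I" for m i
  proof (cases "i < n")
    case True
    then show ?thesis using floor_le[of m i] by (simp add: coef[OF that True] abs_mult s_def del: of_nat_Suc)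
  next
    case False
    then show ?thesis by (simp add: rational_coefs_def q_def)
  qed
  define t where "t m i = (if i \<in> I then (real_of_int \<lfloor>real (Suc m) * \<bar>b i\<bar>\<rfloor> / real (Suc m)) * \<bar>e i x\<bar> else 0)" for m i
  have bound: "(\<Sum>i<n. t m i) \<le> K * seq_norm I \<mu> \<theta> r b" for m
  proof -
    have "norm_le (rational_coefs (q m)) (seq_norm I \<mu> \<theta> r b)"
      using norm_le_seq_norm[OF b] le by (rule norm_le_mono)
    then have norm: "seq_norm I \<mu> \<theta> r (rational_coefs (q m)) \<le> seq_norm I \<mu> \<theta> r b"
      by (simp add: norm_le_iff)
    have "t m i = summand (rational_coefs (q m)) x i" if "i < n" for i
      using that coef[of i m] by (simp add: t_def summand_def s_def abs_if del: of_nat_Suc)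
    then have "(\<Sum>i<n. t m i) = partial_sum (rational_coefs (q m)) n x" by (simp add: partial_sum_def)
    also have "\<dots> \<le> K * seq_norm I \<mu> \<theta> r (rational_coefs (q m))"
      using rational_bound[OF x, of "q m"] by (simp add: q_def)
    also have "\<dots> \<le> K * seq_norm I \<mu> \<theta> r b" using norm K_nonneg by (rule mult_left_mono)
    finally show ?thesis .
  qed
  have "(\<lambda>m. t m i) \<longlonglongrightarrow> \<bar>summand b x i\<bar>" for i
  proof (cases "i \<in> I")
    case True
    then show ?thesis
      using tendsto_mult_right[OF floor_fraction_tendsto[of "\<bar>b i\<bar>"], of "\<bar>e i x\<bar>"]
      by (simp add: t_def summand_def abs_mult del: of_nat_Suc)
  qed (simp add: t_def summand_def)
  then have "(\<lambda>m. \<Sum>i<n. t m i) \<longlonglongrightarrow> (\<Sum>i<n. \<bar>summand b x i\<bar>)" by (intro tendsto_sum)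
  then show ?thesis by (rule LIMSEQ_le_const2) (use bound in blast)
qed

lemma summable_abs_summand:
  assumes "x \<in> space M - exceptional_set" "b \<in> seq_space I \<mu> \<theta> r"
  shows "summable (\<lambda>i. \<bar>summand b x i\<bar>)"
  by (rule summableI_nonneg_bounded[of _ "K * seq_norm I \<mu> \<theta> r b"])
    (auto simp: sum_abs_summand_le[OF assms])

lemma summable_summand:
  assumes "x \<in> space M - exceptional_set" "b \<in> seq_space I \<mu> \<theta> r"
  shows "summable (summand b x)"
  using summable_abs_summand[OF assms] by (rule summable_rabs_cancel)

definition pointwise_sum :: "(nat \<Rightarrow> real) \<Rightarrow> 'a \<Rightarrow> real" where
  "pointwise_sum b = (\<lambda>x\<in>space M. if x \<in> exceptional_set then 0 else suminf (summand b x))"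

lemma pointwise_sum_sums:
  assumes "x \<in> space M - exceptional_set" "b \<in> seq_space I \<mu> \<theta> r"
  shows "summand b x sums pointwise_sum b x"
  using assms summable_sums[OF summable_summand[OF assms]] by (simp add: pointwise_sum_def)

lemma pointwise_sum_bound:
  assumes x: "x \<in> space M" and b: "b \<in> seq_space I \<mu> \<theta> r"
  shows "\<bar>pointwise_sum b x\<bar> \<le> K * seq_norm I \<mu> \<theta> r b"
proof (cases "x \<in> exceptional_set")
  case True
  then show ?thesis using x K_nonneg seq_norm_nonneg[OF b] by (simp add: pointwise_sum_def)
next
  case False
  then have x': "x \<in> space M - exceptional_set" using x by simp
  have "\<bar>suminf (summand b x)\<bar> \<le> (\<Sum>i. \<bar>summand b x i\<bar>)"
    by (rule summable_rabs[OF summable_abs_summand[OF x' b]])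
  also have "\<dots> \<le> K * seq_norm I \<mu> \<theta> r b"
    by (rule suminf_le_const[OF summable_abs_summand[OF x' b] sum_abs_summand_le[OF x' b]])
  finally show ?thesis using x False by (simp add: pointwise_sum_def)
qed

lemma pointwise_sum_measurable: "pointwise_sum b \<in> measurable_functions M"
proof -
  have [measurable]: "exceptional_set \<in> sets M" using exceptional_set_null by blast
  have "(\<lambda>x. if x \<in> exceptional_set then 0 else suminf (summand b x)) \<in> borel_measurable M"
    by measurable
  then show ?thesis unfolding pointwise_sum_def by (rule restrict_measurable_functions)
qed

lemma pointwise_sum_expansion:
  assumes b: "b \<in> seq_space I \<mu> \<theta> r"
  shows "sq_integrable M (pointwise_sum b)" "class_expansion M I e b (ae_class M (pointwise_sum b))"
proof -
  have "AE x in M. summand b x sums pointwise_sum b x"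
    using AE_not_in[OF exceptional_set_null] AE_space
    by eventually_elim (use pointwise_sum_sums[OF _ b] in auto)
  with pointwise_sum_measurable[of b]
  show "sq_integrable M (pointwise_sum b)" "class_expansion M I e b (ae_class M (pointwise_sum b))"
    by (auto simp: measurable_functions_def intro: pointwise_sum_class_expansion[OF b])
qed

text \<open>The Banach space of functions of the theorem. Its elements vanish on the exceptional set, so
  that the supremum norm is governed by the bound off that set.\<close>

definition function_power_space :: "('a \<Rightarrow> real) nspace" where
  "function_power_space =
     \<lparr> vcarrier = pointwise_sum ` vcarrier (coef_space I \<mu> \<theta> r),
       vzero = (\<lambda>x\<in>space M. 0),
       vadd = (\<lambda>f g. \<lambda>x\<in>space M. f x + g x),
       vscale = (\<lambda>a f. \<lambda>x\<in>space M. a * f x),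
       vnorm = (\<lambda>f. vnorm P (ae_class M f)) \<rparr>"

lemma function_power_space_simps [simp]:
  "vcarrier function_power_space = pointwise_sum ` vcarrier (coef_space I \<mu> \<theta> r)"
  "vzero function_power_space = (\<lambda>x\<in>space M. 0)"
  "vadd function_power_space f g = (\<lambda>x\<in>space M. f x + g x)"
  "vscale function_power_space a f = (\<lambda>x\<in>space M. a * f x)"
  "vnorm function_power_space f = vnorm P (ae_class M f)"
  by (simp_all add: function_power_space_def)

lemma pointwise_sum_add:
  assumes "b \<in> seq_space I \<mu> \<theta> r" "b' \<in> seq_space I \<mu> \<theta> r"
  shows "pointwise_sum (\<lambda>i. b i + b' i) = (\<lambda>x\<in>space M. pointwise_sum b x + pointwise_sum b' x)"
proof
  fix x
  have "summand (\<lambda>i. b i + b' i) x = (\<lambda>i. summand b x i + summand b' x i)"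
    by (auto simp: summand_def distrib_right)
  then show "pointwise_sum (\<lambda>i. b i + b' i) x = (\<lambda>x\<in>space M. pointwise_sum b x + pointwise_sum b' x) x"
    using suminf_add[OF summable_summand summable_summand, of x b x b'] assms
    by (simp add: pointwise_sum_def)
qed

lemma pointwise_sum_scale:
  assumes "b \<in> seq_space I \<mu> \<theta> r"
  shows "pointwise_sum (\<lambda>i. a * b i) = (\<lambda>x\<in>space M. a * pointwise_sum b x)"
proof
  fix x
  have "summand (\<lambda>i. a * b i) x = (\<lambda>i. a * summand b x i)"
    by (auto simp: summand_def)
  then show "pointwise_sum (\<lambda>i. a * b i) x = (\<lambda>x\<in>space M. a * pointwise_sum b x) x"
    using suminf_mult[OF summable_summand, of x b a] assms
    by (simp add: pointwise_sum_def)
qed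

lemma norm_pointwise_sum:
  assumes b: "b \<in> seq_space I \<mu> \<theta> r"
  shows "vnorm P (ae_class M (pointwise_sum b)) = seq_norm I \<mu> \<theta> r b"
  using power_space_norm[OF ae_class_in_L2 b] pointwise_sum_expansion[OF b] by simp

lemma inj_on_ae_class_pointwise_sum:
  "inj_on (\<lambda>b. ae_class M (pointwise_sum b)) (vcarrier (coef_space I \<mu> \<theta> r))"
proof (rule inj_onI)
  fix b b'
  assume b: "b \<in> vcarrier (coef_space I \<mu> \<theta> r)" and b': "b' \<in> vcarrier (coef_space I \<mu> \<theta> r)"
    and eq: "ae_class M (pointwise_sum b) = ae_class M (pointwise_sum b')"
  have S: "b \<in> seq_space I \<mu> \<theta> r" "b' \<in> seq_space I \<mu> \<theta> r" using b b' by simp_all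
  have ex: "class_expansion M I e b (ae_class M (pointwise_sum b))"
    "class_expansion M I e b' (ae_class M (pointwise_sum b))"
    using pointwise_sum_expansion(2)[OF S(1)] pointwise_sum_expansion(2)[OF S(2)] eq by simp_all
  show "b = b'"
  proof
    fix i
    show "b i = b' i"
    proof (cases "i \<in> I")
      case True
      show ?thesis
        by (rule class_expansion_coefficients_unique[OF
              ae_class_in_L2[OF pointwise_sum_expansion(1)[OF S(1)]] ex True])
    qed (use b b' in simp)
  qed
qed

lemma ae_class_pointwise_sum_image:
  "(\<lambda>b. ae_class M (pointwise_sum b)) ` vcarrier (coef_space I \<mu> \<theta> r) = vcarrier P"
proof
  show "(\<lambda>b. ae_class M (pointwise_sum b)) ` vcarrier (coef_space I \<mu> \<theta> r) \<subseteq> vcarrier P"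
    using pointwise_sum_expansion ae_class_in_L2 by (auto simp: power_space_simps(1))
  show "vcarrier P \<subseteq> (\<lambda>b. ae_class M (pointwise_sum b)) ` vcarrier (coef_space I \<mu> \<theta> r)"
  proof
    fix c assume "c \<in> vcarrier P"
    then obtain b where b: "b \<in> vcarrier (coef_space I \<mu> \<theta> r)" and ex: "class_expansion M I e b c"
      by (rule power_space_coefficients)
    have "class_expansion M I e b (ae_class M (pointwise_sum b))"
      using b by (intro pointwise_sum_expansion(2)) simp
    then have "c = ae_class M (pointwise_sum b)" by (rule class_expansion_unique[OF ex])
    then show "c \<in> (\<lambda>b. ae_class M (pointwise_sum b)) ` vcarrier (coef_space I \<mu> \<theta> r)"
      using b by blast
  qed
qed

lemma function_power_space_banach: "banach_vspace function_power_space"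
proof (rule isometric_iso_banach[OF coef_space_banach])
  have "inj_on pointwise_sum (vcarrier (coef_space I \<mu> \<theta> r))"
    using inj_on_imageI2[of "ae_class M" pointwise_sum] inj_on_ae_class_pointwise_sum
    by (simp add: comp_def)
  then show "isometric_iso (coef_space I \<mu> \<theta> r) function_power_space pointwise_sum"
    by (auto simp: isometric_iso_def vlinear_def bij_betw_def pointwise_sum_add pointwise_sum_scale
        norm_pointwise_sum)
  have "summand (\<lambda>i. 0) x = (\<lambda>i. 0)" for x by (auto simp: summand_def)
  then have "suminf (summand (\<lambda>i. 0) x) = 0" for x by simp
  then show "pointwise_sum (vzero (coef_space I \<mu> \<theta> r)) = vzero function_power_space"
    by (auto simp: pointwise_sum_def fun_eq_iff)
qed

lemma function_power_space_iso: "isometric_iso function_power_space P (ae_class M)"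
proof -
  have meas: "f \<in> borel_measurable M" if "f \<in> vcarrier function_power_space" for f
    using that pointwise_sum_measurable by (auto simp: measurable_functions_def)
  have "bij_betw (ae_class M) (vcarrier function_power_space) (vcarrier P)"
    using inj_on_ae_class_pointwise_sum ae_class_pointwise_sum_image
    unfolding bij_betw_def function_power_space_simps
    by (auto simp: image_image inj_on_def)
  moreover have "vlinear function_power_space P (ae_class M)"
    using ae_class_pointwise_sum_image meas
    by (auto simp: vlinear_def power_space_simps(3,4) ae_class_restrict class_add_ae_class class_scale_ae_class)
  ultimately show ?thesis by (simp add: isometric_iso_def)
qed

lemma function_power_space_inclusion: "normed_inclusion function_power_space (bounded_functions M)"
proof (intro normed_inclusion.intro normed_inclusion_axioms.intro)
  show "normed_vspace function_power_space"
    using function_power_space_banach by (simp add: banach_vspace_def)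
  show "vcarrier function_power_space \<subseteq> vcarrier (bounded_functions M)"
    using pointwise_sum_measurable pointwise_sum_bound by (auto simp: bounded_image_iff)
qed (auto simp: bounded_functions_normed)

lemma function_power_space_sup_norm_le:
  assumes f: "f \<in> vcarrier function_power_space"
  shows "vnorm (bounded_functions M) f \<le> K * vnorm function_power_space f"
proof -
  obtain b where b: "b \<in> seq_space I \<mu> \<theta> r" "f = pointwise_sum b" using f by auto
  have "bounded (f ` space M)"
    using pointwise_sum_bound[OF _ b(1)] unfolding b(2) bounded_image_iff by blast
  then show ?thesis
    using pointwise_sum_bound[OF _ b(1)] K_nonneg seq_norm_nonneg[OF b(1)]
    by (simp add: bounded_functions_norm_le_iff b(2) norm_pointwise_sum[OF b(1)])
qed

lemma function_power_space_embeds: "embeds function_power_space (bounded_functions M)"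
  using function_power_space_sup_norm_le
  unfolding normed_inclusion.embeds_iff[OF function_power_space_inclusion] by blast

text \<open>The essential supremum is at most the supremum, which gives one inequality; the other one is
  the pointwise bound by \<open>K\<close>.\<close>

lemma function_power_space_embedding_norm:
  "embedding_norm function_power_space (bounded_functions M) = K"
proof (rule order_antisym)
  note V = function_power_space_inclusion and PL = power_space_L_infinity_inclusion
  have "vnorm (bounded_functions M) f \<le> K" if "f \<in> vunit_ball function_power_space" for f
  proof -
    have f: "f \<in> vcarrier function_power_space" "vnorm function_power_space f \<le> 1"
      using that by (auto simp: vunit_ball_def)
    have "vnorm (bounded_functions M) f \<le> K * vnorm function_power_space f"
      by (rule function_power_space_sup_norm_le[OF f(1)])
    also have "\<dots> \<le> K * 1" using f(2) K_nonneg by (rule mult_left_mono)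
    finally show ?thesis by simp
  qed
  then show "embedding_norm function_power_space (bounded_functions M) \<le> K"
    unfolding embedding_norm_def operator_norm_def
    using normed_inclusion.zero_in_unit_ball[OF V] by (intro cSUP_least) auto
  have "vnorm (L_infinity M) c \<le> embedding_norm function_power_space (bounded_functions M)"
    if c: "c \<in> vunit_ball P" for c
  proof -
    have "vcarrier P = ae_class M ` vcarrier function_power_space"
      using function_power_space_iso unfolding isometric_iso_def bij_betw_def by blast
    then have "c \<in> ae_class M ` vcarrier function_power_space"
      using c unfolding vunit_ball_def by blast
    then obtain f where f: "f \<in> vcarrier function_power_space" "c = ae_class M f"
      by (rule imageE)
    then have ball: "f \<in> vunit_ball function_power_space" using c by (simp add: vunit_ball_def)
    have carrier: "f \<in> vcarrier (bounded_functions M)"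
      using f(1) normed_inclusion.carrier_subset[OF V] by blast
    then have bdd: "bounded (f ` space M)" and meas: "f \<in> borel_measurable M"
      by (auto simp: measurable_functions_def)
    have "vnorm (L_infinity M) c \<le> vnorm (bounded_functions M) f"
      unfolding f(2)
      using bounded_functions_norm_le_iff[OF bdd, of "vnorm (bounded_functions M) f"]
      by (intro L_infinity_norm_le[OF meas]) auto
    also have "\<dots> \<le> embedding_norm function_power_space (bounded_functions M)"
      by (rule normed_inclusion.norm_le_embedding_norm[OF V function_power_space_embeds ball])
    finally show ?thesis .
  qed
  then show "K \<le> embedding_norm function_power_space (bounded_functions M)"
    unfolding embedding_norm_def[of P] operator_norm_def[of P]
    using normed_inclusion.zero_in_unit_ball[OF PL] by (intro cSUP_least) auto
qed

lemma function_power_space_BSF: "BSF (space M) function_power_space"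
proof -
  have "function_space (space M) function_power_space"
    using pointwise_sum_measurable by (auto simp: function_space_def measurable_functions_def)
  moreover have "\<bar>f x\<bar> \<le> K * vnorm function_power_space f"
    if f: "f \<in> vcarrier function_power_space" and x: "x \<in> space M" for f x
  proof -
    obtain b where b: "b \<in> seq_space I \<mu> \<theta> r" "f = pointwise_sum b" using f by auto
    then show ?thesis using pointwise_sum_bound[OF x b(1)] by (simp add: norm_pointwise_sum)
  qed
  ultimately show ?thesis
    unfolding BSF_def using function_power_space_banach by blast
qed

end

theorem theorem3p2:
  fixes M :: "'a measure"
    and H :: "('a \<Rightarrow> real) ipspace"
    and k :: "'a \<Rightarrow> 'a \<Rightarrow> real"
    and I :: "nat set"
    and \<mu> :: "nat \<Rightarrow> real"
    and e :: "nat \<Rightarrow> 'a \<Rightarrow> real"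
    and \<theta> :: real
    and r :: ereal
  assumes "sigma_finite_measure M"
    and "RKHS (space M) H k"
    and "(\<lambda>(x, y). k x y) \<in> borel_measurable (M \<Otimes>\<^sub>M M)"
    and "bounded ((\<lambda>(x, y). k x y) ` (space M \<times> space M))"
    and "compactly_embedded_L2 M H"
    and "eigensystem M H I \<mu> e"
    and "0 < \<theta>" and "\<theta> < 1" and "1 \<le> r"
    and "embeds (power_space M I \<mu> e \<theta> r) (L_infinity M)"
  shows "\<exists>V :: ('a \<Rightarrow> real) nspace.
    BSF (space M) V \<and>
    vcarrier V \<subseteq> measurable_functions M \<and>
    isometric_iso V (power_space M I \<mu> e \<theta> r) (ae_class M) \<and>
    embeds V (bounded_functions M) \<and>
    embedding_norm V (bounded_functions M) =
      embedding_norm (power_space M I \<mu> e \<theta> r) (L_infinity M) \<and>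
    (\<exists>N\<in>null_sets M. \<forall>f\<in>vcarrier V. \<exists>b\<in>seq_space I \<mu> \<theta> r. \<forall>x\<in>space M - N.
       (\<lambda>i. if i \<in> I then b i * e i x else 0) sums f x)"
proof -
  have H: "hilbert_vspace H" using assms(2) by (simp add: RKHS_def)
  note emb = assms(5) and sys = assms(6)
  interpret embedded_expansion I \<mu> \<theta> r M e
  proof
    show "0 < \<mu> i" if "i \<in> I" for i by (rule eigenvalue_pos[OF H emb sys that])
    show "finite {i \<in> I. \<epsilon> < \<mu> i}" if "0 < \<epsilon>" for \<epsilon>
      by (rule finite_eigenvalues_above[OF H emb sys that])
    have e: "sq_integrable M (e i)" if "i \<in> I" for i
      using sys that by (intro sq_integrable_RKHS[OF H emb]) (simp add: eigensystem_def)
    then show "sq_integrable M (e i)" if "i \<in> I" for i using that .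
    show "(\<integral>x. e i x * e j x \<partial>M) = (if i = j then 1 else 0)" if "i \<in> I" "j \<in> I" for i j
      using eigensystem_L2_orthonormal(2)[OF sys that] L2_inner[OF e[OF that(1)] e[OF that(2)]] by simp
  qed (use assms in auto)
  have "\<exists>b\<in>seq_space I \<mu> \<theta> r. \<forall>x\<in>space M - exceptional_set.
       (\<lambda>i. if i \<in> I then b i * e i x else 0) sums f x" if f: "f \<in> vcarrier function_power_space" for f
  proof -
    obtain b where b: "b \<in> seq_space I \<mu> \<theta> r" "f = pointwise_sum b" using f by auto
    then show ?thesis using pointwise_sum_sums[OF _ b(1)] unfolding summand_def[abs_def] by blast
  qed
  then have "\<exists>N\<in>null_sets M. \<forall>f\<in>vcarrier function_power_space. \<exists>b\<in>seq_space I \<mu> \<theta> r.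
      \<forall>x\<in>space M - N. (\<lambda>i. if i \<in> I then b i * e i x else 0) sums f x"
    using exceptional_set_null by blast
  moreover have "vcarrier function_power_space \<subseteq> measurable_functions M"
    using pointwise_sum_measurable by auto
  ultimately show ?thesis
    using function_power_space_BSF function_power_space_iso function_power_space_embeds
      function_power_space_embedding_norm by blast
qed

end
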